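(* Let $\alpha,\beta$ be algebraically independent indeterminates over $\mathbb Q$ and let $W$ be a finitely generated primitive axial algebra of Monster type $(\alpha,\beta)$ over the field $\mathbb Q(\alpha,\beta)$. Then the Miyamoto group of $W$ is a group of $3$-transpositions; that is, the product of any two Miyamoto involutions of $W$ has order at most $3$.
   Context: Write $\mathbb F=\mathbb Q(\alpha,\beta)$. For a commutative, not necessarily associative $\mathbb F$-algebra $W$, $a\in W$ and $\lambda\in\mathbb F$, let $W_\lambda^a=\{v\in W : va=\lambda v\}$. The Monster fusion law $\mathcal M(\alpha,\beta)$ is the symmetric map $\star$ from $\{1,0,\alpha,\beta\}^2$ to the set of subsets of $\{1,0,\alpha,\beta\}$ given by $1\star1=\{1\}$, $1\star0=\emptyset$, $1\star\alpha=\{\alpha\}$, $1\star\beta=\{\beta\}$, $0\star0=\{0\}$, $0\star\alpha=\{\alpha\}$, $0\star\beta=\{\beta\}$, $\alpha\star\alpha=\{1,0\}$, $\alpha\star\beta=\{\beta\}$, $\beta\star\beta=\{1,0,\alpha\}$. A primitive axis of Monster type $(\alpha,\beta)$ in $W$ is a nonzero idempotent $a$ such that $W=W_1^a\oplus W_0^a\oplus W_\alpha^a\oplus W_\beta^a$, $W_\lambda^aW_\mu^a\subseteq\sum_{\nu\in\lambda\star\mu}W_\nu^a$ for all $\lambda,\mu$, and $W_1^a=\mathbb Fa$. A finitely generated primitive axial algebra of Monster type $(\alpha,\beta)$ is a commutative non-associative $\mathbb F$-algebra generated, as an algebra, by a finite set of such axes. Since the fusion law is $\mathbb Z_2$-graded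 with even part $\{1,0,\alpha\}$ and odd part $\{\beta\}$, every such axis $a$ induces an algebra automorphism $\tau_a$ of $W$, acting as the identity on $W_1^a\oplus W_0^a\oplus W_\alpha^a$ and as $-1$ on $W_\beta^a$, called the Miyamoto involution of $a$ (it may be trivial). The Miyamoto group of $W$ is the group generated by all the Miyamoto involutions $\tau_a$, $a$ ranging over the primitive axes of Monster type $(\alpha,\beta)$ of $W$. A group of $3$-transpositions is a group generated by a conjugation-invariant set of involutions such that the product of any two of them has order at most $3$. *)

theory Defs
  imports
    "HOL-Computational_Algebra.Polynomial_Factorial"
    "HOL-Algebra.Bij"
    "HOL-Algebra.Generated_Groups"
    "HOL-Algebra.Multiplicative_Group"
begin

text \<open>
  The field of rational functions in two indeterminates over the rationals, realised as the
  field of fractions of the iterated polynomial ring. The first indeterminate is the variable of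
  the inner polynomial ring, the second one that of the outer polynomial ring.
\<close>

type_synonym ratfun2 = "rat poly poly fract"

definition indet_alpha :: ratfun2
  where "indet_alpha = to_fract [:[:0, 1:]:]"

definition indet_beta :: ratfun2
  where "indet_beta = to_fract [:0, 1:]"


text \<open>
  The fusion law depends only on the unordered pair of its arguments; a singleton on the left
  of a test is the pair with two equal components. The law is meant for pairwise distinct
  1, 0, a, b; its value outside these arguments is irrelevant.
\<close>

definition monster_law :: "'f::field \<Rightarrow> 'f \<Rightarrow> 'f \<Rightarrow> 'f \<Rightarrow> 'f set"
  where "monster_law a b x y =
    (if {1} = {x, y} then {1}
     else if {1, 0} = {x, y} then {}
     else if {1, a} = {x, y} then {a}
     else if {1, b} = {x, y} then {b}
     else if {0} = {x, y} then {0}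
     else if {0, a} = {x, y} then {a}
     else if {0, b} = {x, y} then {b}
     else if {a} = {x, y} then {1, 0}
     else if {a, b} = {x, y} then {b}
     else if {b} = {x, y} then {1, 0, a}
     else {})"


locale commutative_nonassoc_algebra = vector_space scale
  for scale :: "'f::field \<Rightarrow> 'w::ab_group_add \<Rightarrow> 'w" (infixr \<open>*s\<close> 75) +
  fixes mult :: "'w \<Rightarrow> 'w \<Rightarrow> 'w" (infixl \<open>\<odot>\<close> 70)
  assumes mult_commute: "x \<odot> y = y \<odot> x"
    and mult_add_left: "(x + y) \<odot> z = x \<odot> z + y \<odot> z"
    and mult_scale_left: "(c *s x) \<odot> y = c *s (x \<odot> y)"
begin

definition subalgebra :: "'w set \<Rightarrow> bool"
  where "subalgebra S \<longleftrightarrow> subspace S \<and> (\<forall>x\<in>S. \<forall>y\<in>S. x \<odot> y \<in> S)"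

definition eigenspace :: "'w \<Rightarrow> 'f \<Rightarrow> 'w set"
  where "eigenspace a l = {v. v \<odot> a = l *s v}"

end


locale monster_algebra = commutative_nonassoc_algebra scale mult
  for scale :: "'f::field \<Rightarrow> 'w::ab_group_add \<Rightarrow> 'w" (infixr \<open>*s\<close> 75)
    and mult :: "'w \<Rightarrow> 'w \<Rightarrow> 'w" (infixl \<open>\<odot>\<close> 70) +
  fixes \<alpha> \<beta> :: 'f
begin

definition primitive_axis :: "'w \<Rightarrow> bool"
  where "primitive_axis a \<longleftrightarrow>
    a \<noteq> 0 \<and> a \<odot> a = a \<and>
    (\<forall>v. \<exists>!f. f \<in> (\<Pi>\<^sub>E l\<in>{1, 0, \<alpha>, \<beta>}. eigenspace a l) \<and> v = (\<Sum>l\<in>{1, 0, \<alpha>, \<beta>}. f l)) \<and>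
    (\<forall>l\<in>{1, 0, \<alpha>, \<beta>}. \<forall>m\<in>{1, 0, \<alpha>, \<beta>}. \<forall>x\<in>eigenspace a l. \<forall>y\<in>eigenspace a m.
       x \<odot> y \<in> span (\<Union>n\<in>monster_law \<alpha> \<beta> l m. eigenspace a n)) \<and>
    eigenspace a 1 = range (\<lambda>c. c *s a)"

text \<open>
  For a primitive axis the eigenspaces decompose the algebra, so the linear map below exists
  and is unique (for pairwise distinct 1, 0, \<open>\<alpha>\<close>, \<open>\<beta>\<close>); it is the
  identity on the even part because it is the identity on the three even eigenspaces. It is then
  an algebra automorphism by the grading of the fusion law.
\<close>

definition miyamoto_involution :: "'w \<Rightarrow> 'w \<Rightarrow> 'w"
  where "miyamoto_involution a =
    (THE t. Vector_Spaces.linear scale scale t \<and>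
       (\<forall>l\<in>{1, 0, \<alpha>}. \<forall>v\<in>eigenspace a l. t v = v) \<and>
       (\<forall>v\<in>eigenspace a \<beta>. t v = - v))"

text \<open>The subgroup generated inside the group of all bijections of the algebra.\<close>

definition miyamoto_group :: "('w \<Rightarrow> 'w) monoid"
  where "miyamoto_group =
    (BijGroup UNIV)
      \<lparr>carrier := generate (BijGroup UNIV) (miyamoto_involution ` {a. primitive_axis a})\<rparr>"

end


locale fg_primitive_axial_algebra = monster_algebra +
  assumes finitely_generated:
    "\<exists>A. finite A \<and> (\<forall>a\<in>A. primitive_axis a) \<and> subalgebra hull A = UNIV"


text \<open>The library's element order is 0 for elements of infinite order.\<close>

definition order_at_most :: "('g, 'm) monoid_scheme \<Rightarrow> nat \<Rightarrow> 'g \<Rightarrow> bool"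
  where "order_at_most G n x \<longleftrightarrow> 0 < group.ord G x \<and> group.ord G x \<le> n"

definition three_transposition_group :: "('g, 'm) monoid_scheme \<Rightarrow> bool"
  where "three_transposition_group G \<longleftrightarrow>
    group G \<and>
    (\<exists>D \<subseteq> carrier G.
       generate G D = carrier G \<and>
       (\<forall>g\<in>carrier G. \<forall>d\<in>D. g \<otimes>\<^bsub>G\<^esub> d \<otimes>\<^bsub>G\<^esub> inv\<^bsub>G\<^esub> g \<in> D) \<and>
       (\<forall>d\<in>D. group.ord G d = 2) \<and>
       (\<forall>c\<in>D. \<forall>d\<in>D. order_at_most G 3 (c \<otimes>\<^bsub>G\<^esub> d)))"

end

theory Submission
  imports Defs
begin

text \<open>
  Two Miyamoto involutions generate a dihedral group, and its orbits on the two axes \<open>a\<close>, \<open>b\<close>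
  form one bi-infinite sequence \<open>A\<close> with \<open>A 0 = a\<close>, \<open>A 1 = b\<close> in which the involution of
  \<open>A n\<close> sends \<open>A m\<close> to \<open>A (2 n - m)\<close>. The heart of the matter is \<open>two_axes\<close>: the
  dihedral group fixes \<open>A 0\<close>, or it fixes \<open>A 1\<close>, or \<open>A (-1) = A 2\<close>. As an automorphism
  conjugates the involution of an axis to the involution of the image, the two involutions
  commute in the first two cases; in the third one \<open>\<tau>\<^sub>a \<tau>\<^sub>b \<tau>\<^sub>a\<close> and \<open>\<tau>\<^sub>b \<tau>\<^sub>a \<tau>\<^sub>b\<close> are the
  involutions of the same axis, so that \<open>\<tau>\<^sub>a \<tau>\<^sub>b\<close> has order dividing 3.

  Let \<open>Z\<close> be the subalgebra of the invariants of the dihedral group. It contains the modified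
  products \<open>sg x y = x y - \<beta> (x + y)\<close> of axes at distance 1 and 2, namely
  \<open>s = sg (A 0) (A 1)\<close>, \<open>p = sg (A 0) (A 2)\<close> and \<open>q = sg (A 1) (A (-1))\<close>.
  The fusion law of the single axis \<open>A 0\<close> determines the products of \<open>A 0\<close> with \<open>s\<close>, \<open>p\<close>,
  \<open>q\<close> and the square of \<open>s\<close>: all of them are explicit linear combinations of \<open>s\<close>, \<open>p\<close>, \<open>q\<close> and
  of the axes \<open>A (-2), ..., A 2\<close>, with coefficients that are polynomials in \<open>\<alpha>\<close>, \<open>\<beta>\<close> and
  the projections of the axes on each other, up to a factor \<open>\<alpha> - 2 \<beta>\<close> or \<open>\<alpha> - \<beta>\<close>. Two
  consequences drive everything. Since \<open>s\<^sup>2\<close> is invariant, five consecutive axes satisfy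
  modulo \<open>Z\<close> a linear recurrence with coefficients \<open>c, d, e, d, c\<close>. Since \<open>s\<close> looks the
  same from \<open>A 0\<close> and from \<open>A 1\<close>, the two formulas for \<open>s\<^sup>2\<close> agree, which is a relation in
  the algebra itself (\<open>two_squares\<close>); it can be multiplied by an axis or projected on an
  eigenspace. All computations modulo \<open>Z\<close> are done with linear functionals that vanish on \<open>Z\<close>.

  If the projections of \<open>A 0\<close> and \<open>A 1\<close> on each other agree, and likewise at distance 2,
  elimination yields \<open>A 1 + A (-1) = N A 0\<close> modulo \<open>Z\<close> for a scalar \<open>N\<close>
  (\<open>symmetric_ratio\<close>), and squaring this congruence forces \<open>N \<in> {0, -1}\<close>
  (\<open>ratio_zero_or_minus_one\<close>). The same holds at \<open>A 1\<close>. The combination \<open>(0, 0)\<close> means that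
  the sequence has period 4 and is ruled out by \<open>no_four_axes\<close>; \<open>(-1, -1)\<close> leads to
  \<open>A (-1) = A 2\<close> by \<open>three_axes\<close>; the mixed ones are impossible. An arbitrary pair is
  reduced to this: the sequences of the axes of even and of odd index do have the symmetry,
  because the dihedral group translates indices by 2. Hence \<open>A 0 + A 2\<close> or
  \<open>A (-2) + A 0 + A 2\<close> is invariant, the same holds for the odd indices, and each of
  the four combinations is either contradictory or forces the original pair to be symmetric.

  The elimination works unless certain polynomials in \<open>\<alpha>\<close>, \<open>\<beta>\<close> and the projections vanish
  simultaneously. This is where the independence of \<open>\<alpha>\<close> and \<open>\<beta>\<close> enters. A rational function of
  \<open>\<alpha>\<close>, \<open>\<beta>\<close> that is defined and non-zero at one rational point is not zero. In an exceptional
  case the projections are solutions of linear equations whose leading coefficients are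
  non-zero at the point \<open>(3, 2)\<close>, so they have rational values there, and one more equation
  is violated by these values.
\<close>

(* The infix symbol is used for the product of the algebra. *)
no_notation Module.smult (infixl "\<odot>\<index>" 70)

section \<open>Specialising two independent indeterminates\<close>

text \<open>
  The pairs of an element \<open>x\<close> and its value \<open>r\<close> when \<open>a\<close> and \<open>b\<close> become the rational numbers
  \<open>u\<close> and \<open>v\<close>. Division by elements of non-zero value is included: for independent \<open>a\<close>, \<open>b\<close>
  the domain is a local ring, the rational functions that are defined at the point \<open>(u, v)\<close>.
  The introduction rules compute the value of a given expression by repeated resolution.
\<close>

inductive specializes :: "'f::field_char_0 \<Rightarrow> 'f \<Rightarrow> rat \<Rightarrow> rat \<Rightarrow> 'f \<Rightarrow> rat \<Rightarrow> bool"
  for a b :: 'f and u v :: rat where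
  sp_fst: "specializes a b u v a u"
| sp_snd: "specializes a b u v b v"
| sp_zero: "specializes a b u v 0 0"
| sp_one: "specializes a b u v 1 1"
| sp_num: "specializes a b u v (numeral n) (numeral n)"
| sp_add: "specializes a b u v x r \<Longrightarrow> specializes a b u v y s \<Longrightarrow> specializes a b u v (x + y) (r + s)"
| sp_diff: "specializes a b u v x r \<Longrightarrow> specializes a b u v y s \<Longrightarrow> specializes a b u v (x - y) (r - s)"
| sp_minus: "specializes a b u v x r \<Longrightarrow> specializes a b u v (- x) (- r)"
| sp_mult: "specializes a b u v x r \<Longrightarrow> specializes a b u v y s \<Longrightarrow> specializes a b u v (x * y) (r * s)"
| sp_power: "specializes a b u v x r \<Longrightarrow> specializes a b u v (x ^ n) (r ^ n)"
| sp_divide: "specializes a b u v x r \<Longrightarrow> specializes a b u v y s \<Longrightarrow> s \<noteq> 0 \<Longrightarrow>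
    specializes a b u v (x / y) (r / s)"

text \<open>
  A value is attached to a rational function through any way of writing it as a fraction with
  a denominator that does not vanish at the point; by induction every element with a value \<open>r\<close>
  is such a fraction with the quotient of the evaluated polynomials equal to \<open>r\<close>, so \<open>r \<noteq> 0\<close>
  makes the numerator non-zero.
\<close>

lemma specializes_ratfun2:
  assumes "specializes indet_alpha indet_beta u v x r" "r \<noteq> 0"
  shows "x \<noteq> 0"
proof -
  \<comment> \<open>The inner variable is the first indeterminate, hence the order of the two evaluations.\<close>
  define E where "E q = poly (poly q [:v:]) u" for q
  have E: "E 0 = 0" "E 1 = 1" "E (p + q) = E p + E q" "E (p - q) = E p - E q" "E (- p) = - E p"
    "E (p * q) = E p * E q" "E (p ^ n) = E p ^ n" "E (numeral k) = numeral k" for p q n k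
    by (simp_all add: E_def poly_power)
  define frac where "frac x r \<longleftrightarrow> (\<exists>p q. x = to_fract p / to_fract q \<and> E q \<noteq> 0 \<and> r = E p / E q)" for x r
  have fracI: "frac x r" if "x = to_fract p / to_fract q" "E q \<noteq> 0" "r = E p / E q" for x r p q
    using that by (auto simp: frac_def)
  have nz: "to_fract q \<noteq> 0" if "E q \<noteq> 0" for q
    using that E(1) by (auto simp: to_fract_eq_0_iff)
  have poly: "frac (to_fract p) (E p)" for p
    by (rule fracI[of _ p 1]) (simp_all add: E)
  have add: "frac (x + y) (r + s)" if "frac x r" "frac y s" for x y r s
  proof -
    from that obtain p q p' q' where *: "x = to_fract p / to_fract q" "E q \<noteq> 0" "r = E p / E q"
      "y = to_fract p' / to_fract q'" "E q' \<noteq> 0" "s = E p' / E q'" by (auto simp: frac_def)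
    show ?thesis
      by (rule fracI[of _ "p * q' + p' * q" "q * q'"])
        (use * nz[OF *(2)] nz[OF *(5)] in \<open>simp_all add: E to_fract_add to_fract_mult add_frac_eq\<close>)
  qed
  have mult: "frac (x * y) (r * s)" if "frac x r" "frac y s" for x y r s
  proof -
    from that obtain p q p' q' where *: "x = to_fract p / to_fract q" "E q \<noteq> 0" "r = E p / E q"
      "y = to_fract p' / to_fract q'" "E q' \<noteq> 0" "s = E p' / E q'" by (auto simp: frac_def)
    show ?thesis
      by (rule fracI[of _ "p * p'" "q * q'"]) (use * in \<open>simp_all add: E to_fract_mult\<close>)
  qed
  have minus: "frac (- x) (- r)" if "frac x r" for x r
    using mult[OF poly[of "-1"] that] by (simp add: E to_fract_uminus)
  have "frac x r"
    using assms(1)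
  proof induction
    case sp_fst
    show ?case using poly[of "[:[:0, 1:]:]"] by (simp add: indet_alpha_def E_def)
  next
    case sp_snd
    show ?case using poly[of "[:0, 1:]"] by (simp add: indet_beta_def E_def)
  next
    case sp_zero
    show ?case using poly[of 0] by (simp add: E)
  next
    case sp_one
    show ?case using poly[of 1] by (simp add: E)
  next
    case (sp_num n)
    have "to_fract (of_nat k :: rat poly poly) = of_nat k" for k
      by (induction k) simp_all
    from this[of "numeral n"] show ?case using poly[of "numeral n"] by (simp add: E)
  next
    case (sp_add x r y s)
    then show ?case by (simp add: add)
  next
    case (sp_diff x r y s)
    then show ?case using add[of x r "- y" "- s"] minus[of y s] by simp
  next
    case (sp_minus x r)
    then show ?case by (simp add: minus)
  next
    case (sp_mult x r y s)
    then show ?case by (simp add: mult)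
  next
    case (sp_power x r n)
    have "frac (x ^ n) (r ^ n)"
    proof (induction n)
      case 0
      show ?case using poly[of 1] by (simp add: E)
    next
      case (Suc n)
      then show ?case using mult[OF sp_power.IH Suc] by simp
    qed
    then show ?case .
  next
    case (sp_divide x r y s)
    then obtain p q where *: "y = to_fract p / to_fract q" "E q \<noteq> 0" "s = E p / E q" by (auto simp: frac_def)
    then have "frac (1 / y) (1 / s)"
      using sp_divide.hyps nz[OF *(2)] by (intro fracI[of _ q p]) auto
    from mult[OF sp_divide.IH(1) this] show ?case by simp
  qed
  with assms(2) nz show ?thesis by (auto simp: frac_def E)
qed

section \<open>Linear functionals\<close>

context commutative_nonassoc_algebra
begin

definition linear_form :: "('w \<Rightarrow> 'f) \<Rightarrow> bool"
  where "linear_form f \<longleftrightarrow> (\<forall>x y. f (x + y) = f x + f y) \<and> (\<forall>c x. f (scale c x) = c * f x)"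

lemma
  fixes f :: "'w \<Rightarrow> 'f"
  assumes f: "linear_form f"
  shows linear_form_add: "f (x + y) = f x + f y"
    and linear_form_scale: "f (scale c x) = c * f x"
    and linear_form_0: "f 0 = 0"
    and linear_form_minus: "f (- x) = - f x"
    and linear_form_diff: "f (x - y) = f x - f y"
proof -
  show add: "f (x + y) = f x + f y" for x y using f by (simp add: linear_form_def)
  show sc: "f (scale c x) = c * f x" for c x using f by (simp add: linear_form_def)
  show "f 0 = 0" using sc[of 0 0] by simp
  show m: "f (- x) = - f x" for x using sc[of "-1" x] by simp
  show "f (x - y) = f x - f y" using add[of x "- y"] m[of y] by simp
qed

lemmas linear_form_simps = linear_form_add linear_form_scale linear_form_0 linear_form_minus linear_form_diff

text \<open>
  Functionals separate a subspace from the vectors outside of it. This lets computations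
  modulo the invariants of a dihedral group, and all identities between linear combinations,
  take place in the base field.
\<close>

lemma mem_subspaceI:
  assumes S: "subspace S"
    and x: "\<And>f :: 'w \<Rightarrow> 'f. linear_form f \<Longrightarrow> (\<And>z. z \<in> S \<Longrightarrow> f z = 0) \<Longrightarrow> f x = 0"
  shows "x \<in> S"
proof (rule ccontr)
  assume "x \<notin> S"
  interpret K: vector_space "(*) :: 'f \<Rightarrow> 'f \<Rightarrow> 'f"
    by unfold_locales (simp_all add: algebra_simps)
  interpret P: vector_space_pair scale "(*) :: 'f \<Rightarrow> 'f \<Rightarrow> 'f" ..
  obtain B where B: "B \<subseteq> S" "independent B" "S \<subseteq> span B"
    using maximal_independent_subset by blast
  have "span B = S" using B S by (simp add: span_minimal subset_antisym)
  then have "independent (insert x B)"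
    using \<open>x \<notin> S\<close> B by (simp add: independent_insertI)
  then obtain g where g: "Vector_Spaces.linear scale (*) g"
    "\<forall>y\<in>insert x B. g y = (if y = x then 1 else 0)"
    using P.linear_independent_extend[of "insert x B" "\<lambda>y. if y = x then 1 else 0"] by blast
  have "linear_form g"
    using P.linear_add[OF g(1)] P.linear_scale[OF g(1)] by (simp add: linear_form_def)
  have "x \<notin> B" using \<open>x \<notin> S\<close> B by blast
  then have "g b = 0" if "b \<in> B" for b using g(2) that by auto
  then have "g z = 0" if "z \<in> S" for z
    using P.linear_eq_0_on_span[OF g(1), of B z] that B(3) by blast
  from x[OF \<open>linear_form g\<close> this] g(2) show False by simp
qed

lemma eq_by_functionals:
  assumes "\<And>f :: 'w \<Rightarrow> 'f. linear_form f \<Longrightarrow> f x = f y"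
  shows "x = y"
proof -
  have "x - y \<in> {0}"
    by (rule mem_subspaceI) (simp_all add: assms linear_form_diff)
  then show ?thesis by simp
qed

end

section \<open>Eigenspace decompositions and Miyamoto involutions\<close>

text \<open>
  Genericity of the two parameters is only needed in the form that a non-zero value at some
  rational point makes an expression non-zero.
\<close>

locale generic_monster_algebra = monster_algebra scale mult \<alpha> \<beta>
  for scale :: "'f::field_char_0 \<Rightarrow> 'w::ab_group_add \<Rightarrow> 'w" (infixr \<open>*s\<close> 75)
    and mult :: "'w \<Rightarrow> 'w \<Rightarrow> 'w" (infixl \<open>\<odot>\<close> 70)
    and \<alpha> \<beta> :: 'f +
  assumes generic: "specializes \<alpha> \<beta> u v x r \<Longrightarrow> r \<noteq> 0 \<Longrightarrow> x \<noteq> 0"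
begin

lemmas sp_intros = sp_fst sp_snd sp_zero sp_one sp_num sp_add sp_diff sp_minus sp_mult sp_power sp_divide

lemma mult_add_right: "z \<odot> (x + y) = z \<odot> x + z \<odot> y"
  by (simp add: mult_commute[of z] mult_add_left)

lemma mult_scale_right: "y \<odot> (c *s x) = c *s (y \<odot> x)"
  by (simp add: mult_commute[of y] mult_scale_left)

lemma mult_0_left [simp]: "0 \<odot> x = 0"
  using mult_scale_left[of 0 0 x] by simp

lemma mult_0_right [simp]: "x \<odot> 0 = 0"
  by (simp add: mult_commute)

lemma mult_minus_left: "(- x) \<odot> y = - (x \<odot> y)"
  using mult_scale_left[of "-1" x y] by simp

lemma mult_minus_right: "y \<odot> (- x) = - (y \<odot> x)"
  using mult_scale_right[of y "-1" x] by simp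

lemma mult_diff_left: "(x - y) \<odot> z = x \<odot> z - y \<odot> z"
  using mult_add_left[of x "- y" z] by (simp add: mult_minus_left)

lemma mult_diff_right: "z \<odot> (x - y) = z \<odot> x - z \<odot> y"
  using mult_add_right[of z x "- y"] by (simp add: mult_minus_right)

lemmas bilinear = mult_add_left mult_add_right mult_scale_left mult_scale_right
  mult_minus_left mult_minus_right mult_diff_left mult_diff_right

lemma distinct_eigenvalues [simp]:
  "\<alpha> \<noteq> 0" "\<alpha> \<noteq> 1" "\<beta> \<noteq> 0" "\<beta> \<noteq> 1" "\<alpha> \<noteq> \<beta>"
  "0 \<noteq> \<alpha>" "1 \<noteq> \<alpha>" "0 \<noteq> \<beta>" "1 \<noteq> \<beta>" "\<beta> \<noteq> \<alpha>"
proof -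
  have "\<alpha> \<noteq> 0" by (rule generic[where u = 2 and v = 3], (rule sp_intros)+, simp)
  moreover have "\<beta> \<noteq> 0" by (rule generic[where u = 2 and v = 3], (rule sp_intros)+, simp)
  moreover have "\<alpha> - 1 \<noteq> 0" by (rule generic[where u = 2 and v = 3], (rule sp_intros)+, simp)
  moreover have "\<beta> - 1 \<noteq> 0" by (rule generic[where u = 2 and v = 3], (rule sp_intros)+, simp)
  moreover have "\<alpha> - \<beta> \<noteq> 0" by (rule generic[where u = 2 and v = 3], (rule sp_intros)+, simp)
  ultimately show "\<alpha> \<noteq> 0" "\<alpha> \<noteq> 1" "\<beta> \<noteq> 0" "\<beta> \<noteq> 1" "\<alpha> \<noteq> \<beta>"
    "0 \<noteq> \<alpha>" "1 \<noteq> \<alpha>" "0 \<noteq> \<beta>" "1 \<noteq> \<beta>" "\<beta> \<noteq> \<alpha>" by auto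
qed

lemma subspace_eigenspace: "subspace (eigenspace a l)"
  by (rule subspaceI)
    (auto simp: eigenspace_def bilinear scale_right_distrib scale_left_commute)

abbreviation eigenvalues :: "'f set" where "eigenvalues \<equiv> {1, 0, \<alpha>, \<beta>}"

text \<open>
  The components of a vector in the eigenspaces of an axis. The component in the 1-eigenspace
  is \<open>lam a v *s a\<close>; \<open>pz\<close>, \<open>pa\<close> and \<open>pb\<close> are the components for the eigenvalues 0, \<open>\<alpha>\<close> and
  \<open>\<beta>\<close>.
\<close>

definition part :: "'w \<Rightarrow> 'f \<Rightarrow> 'w \<Rightarrow> 'w" where
  "part a l v = (THE f. f \<in> (\<Pi>\<^sub>E l\<in>eigenvalues. eigenspace a l) \<and> v = (\<Sum>l\<in>eigenvalues. f l)) l"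

lemma sum_eigenvalues: "(\<Sum>l\<in>eigenvalues. f l) = f 1 + f 0 + f \<alpha> + (f \<beta> :: 'w)"
  by (simp add: add.assoc)

lemma part_props:
  assumes "primitive_axis a"
  shows "l \<in> eigenvalues \<Longrightarrow> part a l v \<in> eigenspace a l"
    and "v = part a 1 v + part a 0 v + part a \<alpha> v + part a \<beta> v"
proof -
  have "\<exists>!f. f \<in> (\<Pi>\<^sub>E l\<in>eigenvalues. eigenspace a l) \<and> v = (\<Sum>l\<in>eigenvalues. f l)"
    using assms by (simp add: primitive_axis_def)
  from theI'[OF this]
  have *: "(\<lambda>l. part a l v) \<in> (\<Pi>\<^sub>E l\<in>eigenvalues. eigenspace a l)"
    "v = (\<Sum>l\<in>eigenvalues. part a l v)" by (simp_all only: part_def)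
  show "part a l v \<in> eigenspace a l" if "l \<in> eigenvalues" using *(1) that by blast
  show "v = part a 1 v + part a 0 v + part a \<alpha> v + part a \<beta> v"
    using *(2) unfolding sum_eigenvalues .
qed

lemma part_unique:
  assumes a: "primitive_axis a"
    and x: "x\<^sub>1 \<in> eigenspace a 1" "x\<^sub>0 \<in> eigenspace a 0" "x\<^sub>2 \<in> eigenspace a \<alpha>" "x\<^sub>3 \<in> eigenspace a \<beta>"
  shows "part a 1 (x\<^sub>1 + x\<^sub>0 + x\<^sub>2 + x\<^sub>3) = x\<^sub>1 \<and> part a 0 (x\<^sub>1 + x\<^sub>0 + x\<^sub>2 + x\<^sub>3) = x\<^sub>0 \<and>
    part a \<alpha> (x\<^sub>1 + x\<^sub>0 + x\<^sub>2 + x\<^sub>3) = x\<^sub>2 \<and> part a \<beta> (x\<^sub>1 + x\<^sub>0 + x\<^sub>2 + x\<^sub>3) = x\<^sub>3"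
proof -
  define f where "f = (\<lambda>l\<in>eigenvalues. if l = 1 then x\<^sub>1 else if l = 0 then x\<^sub>0 else if l = \<alpha> then x\<^sub>2 else x\<^sub>3)"
  have f: "f 1 = x\<^sub>1" "f 0 = x\<^sub>0" "f \<alpha> = x\<^sub>2" "f \<beta> = x\<^sub>3" by (simp_all add: f_def)
  have "f \<in> (\<Pi>\<^sub>E l\<in>eigenvalues. eigenspace a l)" using x by (auto simp: f_def)
  moreover have "x\<^sub>1 + x\<^sub>0 + x\<^sub>2 + x\<^sub>3 = (\<Sum>l\<in>eigenvalues. f l)" by (simp only: sum_eigenvalues f)
  moreover have "\<exists>!g. g \<in> (\<Pi>\<^sub>E l\<in>eigenvalues. eigenspace a l) \<and> x\<^sub>1 + x\<^sub>0 + x\<^sub>2 + x\<^sub>3 = (\<Sum>l\<in>eigenvalues. g l)"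
    using a by (simp add: primitive_axis_def)
  ultimately have "(THE g. g \<in> (\<Pi>\<^sub>E l\<in>eigenvalues. eigenspace a l) \<and> x\<^sub>1 + x\<^sub>0 + x\<^sub>2 + x\<^sub>3 = (\<Sum>l\<in>eigenvalues. g l)) = f"
    by (intro the1_equality) auto
  then show ?thesis by (simp only: part_def f simp_thms)
qed

definition lam :: "'w \<Rightarrow> 'w \<Rightarrow> 'f" where "lam a v = (THE c. part a 1 v = c *s a)"
definition pz :: "'w \<Rightarrow> 'w \<Rightarrow> 'w" where "pz a = part a 0"
definition pa :: "'w \<Rightarrow> 'w \<Rightarrow> 'w" where "pa a = part a \<alpha>"
definition pb :: "'w \<Rightarrow> 'w \<Rightarrow> 'w" where "pb a = part a \<beta>"

lemma axis_nonzero: "primitive_axis a \<Longrightarrow> a \<noteq> 0"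
  and axis_idem: "primitive_axis a \<Longrightarrow> a \<odot> a = a"
  and axis_eigenspace_1: "primitive_axis a \<Longrightarrow> eigenspace a 1 = range (\<lambda>c. c *s a)"
  by (simp_all add: primitive_axis_def)

lemma lam_part: assumes "primitive_axis a" shows "part a 1 v = lam a v *s a"
proof -
  have "part a 1 v \<in> range (\<lambda>c. c *s a)"
    using part_props(1)[OF assms, of 1 v] axis_eigenspace_1[OF assms] by simp
  then obtain c where c: "part a 1 v = c *s a" by blast
  have "lam a v = c" unfolding lam_def c
    using axis_nonzero[OF assms] by (intro the_equality) auto
  with c show ?thesis by simp
qed

lemma axis_decomp: "primitive_axis a \<Longrightarrow> v = lam a v *s a + pz a v + pa a v + pb a v"
  using part_props(2)[of a v] by (simp add: lam_part pz_def pa_def pb_def)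

lemma axis_eigen:
  assumes "primitive_axis a"
  shows "pz a v \<odot> a = 0" "pa a v \<odot> a = \<alpha> *s pa a v" "pb a v \<odot> a = \<beta> *s pb a v"
  using part_props(1)[OF assms, of _ v] by (auto simp: eigenspace_def pz_def pa_def pb_def)

lemma axis_unique:
  assumes "primitive_axis a" "v = c *s a + x + y + z"
    "x \<odot> a = 0" "y \<odot> a = \<alpha> *s y" "z \<odot> a = \<beta> *s z"
  shows "lam a v = c" "pz a v = x" "pa a v = y" "pb a v = z"
proof -
  have "c *s a \<in> eigenspace a 1" "x \<in> eigenspace a 0" "y \<in> eigenspace a \<alpha>" "z \<in> eigenspace a \<beta>"
    using assms(3-5) axis_eigenspace_1[OF assms(1)] by (auto simp: eigenspace_def)
  from part_unique[OF assms(1) this]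
  have *: "part a 1 v = c *s a" "pz a v = x" "pa a v = y" "pb a v = z"
    by (simp_all add: assms(2) pz_def pa_def pb_def)
  then show "pz a v = x" "pa a v = y" "pb a v = z" by simp_all
  have "lam a v *s a = c *s a" using lam_part[OF assms(1)] *(1) by simp
  then show "lam a v = c" using axis_nonzero[OF assms(1)] by simp
qed

lemma axis_add:
  assumes "primitive_axis a"
  shows "lam a (v + w) = lam a v + lam a w" "pz a (v + w) = pz a v + pz a w"
    "pa a (v + w) = pa a v + pa a w" "pb a (v + w) = pb a v + pb a w"
proof -
  have "v + w = (lam a v + lam a w) *s a + (pz a v + pz a w) + (pa a v + pa a w) + (pb a v + pb a w)"
    by (subst axis_decomp[OF assms, of v], subst axis_decomp[OF assms, of w])
      (simp add: scale_left_distrib algebra_simps)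
  from axis_unique[OF assms this]
  show "lam a (v + w) = lam a v + lam a w" "pz a (v + w) = pz a v + pz a w"
    "pa a (v + w) = pa a v + pa a w" "pb a (v + w) = pb a v + pb a w"
    by (simp_all add: bilinear axis_eigen[OF assms] scale_right_distrib)
qed

lemma axis_scale:
  assumes "primitive_axis a"
  shows "lam a (c *s v) = c * lam a v" "pz a (c *s v) = c *s pz a v"
    "pa a (c *s v) = c *s pa a v" "pb a (c *s v) = c *s pb a v"
proof -
  have "c *s v = (c * lam a v) *s a + (c *s pz a v) + (c *s pa a v) + (c *s pb a v)"
    by (subst axis_decomp[OF assms, of v]) (simp add: scale_right_distrib)
  from axis_unique[OF assms this]
  show "lam a (c *s v) = c * lam a v" "pz a (c *s v) = c *s pz a v"
    "pa a (c *s v) = c *s pa a v" "pb a (c *s v) = c *s pb a v"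
    by (simp_all add: bilinear axis_eigen[OF assms] scale_left_commute)
qed

lemma axis_minus:
  assumes "primitive_axis a"
  shows "lam a (- v) = - lam a v" "pz a (- v) = - pz a v" "pa a (- v) = - pa a v" "pb a (- v) = - pb a v"
  using axis_scale[OF assms, of "-1" v] by simp_all

lemma axis_diff:
  assumes "primitive_axis a"
  shows "lam a (v - w) = lam a v - lam a w" "pz a (v - w) = pz a v - pz a w"
    "pa a (v - w) = pa a v - pa a w" "pb a (v - w) = pb a v - pb a w"
  using axis_add[OF assms, of v "- w"] by (simp_all add: axis_minus[OF assms])

lemma axis_zero:
  assumes "primitive_axis a"
  shows "lam a 0 = 0" "pz a 0 = 0" "pa a 0 = 0" "pb a 0 = 0"
  using axis_scale[OF assms, of 0 0] by simp_all

lemmas axis_linear = axis_add axis_scale axis_minus axis_diff axis_zero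

lemma axis_self:
  assumes "primitive_axis a"
  shows "lam a a = 1" "pz a a = 0" "pa a a = 0" "pb a a = 0"
  using axis_unique[OF assms, of a 1 0 0 0] by simp_all

lemma proj_zero_eigen:
  assumes "primitive_axis a" "x \<odot> a = 0"
  shows "lam a x = 0" "pz a x = x" "pa a x = 0" "pb a x = 0"
  using axis_unique[OF assms(1), of x 0 x 0 0] assms by simp_all

lemma proj_alpha_eigen:
  assumes "primitive_axis a" "x \<odot> a = \<alpha> *s x"
  shows "lam a x = 0" "pz a x = 0" "pa a x = x" "pb a x = 0"
  using axis_unique[OF assms(1), of x 0 0 x 0] assms by simp_all

lemma proj_beta_eigen:
  assumes "primitive_axis a" "x \<odot> a = \<beta> *s x"
  shows "lam a x = 0" "pz a x = 0" "pa a x = 0" "pb a x = x"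
  using axis_unique[OF assms(1), of x 0 0 0 x] assms by simp_all

lemma proj_idem [simp]:
  assumes "primitive_axis a"
  shows "lam a (pz a v) = 0" "lam a (pa a v) = 0" "lam a (pb a v) = 0"
    "pa a (pz a v) = 0" "pa a (pa a v) = pa a v" "pa a (pb a v) = 0"
    "pb a (pz a v) = 0" "pb a (pa a v) = 0" "pb a (pb a v) = pb a v"
  using proj_zero_eigen[OF assms axis_eigen(1)[OF assms, of v]]
    proj_alpha_eigen[OF assms axis_eigen(2)[OF assms, of v]]
    proj_beta_eigen[OF assms axis_eigen(3)[OF assms, of v]] by simp_all

lemma axis_mult:
  assumes "primitive_axis a"
  shows "a \<odot> v = lam a v *s a + \<alpha> *s pa a v + \<beta> *s pb a v"
proof -
  have "a \<odot> pz a v = 0" "a \<odot> pa a v = \<alpha> *s pa a v" "a \<odot> pb a v = \<beta> *s pb a v"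
    using axis_eigen[OF assms, of v] by (simp_all add: mult_commute)
  then show ?thesis
    by (subst axis_decomp[OF assms, of v]) (simp add: bilinear axis_idem[OF assms])
qed

lemma proj_axis_mult:
  assumes "primitive_axis a"
  shows "lam a (a \<odot> v) = lam a v" "pa a (a \<odot> v) = \<alpha> *s pa a v" "pb a (a \<odot> v) = \<beta> *s pb a v"
  by (simp_all add: axis_mult[OF assms] axis_linear[OF assms] axis_self[OF assms] assms)

lemma axis_fusion:
  assumes "primitive_axis a" "l \<in> eigenvalues" "m \<in> eigenvalues" "x \<in> eigenspace a l" "y \<in> eigenspace a m"
  shows "x \<odot> y \<in> span (\<Union>n\<in>monster_law \<alpha> \<beta> l m. eigenspace a n)"
  using assms unfolding primitive_axis_def by blast

lemma monster_law_values:
  "monster_law \<alpha> \<beta> 0 0 = {0}" "monster_law \<alpha> \<beta> 0 \<alpha> = {\<alpha>}" "monster_law \<alpha> \<beta> 0 \<beta> = {\<beta>}"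
  "monster_law \<alpha> \<beta> \<alpha> \<alpha> = {1, 0}" "monster_law \<alpha> \<beta> \<alpha> \<beta> = {\<beta>}" "monster_law \<alpha> \<beta> \<beta> \<beta> = {1, 0, \<alpha>}"
  by (auto simp: monster_law_def doubleton_eq_iff)

lemma fusion_single:
  assumes "primitive_axis a" "l \<in> eigenvalues" "m \<in> eigenvalues" "monster_law \<alpha> \<beta> l m = {n}"
    "x \<odot> a = l *s x" "y \<odot> a = m *s y"
  shows "(x \<odot> y) \<odot> a = n *s (x \<odot> y)"
proof -
  have "x \<odot> y \<in> span (eigenspace a n)"
    using axis_fusion[OF assms(1-3), of x y] assms(4-6) by (simp add: eigenspace_def)
  also have "span (eigenspace a n) = eigenspace a n"
    by (simp add: subspace_eigenspace)
  finally show ?thesis by (simp add: eigenspace_def)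
qed

lemma fusion_zero_zero:
  "primitive_axis a \<Longrightarrow> x \<odot> a = 0 \<Longrightarrow> y \<odot> a = 0 \<Longrightarrow> (x \<odot> y) \<odot> a = 0"
  using fusion_single[of a 0 0 0 x y] by (simp add: monster_law_values)

lemma fusion_zero_alpha:
  "primitive_axis a \<Longrightarrow> x \<odot> a = 0 \<Longrightarrow> y \<odot> a = \<alpha> *s y \<Longrightarrow> (x \<odot> y) \<odot> a = \<alpha> *s (x \<odot> y)"
  using fusion_single[of a 0 \<alpha> \<alpha> x y] by (simp add: monster_law_values)

lemma fusion_zero_beta:
  "primitive_axis a \<Longrightarrow> x \<odot> a = 0 \<Longrightarrow> y \<odot> a = \<beta> *s y \<Longrightarrow> (x \<odot> y) \<odot> a = \<beta> *s (x \<odot> y)"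
  using fusion_single[of a 0 \<beta> \<beta> x y] by (simp add: monster_law_values)

lemma fusion_alpha_beta:
  "primitive_axis a \<Longrightarrow> x \<odot> a = \<alpha> *s x \<Longrightarrow> y \<odot> a = \<beta> *s y \<Longrightarrow> (x \<odot> y) \<odot> a = \<beta> *s (x \<odot> y)"
  using fusion_single[of a \<alpha> \<beta> \<beta> x y] by (simp add: monster_law_values)

lemma eigenspace_1_proj:
  assumes a: "primitive_axis a" and "v \<in> eigenspace a 1"
  shows "pa a v = 0" "pb a v = 0"
proof -
  obtain c where "v = c *s a" using assms(2) axis_eigenspace_1[OF a] by blast
  then show "pa a v = 0" "pb a v = 0" by (simp_all add: axis_scale[OF a] axis_self[OF a])
qed

lemma eigenspace_0_proj:
  assumes a: "primitive_axis a" and "v \<in> eigenspace a 0"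
  shows "pa a v = 0" "pb a v = 0"
  using proj_zero_eigen[OF a, of v] assms(2) by (simp_all add: eigenspace_def)

lemma eigenspace_alpha_proj:
  assumes a: "primitive_axis a" and "v \<in> eigenspace a \<alpha>"
  shows "pb a v = 0"
  using proj_alpha_eigen(4)[OF a, of v] assms(2) by (simp add: eigenspace_def)

text \<open>
  A product of two \<open>\<alpha>\<close>-eigenvectors lies in a sum of two eigenspaces, which is conveniently
  expressed by the vanishing of the other projections. The same is done below for the product
  of two \<open>\<beta>\<close>-eigenvectors.
\<close>

lemma fusion_alpha_alpha:
  assumes a: "primitive_axis a" and x: "x \<odot> a = \<alpha> *s x" and y: "y \<odot> a = \<alpha> *s y"
  shows "pa a (x \<odot> y) = 0" "pb a (x \<odot> y) = 0"
proof -
  have "x \<in> eigenspace a \<alpha>" "y \<in> eigenspace a \<alpha>" using x y by (simp_all add: eigenspace_def)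
  from axis_fusion[OF a _ _ this]
  have "x \<odot> y \<in> span (eigenspace a 1 \<union> eigenspace a 0)" by (simp add: monster_law_values)
  also have "\<dots> \<subseteq> {v. pa a v = 0 \<and> pb a v = 0}"
  proof (rule span_minimal)
    show "subspace {v. pa a v = 0 \<and> pb a v = 0}"
      by (rule subspaceI) (simp_all add: axis_linear[OF a])
    show "eigenspace a 1 \<union> eigenspace a 0 \<subseteq> {v. pa a v = 0 \<and> pb a v = 0}"
      using eigenspace_1_proj[OF a] eigenspace_0_proj[OF a] by blast
  qed
  finally show "pa a (x \<odot> y) = 0" "pb a (x \<odot> y) = 0" by simp_all
qed

lemma fusion_beta_beta:
  assumes a: "primitive_axis a" and x: "x \<odot> a = \<beta> *s x" and y: "y \<odot> a = \<beta> *s y"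
  shows "pb a (x \<odot> y) = 0"
proof -
  have "x \<in> eigenspace a \<beta>" "y \<in> eigenspace a \<beta>" using x y by (simp_all add: eigenspace_def)
  from axis_fusion[OF a _ _ this]
  have "x \<odot> y \<in> span (eigenspace a 1 \<union> (eigenspace a 0 \<union> eigenspace a \<alpha>))"
    by (simp add: monster_law_values)
  also have "\<dots> \<subseteq> {v. pb a v = 0}"
  proof (rule span_minimal)
    show "subspace {v. pb a v = 0}"
      by (rule subspaceI) (simp_all add: axis_linear[OF a])
    show "eigenspace a 1 \<union> (eigenspace a 0 \<union> eigenspace a \<alpha>) \<subseteq> {v. pb a v = 0}"
      using eigenspace_1_proj[OF a] eigenspace_0_proj[OF a] eigenspace_alpha_proj[OF a] by blast
  qed
  finally show "pb a (x \<odot> y) = 0" by simp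
qed

abbreviation tau :: "'w \<Rightarrow> 'w \<Rightarrow> 'w" where "tau \<equiv> miyamoto_involution"

text \<open>
  Changing the sign of the \<open>\<beta>\<close>-component is the only linear map with the defining properties
  of the Miyamoto involution, because the eigenspaces span the algebra.
\<close>

lemma tau_eq:
  assumes a: "primitive_axis a"
  shows "tau a v = v - 2 *s pb a v"
proof -
  let ?t = "\<lambda>v. v - 2 *s pb a v"
  have lin: "Vector_Spaces.linear scale scale ?t"
    by unfold_locales (simp_all add: axis_linear[OF a] scale_right_distrib scale_right_diff_distrib scale_left_commute)
  have "miyamoto_involution a = ?t"
    unfolding miyamoto_involution_def
  proof (rule the_equality)
    show "Vector_Spaces.linear scale scale ?t \<and> (\<forall>l\<in>{1, 0, \<alpha>}. \<forall>v\<in>eigenspace a l. ?t v = v) \<and>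
       (\<forall>v\<in>eigenspace a \<beta>. ?t v = - v)"
    proof (intro conjI lin ballI)
      fix l v assume "l \<in> {1, 0, \<alpha>}" "v \<in> eigenspace a l"
      moreover have "pb a v = 0" if "v \<in> eigenspace a 1"
        using that unfolding axis_eigenspace_1[OF a] by (auto simp: axis_linear[OF a] axis_self[OF a])
      ultimately have "pb a v = 0"
        using proj_zero_eigen(4)[OF a, of v] proj_alpha_eigen(4)[OF a, of v] by (auto simp: eigenspace_def)
      then show "?t v = v" by simp
    next
      fix v assume "v \<in> eigenspace a \<beta>"
      then have "pb a v = v" using proj_beta_eigen(4)[OF a, of v] by (simp add: eigenspace_def)
      moreover have "2 *s v = v + v" using scale_left_distrib[of 1 1 v] by simp
      ultimately show "?t v = - v" by simp
    qed
  next
    fix t assume t: "Vector_Spaces.linear scale scale t \<and> (\<forall>l\<in>{1, 0, \<alpha>}. \<forall>v\<in>eigenspace a l. t v = v) \<and>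
       (\<forall>v\<in>eigenspace a \<beta>. t v = - v)"
    interpret t: Vector_Spaces.linear scale scale t using t by blast
    show "t = ?t"
    proof
      fix v
      have "t (lam a v *s a) = lam a v *s a" "t (pz a v) = pz a v" "t (pa a v) = pa a v" "t (pb a v) = - pb a v"
        using t axis_eigen[OF a, of v] axis_eigenspace_1[OF a] by (auto simp: eigenspace_def)
      then have "t (lam a v *s a + pz a v + pa a v + pb a v) = lam a v *s a + pz a v + pa a v - pb a v"
        by (simp add: t.add)
      moreover have "2 *s pb a v = pb a v + pb a v" using scale_left_distrib[of 1 1 "pb a v"] by simp
      ultimately show "t v = ?t v"
        using axis_decomp[OF a, of v] by (metis add_diff_cancel_right diff_add_eq_diff_diff_swap add.commute)
    qed
  qed
  then show ?thesis by simp
qed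

lemma tau_fixed_iff: "primitive_axis a \<Longrightarrow> tau a v = v \<longleftrightarrow> pb a v = 0"
  by (simp add: tau_eq)

text \<open>
  The fusion law is graded: products of vectors without \<open>\<beta>\<close>-component have none. Together with
  \<open>even_odd_mult\<close> and \<open>fusion_beta_beta\<close> this makes the Miyamoto involutions automorphisms.
\<close>

lemma even_mult:
  assumes a: "primitive_axis a" and x: "pb a x = 0" and y: "pb a y = 0"
  shows "pb a (x \<odot> y) = 0"
proof -
  note e = axis_eigen[OF a]
  have "pb a (pz a x \<odot> pz a y) = 0"
    by (rule proj_zero_eigen(4)[OF a fusion_zero_zero[OF a e(1) e(1)]])
  moreover have "pb a (pz a u \<odot> pa a v) = 0" for u v
    by (rule proj_alpha_eigen(4)[OF a fusion_zero_alpha[OF a e(1) e(2)]])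
  moreover from this[of y x] have "pb a (pa a x \<odot> pz a y) = 0" by (simp add: mult_commute)
  moreover have "pb a (pa a x \<odot> pa a y) = 0"
    by (rule fusion_alpha_alpha(2)[OF a e(2) e(2)])
  moreover have "pb a (a \<odot> v) = 0" "pb a (v \<odot> a) = 0" if "pb a v = 0" for v
    using proj_axis_mult(3)[OF a, of v] that by (simp_all add: mult_commute)
  moreover have "x \<odot> y = lam a x *s (a \<odot> y) + pz a x \<odot> y + pa a x \<odot> y"
    using axis_decomp[OF a, of x] x by (metis bilinear(1,3) add_0_right)
  moreover have "z \<odot> y = lam a y *s (z \<odot> a) + z \<odot> pz a y + z \<odot> pa a y" for z
    using axis_decomp[OF a, of y] y by (metis bilinear(2,4) add_0_right)
  ultimately show ?thesis
    using y by (simp add: axis_linear[OF a] axis_idem[OF a] axis_self[OF a] a)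
qed

lemma even_odd_mult:
  assumes a: "primitive_axis a" and x: "pb a x = 0" and y: "y \<odot> a = \<beta> *s y"
  shows "(x \<odot> y) \<odot> a = \<beta> *s (x \<odot> y)"
proof -
  have 1: "(pz a x \<odot> y) \<odot> a = \<beta> *s (pz a x \<odot> y)"
    by (rule fusion_zero_beta[OF a axis_eigen(1)[OF a] y])
  have 2: "(pa a x \<odot> y) \<odot> a = \<beta> *s (pa a x \<odot> y)"
    by (rule fusion_alpha_beta[OF a axis_eigen(2)[OF a] y])
  have 3: "(a \<odot> y) \<odot> a = \<beta> *s (a \<odot> y)" using y by (simp add: mult_commute[of a] bilinear)
  have "x = lam a x *s a + pz a x + pa a x"
    using axis_decomp[OF a, of x] x by simp
  then have "x \<odot> y = lam a x *s (a \<odot> y) + pz a x \<odot> y + pa a x \<odot> y"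
    by (metis bilinear(1,3))
  then show ?thesis
    by (simp add: mult_add_left mult_scale_left 1 2 3 scale_right_distrib scale_left_commute)
qed

lemma tau_linear:
  assumes "primitive_axis a"
  shows "tau a (x + y) = tau a x + tau a y" "tau a (c *s x) = c *s tau a x"
    "tau a (- x) = - tau a x" "tau a (x - y) = tau a x - tau a y" "tau a 0 = 0"
  by (simp_all add: tau_eq[OF assms] axis_linear[OF assms] scale_right_distrib
      scale_right_diff_distrib scale_left_commute)

lemma tau_tau: assumes "primitive_axis a" shows "tau a (tau a v) = v"
  by (rule eq_by_functionals)
    (simp add: tau_eq[OF assms] axis_linear[OF assms] assms linear_form_simps)

lemma tau_self: "primitive_axis a \<Longrightarrow> tau a a = a"
  by (simp add: tau_eq axis_self)

lemma tau_mult: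
  assumes a: "primitive_axis a"
  shows "tau a (x \<odot> y) = tau a x \<odot> tau a y"
proof -
  let ?x = "x - pb a x" and ?y = "y - pb a y"
  have ev: "pb a ?x = 0" "pb a ?y = 0" by (simp_all add: axis_linear[OF a] a)
  note e = axis_eigen(3)[OF a]
  have 1: "pb a (?x \<odot> ?y) = 0" by (rule even_mult[OF a ev])
  have 2: "pb a (?x \<odot> pb a y) = ?x \<odot> pb a y"
    by (rule proj_beta_eigen(4)[OF a even_odd_mult[OF a ev(1) e]])
  have 3: "pb a (pb a x \<odot> ?y) = pb a x \<odot> ?y"
    using proj_beta_eigen(4)[OF a even_odd_mult[OF a ev(2) e[of x]]] by (simp add: mult_commute)
  have 4: "pb a (pb a x \<odot> pb a y) = 0" by (rule fusion_beta_beta[OF a e e])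
  have "x \<odot> y = ?x \<odot> ?y + ?x \<odot> pb a y + pb a x \<odot> ?y + pb a x \<odot> pb a y"
    by (simp add: bilinear)
  then have "pb a (x \<odot> y) = ?x \<odot> pb a y + pb a x \<odot> ?y"
    by (simp only: axis_add[OF a] 1 2 3 4 add_0_left add_0_right)
  then show ?thesis
    by (intro eq_by_functionals) (simp add: tau_eq[OF a] bilinear linear_form_simps)
qed

definition automorphism :: "('w \<Rightarrow> 'w) \<Rightarrow> bool" where
  "automorphism \<phi> \<longleftrightarrow> bij \<phi> \<and> (\<forall>x y. \<phi> (x + y) = \<phi> x + \<phi> y) \<and> (\<forall>c x. \<phi> (c *s x) = c *s \<phi> x) \<and>
    (\<forall>x y. \<phi> (x \<odot> y) = \<phi> x \<odot> \<phi> y)"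

lemma automorphism_simps:
  assumes "automorphism \<phi>"
  shows "\<phi> (x + y) = \<phi> x + \<phi> y" "\<phi> (c *s x) = c *s \<phi> x" "\<phi> (x \<odot> y) = \<phi> x \<odot> \<phi> y"
    "\<phi> 0 = 0" "\<phi> (- x) = - \<phi> x" "\<phi> (x - y) = \<phi> x - \<phi> y"
proof -
  show *: "\<phi> (x + y) = \<phi> x + \<phi> y" "\<phi> (c *s x) = c *s \<phi> x" "\<phi> (x \<odot> y) = \<phi> x \<odot> \<phi> y" for x y c
    using assms by (simp_all add: automorphism_def)
  show "\<phi> 0 = 0" using *(2)[of 0 0] by simp
  show "\<phi> (- x) = - \<phi> x" for x using *(2)[of "-1" x] by simp
  then show "\<phi> (x - y) = \<phi> x - \<phi> y" using *(1)[of x "- y"] by simp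
qed

lemma automorphism_bij: "automorphism \<phi> \<Longrightarrow> bij \<phi>"
  by (simp add: automorphism_def)

lemma automorphism_tau: "primitive_axis a \<Longrightarrow> automorphism (tau a)"
  unfolding automorphism_def
  using involuntory_imp_bij[of "tau a"] by (simp add: tau_linear tau_mult tau_tau)

lemma automorphism_id: "automorphism id"
  by (simp add: automorphism_def)

lemma automorphism_comp: "automorphism \<phi> \<Longrightarrow> automorphism \<psi> \<Longrightarrow> automorphism (\<phi> \<circ> \<psi>)"
  by (simp add: automorphism_def bij_comp)

lemma automorphism_inv:
  assumes "automorphism \<phi>"
  shows "automorphism (inv_into UNIV \<phi>)"
proof -
  have b: "inj \<phi>" "surj \<phi>" using automorphism_bij[OF assms] by (auto simp: bij_def)
  have *: "\<phi> (inv_into UNIV \<phi> x) = x" for x by (simp add: b surj_f_inv_f)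
  have "inv_into UNIV \<phi> (x + y) = inv_into UNIV \<phi> x + inv_into UNIV \<phi> y" "inv_into UNIV \<phi> (c *s x) = c *s inv_into UNIV \<phi> x"
    "inv_into UNIV \<phi> (x \<odot> y) = inv_into UNIV \<phi> x \<odot> inv_into UNIV \<phi> y" for x y c
    by (rule injD[OF b(1)], simp add: * automorphism_simps[OF assms])+
  then show ?thesis
    unfolding automorphism_def using automorphism_bij[OF assms] bij_imp_bij_inv by blast
qed

text \<open>
  Being a primitive axis is expressed in terms of the algebra structure alone, so
  automorphisms preserve it; the eigenspaces of the image are the images of the eigenspaces.
\<close>

lemma axis_image:
  assumes \<phi>: "automorphism \<phi>" and a: "primitive_axis a"
  shows "primitive_axis (\<phi> a)"
proof -
  define \<psi> where "\<psi> = inv_into UNIV \<phi>"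
  have \<psi>: "automorphism \<psi>" using automorphism_inv[OF \<phi>] by (simp add: \<psi>_def)
  have b: "inj \<phi>" "surj \<phi>" using automorphism_bij[OF \<phi>] by (auto simp: bij_def)
  have inv: "\<phi> (\<psi> x) = x" "\<psi> (\<phi> x) = x" for x
    by (simp_all add: \<psi>_def b surj_f_inv_f)
  note s = automorphism_simps[OF \<phi>] automorphism_simps[OF \<psi>]
  have eig: "x \<in> eigenspace (\<phi> a) l \<longleftrightarrow> \<psi> x \<in> eigenspace a l" for x l
  proof
    assume "x \<in> eigenspace (\<phi> a) l"
    then have "\<psi> (x \<odot> \<phi> a) = \<psi> (l *s x)" by (simp add: eigenspace_def)
    then show "\<psi> x \<in> eigenspace a l" by (simp add: s inv eigenspace_def)
  next
    assume "\<psi> x \<in> eigenspace a l"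
    then have "\<phi> (\<psi> x \<odot> a) = \<phi> (l *s \<psi> x)" by (simp add: eigenspace_def)
    then show "x \<in> eigenspace (\<phi> a) l" by (simp add: s inv eigenspace_def)
  qed
  have ex1: "\<exists>!f. f \<in> (\<Pi>\<^sub>E l\<in>eigenvalues. eigenspace (\<phi> a) l) \<and> v = (\<Sum>l\<in>eigenvalues. f l)" for v
  proof -
    have E: "\<exists>!f. f \<in> (\<Pi>\<^sub>E l\<in>eigenvalues. eigenspace a l) \<and> \<psi> v = (\<Sum>l\<in>eigenvalues. f l)"
      using a by (simp add: primitive_axis_def)
    then obtain f where f: "f \<in> (\<Pi>\<^sub>E l\<in>eigenvalues. eigenspace a l)" "\<psi> v = (\<Sum>l\<in>eigenvalues. f l)" by blast
    show ?thesis
    proof (rule ex1I[of _ "\<lambda>l\<in>eigenvalues. \<phi> (f l)"], intro conjI)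
      show "(\<lambda>l\<in>eigenvalues. \<phi> (f l)) \<in> (\<Pi>\<^sub>E l\<in>eigenvalues. eigenspace (\<phi> a) l)"
        using f(1) unfolding PiE_iff eig by (auto simp: inv)
      have "v = \<phi> (\<Sum>l\<in>eigenvalues. f l)" using f(2) inv(1)[of v] by simp
      then show "v = (\<Sum>l\<in>eigenvalues. (\<lambda>l\<in>eigenvalues. \<phi> (f l)) l)"
        unfolding sum_eigenvalues by (simp add: s)
    next
      fix g assume g: "g \<in> (\<Pi>\<^sub>E l\<in>eigenvalues. eigenspace (\<phi> a) l) \<and> v = (\<Sum>l\<in>eigenvalues. g l)"
      have "(\<lambda>l\<in>eigenvalues. \<psi> (g l)) \<in> (\<Pi>\<^sub>E l\<in>eigenvalues. eigenspace a l)"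
        using g unfolding PiE_iff eig by auto
      moreover have "\<psi> v = (\<Sum>l\<in>eigenvalues. (\<lambda>l\<in>eigenvalues. \<psi> (g l)) l)"
        using g unfolding sum_eigenvalues by (simp add: s)
      ultimately have "(\<lambda>l\<in>eigenvalues. \<psi> (g l)) = f" using E f by blast
      then have "\<phi> (f l) = g l" if "l \<in> eigenvalues" for l
        using that inv(1)[of "g l"] by (metis restrict_apply')
      then show "g = (\<lambda>l\<in>eigenvalues. \<phi> (f l))"
        using g by (intro ext) (auto simp: PiE_iff extensional_def restrict_def)
    qed
  qed
  have fus: "x \<odot> y \<in> span (\<Union>n\<in>monster_law \<alpha> \<beta> l m. eigenspace (\<phi> a) n)"
    if "l \<in> eigenvalues" "m \<in> eigenvalues" "x \<in> eigenspace (\<phi> a) l" "y \<in> eigenspace (\<phi> a) m" for l m x y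
  proof -
    let ?U = "\<Union>n\<in>monster_law \<alpha> \<beta> l m. eigenspace (\<phi> a) n"
    have "\<psi> x \<odot> \<psi> y \<in> span (\<Union>n\<in>monster_law \<alpha> \<beta> l m. eigenspace a n)"
      using axis_fusion[OF a that(1,2)] that(3,4) by (simp add: eig)
    also have "\<dots> \<subseteq> {z. \<phi> z \<in> span ?U}"
    proof (rule span_minimal)
      show "subspace {z. \<phi> z \<in> span ?U}"
        by (rule subspaceI) (simp_all add: s span_zero span_add span_scale)
      show "(\<Union>n\<in>monster_law \<alpha> \<beta> l m. eigenspace a n) \<subseteq> {z. \<phi> z \<in> span ?U}"
        by (auto intro!: span_base simp: eig inv)
    qed
    finally show ?thesis by (simp add: s inv)
  qed
  have one: "eigenspace (\<phi> a) 1 = range (\<lambda>c. c *s \<phi> a)"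
  proof (intro equalityI subsetI)
    fix x assume "x \<in> eigenspace (\<phi> a) 1"
    then obtain c where "\<psi> x = c *s a" using axis_eigenspace_1[OF a] unfolding eig by auto
    then have "x = c *s \<phi> a" by (metis inv(1) s(2))
    then show "x \<in> range (\<lambda>c. c *s \<phi> a)" by blast
  next
    fix x assume "x \<in> range (\<lambda>c. c *s \<phi> a)"
    then show "x \<in> eigenspace (\<phi> a) 1" unfolding eig axis_eigenspace_1[OF a] by (auto simp: s inv)
  qed
  have "\<phi> a \<noteq> 0" using axis_nonzero[OF a] by (metis inv(2) s(10))
  moreover have "\<phi> a \<odot> \<phi> a = \<phi> a" by (metis axis_idem[OF a] s(3))
  ultimately show ?thesis unfolding primitive_axis_def using ex1 fus one by blast
qed

lemma proj_image:
  assumes \<phi>: "automorphism \<phi>" and a: "primitive_axis a"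
  shows "lam (\<phi> a) (\<phi> v) = lam a v" "pa (\<phi> a) (\<phi> v) = \<phi> (pa a v)" "pb (\<phi> a) (\<phi> v) = \<phi> (pb a v)"
proof -
  note s = automorphism_simps[OF \<phi>]
  have 1: "\<phi> v = lam a v *s \<phi> a + \<phi> (pz a v) + \<phi> (pa a v) + \<phi> (pb a v)"
    using arg_cong[where f = \<phi>, OF axis_decomp[OF a, of v]] by (simp only: s)
  have 2: "\<phi> (pz a v) \<odot> \<phi> a = 0" "\<phi> (pa a v) \<odot> \<phi> a = \<alpha> *s \<phi> (pa a v)"
    "\<phi> (pb a v) \<odot> \<phi> a = \<beta> *s \<phi> (pb a v)"
    by (simp_all only: s(3)[symmetric] axis_eigen[OF a] s(2) s(4))
  show "lam (\<phi> a) (\<phi> v) = lam a v" "pa (\<phi> a) (\<phi> v) = \<phi> (pa a v)" "pb (\<phi> a) (\<phi> v) = \<phi> (pb a v)"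
    by (rule axis_unique[OF axis_image[OF \<phi> a] 1 2])+
qed

lemma tau_image:
  assumes \<phi>: "automorphism \<phi>" and a: "primitive_axis a"
  shows "tau (\<phi> a) (\<phi> v) = \<phi> (tau a v)"
  by (simp add: tau_eq[OF a] tau_eq[OF axis_image[OF \<phi> a]] proj_image[OF \<phi> a] automorphism_simps[OF \<phi>])

lemma tau_conj:
  assumes a: "primitive_axis a" and b: "primitive_axis b"
  shows "tau (tau a b) v = tau a (tau b (tau a v))"
  using tau_image[OF automorphism_tau[OF a] b, of "tau a v"] by (simp add: tau_tau[OF a])

section \<open>Dihedral sequences of axes\<close>

text \<open>
  The two classes of axes under the dihedral group generated by two Miyamoto involutions are
  the terms of even and of odd index. Repetitions are allowed.
\<close>

definition dihedral :: "(int \<Rightarrow> 'w) \<Rightarrow> bool" where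
  "dihedral A \<longleftrightarrow> (\<forall>n. primitive_axis (A n)) \<and> (\<forall>n m. tau (A n) (A m) = A (2 * n - m))"

lemma dihedral_axis: "dihedral A \<Longrightarrow> primitive_axis (A n)"
  and dihedral_tau: "dihedral A \<Longrightarrow> tau (A n) (A m) = A (2 * n - m)"
  by (simp_all add: dihedral_def)

lemma dihedral_affine: "dihedral A \<Longrightarrow> dihedral (\<lambda>n. A (i + d * n))"
  by (simp add: dihedral_def algebra_simps)

text \<open>
  The rotation \<open>\<rho> = \<tau>\<^sub>b \<tau>\<^sub>a\<close> has to translate indices by 2. So the even terms are the
  images of \<open>a\<close> and the odd terms the images of \<open>b\<close> under the powers of \<open>\<rho>\<close>. Both involutions
  invert \<open>\<rho>\<close>, hence they act as the reflections of the indices at 0 and at 1, and conjugation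
  by powers of \<open>\<rho>\<close> extends this to all terms.
\<close>

lemma dihedral_exists:
  assumes a: "primitive_axis a" and b: "primitive_axis b"
  shows "\<exists>A. dihedral A \<and> A 0 = a \<and> A 1 = b"
proof -
  define \<rho> where "\<rho> = tau b \<circ> tau a"
  define \<sigma> where "\<sigma> = tau a \<circ> tau b"
  \<comment> \<open>the integral powers of the rotation\<close>
  define R where "R k = (if k \<ge> 0 then \<rho> ^^ nat k else \<sigma> ^^ nat (- k))" for k :: int
  have \<rho>\<sigma>: "\<rho> (\<sigma> x) = x" "\<sigma> (\<rho> x) = x" for x
    by (simp_all add: \<rho>_def \<sigma>_def tau_tau[OF a] tau_tau[OF b])
  have R0: "R 0 x = x" for x by (simp add: R_def)
  have Rs: "R (k + 1) x = \<rho> (R k x)" for k x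
  proof (cases "k \<ge> 0")
    case True
    then have "nat (k + 1) = Suc (nat k)" by simp
    with True show ?thesis by (simp add: R_def)
  next
    case False
    then have "nat (- k) = Suc (nat (- (k + 1)))" by simp
    moreover have "R (k + 1) = \<sigma> ^^ nat (- (k + 1))"
      using False by (cases "k = -1") (simp_all add: R_def)
    ultimately show ?thesis using False by (simp add: R_def \<rho>\<sigma>)
  qed
  have Rp: "R (k - 1) x = \<sigma> (R k x)" for k x
    using Rs[of "k - 1" x] by (simp add: \<rho>\<sigma>)
  have Rneg: "R (- (k + 1)) x = \<sigma> (R (- k) x)" "R (- (k - 1)) x = \<rho> (R (- k) x)" for k x
  proof -
    have "- (k + 1) = - k - 1" "- (k - 1) = - k + 1" by simp_all
    then show "R (- (k + 1)) x = \<sigma> (R (- k) x)" "R (- (k - 1)) x = \<rho> (R (- k) x)"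
      by (simp_all only: Rs Rp)
  qed
  have Radd: "R (j + k) x = R j (R k x)" for j k x
  proof (induction j rule: int_induct[of _ 0])
    case base
    show ?case by (simp add: R0)
  next
    case (step1 i)
    have "R (i + 1 + k) x = R ((i + k) + 1) x" by (simp add: algebra_simps)
    with step1 show ?case by (simp add: Rs)
  next
    case (step2 i)
    have "R (i - 1 + k) x = R ((i + k) - 1) x" by (simp add: algebra_simps)
    with step2 show ?case by (simp add: Rp)
  qed
  have Ra: "tau a (R k x) = R (- k) (tau a x)" for k x
  proof (induction k rule: int_induct[of _ 0])
    case base
    show ?case by (simp add: R0)
  next
    case (step1 i)
    have "tau a (\<rho> y) = \<sigma> (tau a y)" for y by (simp add: \<rho>_def \<sigma>_def)
    with step1 show ?case by (simp only: Rs Rneg)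
  next
    case (step2 i)
    have "tau a (\<sigma> y) = \<rho> (tau a y)" for y by (simp add: \<rho>_def \<sigma>_def tau_tau[OF a])
    with step2 show ?case by (simp only: Rp Rneg)
  qed
  have Rb: "tau b (R k x) = R (- k) (tau b x)" for k x
  proof (induction k rule: int_induct[of _ 0])
    case base
    show ?case by (simp add: R0)
  next
    case (step1 i)
    have "tau b (\<rho> y) = \<sigma> (tau b y)" for y by (simp add: \<rho>_def \<sigma>_def tau_tau[OF b])
    with step1 show ?case by (simp only: Rs Rneg)
  next
    case (step2 i)
    have "tau b (\<sigma> y) = \<rho> (tau b y)" for y by (simp add: \<rho>_def \<sigma>_def)
    with step2 show ?case by (simp only: Rp Rneg)
  qed
  have aut: "automorphism (R k)" for k
  proof -
    have "automorphism (f ^^ n)" if "automorphism f" for f n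
    proof (induction n)
      case 0
      show ?case using automorphism_id by (simp add: id_def)
    next
      case (Suc n)
      show ?case using automorphism_comp[OF that Suc] by (simp only: funpow.simps)
    qed
    moreover have "automorphism \<rho>" "automorphism \<sigma>"
      by (simp_all add: \<rho>_def \<sigma>_def automorphism_comp automorphism_tau a b)
    ultimately show ?thesis by (simp add: R_def)
  qed
  define A where "A n = R (n div 2) (if even n then a else b)" for n
  have A_even: "A (2 * k) = R k a" and A_odd: "A (2 * k + 1) = R k b" for k
    by (simp_all add: A_def)
  have cases: "(\<exists>k. n = 2 * k) \<or> (\<exists>k. n = 2 * k + 1)" for n :: int by presburger
  have shift: "R j (A n) = A (n + 2 * j)" for j n
  proof -
    have "(n + 2 * j) div 2 = j + n div 2" by simp
    then show ?thesis by (simp add: A_def Radd)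
  qed
  have ta: "tau a (A n) = A (- n)" for n
  proof -
    consider k where "n = 2 * k" | k where "n = 2 * k + 1" using cases by blast
    then show ?thesis
    proof cases
      case 1
      then have "A (- n) = R (- k) a" using A_even[of "- k"] by simp
      with 1 show ?thesis by (simp add: A_even Ra tau_self[OF a])
    next
      case 2
      then have "- n = 2 * (- k - 1) + 1" by simp
      then have "A (- n) = R (- k - 1) b" using A_odd[of "- k - 1"] by simp
      also have "\<dots> = R (- k) (\<sigma> b)" using Radd[of "- k" "-1" b] Rp[of 0 b] by (simp add: R0)
      finally show ?thesis using 2 by (simp add: A_odd Ra \<sigma>_def tau_self[OF b])
    qed
  qed
  have tb: "tau b (A n) = A (2 - n)" for n
  proof -
    consider k where "n = 2 * k" | k where "n = 2 * k + 1" using cases by blast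
    then show ?thesis
    proof cases
      case 1
      then have "2 - n = 2 * (- k + 1)" by simp
      then have "A (2 - n) = R (- k + 1) a" using A_even[of "- k + 1"] by simp
      also have "\<dots> = R (- k) (\<rho> a)" using Radd[of "- k" 1 a] Rs[of 0 a] by (simp add: R0)
      finally show ?thesis using 1 by (simp add: A_even Rb \<rho>_def tau_self[OF a])
    next
      case 2
      then have "2 - n = 2 * (- k) + 1" by simp
      then have "A (2 - n) = R (- k) b" by (simp only: A_odd)
      with 2 show ?thesis by (simp add: A_odd Rb tau_self[OF b])
    qed
  qed
  have "primitive_axis (A n)" for n
    unfolding A_def using axis_image[OF aut] a b by simp
  moreover have "tau (A n) (A m) = A (2 * n - m)" for n m
  proof -
    have inv: "R k (R (- k) x) = x" for k x using Radd[of k "- k" x] by (simp add: R0)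
    consider k where "n = 2 * k" | k where "n = 2 * k + 1" using cases by blast
    then show ?thesis
    proof cases
      case 1
      have "tau (R k a) (R k (R (- k) (A m))) = R k (tau a (R (- k) (A m)))"
        by (rule tau_image[OF aut a])
      then have "tau (A n) (A m) = R k (A (- (m - 2 * k)))"
        using 1 by (simp add: inv A_even shift ta)
      with 1 show ?thesis by (simp add: shift algebra_simps)
    next
      case 2
      have "tau (R k b) (R k (R (- k) (A m))) = R k (tau b (R (- k) (A m)))"
        by (rule tau_image[OF aut b])
      then have "tau (A n) (A m) = R k (A (2 - (m - 2 * k)))"
        using 2 by (simp add: inv A_odd shift tb)
      with 2 show ?thesis by (simp add: shift algebra_simps)
    qed
  qed
  ultimately have "dihedral A" by (simp add: dihedral_def)
  moreover have "A 0 = a" "A 1 = b" by (simp_all add: A_def R0)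
  ultimately show ?thesis by blast
qed

definition inv_space :: "(int \<Rightarrow> 'w) \<Rightarrow> 'w set" where
  "inv_space A = {x. \<forall>n. tau (A n) x = x}"

lemma subspace_inv: "dihedral A \<Longrightarrow> subspace (inv_space A)"
  by (rule subspaceI) (auto simp: inv_space_def dihedral_axis tau_linear)

lemma inv_mult: "dihedral A \<Longrightarrow> x \<in> inv_space A \<Longrightarrow> y \<in> inv_space A \<Longrightarrow> x \<odot> y \<in> inv_space A"
  by (simp add: inv_space_def tau_mult dihedral_axis)

text \<open>
  The involution of \<open>A (2 * i - j)\<close> is the conjugate of that of \<open>A j\<close> by that of \<open>A i\<close>,
  so two neighbouring axes generate the whole dihedral group.
\<close>

lemma inv_spaceI:
  assumes A: "dihedral A" and 0: "tau (A 0) x = x" and 1: "tau (A 1) x = x"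
  shows "x \<in> inv_space A"
proof -
  have step: "tau (A (2 * i - j)) x = x" if "tau (A i) x = x" "tau (A j) x = x" for i j
    using tau_conj[OF dihedral_axis[OF A, of i] dihedral_axis[OF A, of j], of x] that
    by (simp add: dihedral_tau[OF A])
  have "tau (A n) x = x \<and> tau (A (n + 1)) x = x" for n
  proof (induction n rule: int_induct[of _ 0])
    case base
    show ?case using 0 1 by simp
  next
    case (step1 i)
    then show ?case using step[of "i + 1" i] by (simp add: algebra_simps)
  next
    case (step2 i)
    then show ?case using step[of i "i + 1"] by (simp add: algebra_simps)
  qed
  then show ?thesis by (simp add: inv_space_def)
qed

lemma inv_space_flip: "inv_space (\<lambda>n. A (i - n)) = inv_space A"
proof -
  have "(\<forall>n. tau (A (i - n)) x = x) \<longleftrightarrow> (\<forall>n. tau (A n) x = x)" for x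
    by (metis diff_diff_eq2 add_diff_cancel_left')
  then show ?thesis by (simp add: inv_space_def)
qed

lemma dihedral_shift: "dihedral A \<Longrightarrow> dihedral (\<lambda>n. A (i + n))"
  using dihedral_affine[of A i 1] by simp

lemma dihedral_flip: "dihedral A \<Longrightarrow> dihedral (\<lambda>n. A (i - n))"
  using dihedral_affine[of A i "-1"] by simp

lemma lam_reflect: "dihedral A \<Longrightarrow> lam (A (2 * i - j)) (A (2 * i - k)) = lam (A j) (A k)"
  using proj_image(1)[OF automorphism_tau[OF dihedral_axis[of A i]] dihedral_axis[of A j], of "A k"]
  by (simp add: dihedral_tau)

end

section \<open>Products of the axes of a dihedral sequence\<close>

text \<open>
  An equation over a field is proved by writing it as a linear combination of known equations,
  with the multipliers given explicitly.
\<close>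

lemma lincomb1: "l = r \<Longrightarrow> x - y = k * (l - r) \<Longrightarrow> x = y"
  for l r x y k :: "'a::field" by simp

lemma lincomb2: "l = r \<Longrightarrow> l' = r' \<Longrightarrow> x - y = k * (l - r) + k' * (l' - r') \<Longrightarrow> x = y"
  for l r l' r' x y k k' :: "'a::field" by simp

lemma lincomb3: "l = r \<Longrightarrow> l' = r' \<Longrightarrow> l'' = r'' \<Longrightarrow>
    x - y = k * (l - r) + k' * (l' - r') + k'' * (l'' - r'') \<Longrightarrow> x = y"
  for l r l' r' l'' r'' x y k k' k'' :: "'a::field" by simp

context generic_monster_algebra
begin

text \<open>
  Subtracting the multiple of \<open>x + y\<close> removes the \<open>\<beta>\<close>-component: for an axis \<open>a\<close> the vector
  \<open>sg a x\<close> is fixed by the involution of \<open>a\<close>. This makes \<open>sg\<close> of two axes invariant under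
  both involutions.
\<close>

definition sg :: "'w \<Rightarrow> 'w \<Rightarrow> 'w" where "sg x y = x \<odot> y - \<beta> *s (x + y)"

lemma sg_commute: "sg x y = sg y x"
  by (simp add: sg_def mult_commute[of x] add.commute)

lemma mult_sg: "x \<odot> y = sg x y + \<beta> *s (x + y)"
  by (simp add: sg_def)

lemma sg_tau: assumes "primitive_axis a" shows "sg a (tau a x) = sg a x"
proof -
  have "a \<odot> pb a x = \<beta> *s pb a x" using axis_eigen(3)[OF assms, of x] by (simp add: mult_commute)
  then show ?thesis
    by (intro eq_by_functionals) (simp add: sg_def tau_eq[OF assms] bilinear linear_form_simps algebra_simps)
qed

lemma sg_image: "automorphism \<phi> \<Longrightarrow> \<phi> (sg x y) = sg (\<phi> x) (\<phi> y)"
  by (simp add: sg_def automorphism_simps)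

text \<open>
  With \<open>l\<close> the projection of \<open>x\<close> on an axis \<open>a\<close>, the projection of \<open>sg a x\<close> on \<open>a\<close> is
  \<open>ls l\<close>, and \<open>gg l\<close> and \<open>hh\<close> are the coefficients of \<open>a\<close> and of \<open>x + \<tau>\<^sub>a x\<close> in the
  product of \<open>a\<close> and \<open>sg a x\<close>.
\<close>

definition gg :: "'f \<Rightarrow> 'f" where "gg l = (1 - \<alpha>) * l + \<beta> * (\<alpha> - \<beta> - 1)"
definition hh :: 'f where "hh = \<beta> * (\<alpha> - \<beta>) / 2"
definition ls :: "'f \<Rightarrow> 'f" where "ls l = l - \<beta> - \<beta> * l"

lemma proj_sg:
  assumes "primitive_axis a"
  shows "lam a (sg a x) = ls (lam a x)" "pa a (sg a x) = (\<alpha> - \<beta>) *s pa a x" "pb a (sg a x) = 0"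
  by (simp_all add: sg_def ls_def axis_linear[OF assms] proj_axis_mult[OF assms] axis_self[OF assms]
      scale_left_diff_distrib algebra_simps)

text \<open>
  The \<open>\<alpha>\<close>-component is the key to everything below because it can be written down explicitly:
  in the product of \<open>a\<close> and \<open>x\<close> it appears besides the projection on \<open>a\<close> and the \<open>\<beta>\<close>-component
  \<open>(x - \<tau>\<^sub>a x) / 2\<close>.
\<close>

lemma scaled_alpha_part:
  assumes "primitive_axis a"
  shows "\<alpha> *s pa a x = sg a x + (\<beta> - lam a x) *s a + (\<beta> / 2) *s (x + tau a x)"
  by (rule eq_by_functionals)
    (simp add: sg_def axis_mult[OF assms, of x] tau_eq[OF assms] linear_form_simps field_simps)

lemma axis_mult_sg:
  assumes "primitive_axis a"
  shows "a \<odot> sg a x = (\<alpha> - \<beta>) *s sg a x + gg (lam a x) *s a + hh *s (x + tau a x)"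
proof -
  have *: "a \<odot> sg a x = ls (lam a x) *s a + (\<alpha> - \<beta>) *s (\<alpha> *s pa a x)"
    by (simp add: axis_mult[OF assms, of "sg a x"] proj_sg[OF assms] scale_left_commute)
  show ?thesis
    unfolding * scaled_alpha_part[OF assms]
    by (intro eq_by_functionals) (simp add: linear_form_simps gg_def hh_def ls_def field_simps)
qed

text \<open>
  For \<open>w = z + v\<close> with \<open>z\<close> in the 0-eigenspace and \<open>v\<close> in the \<open>\<alpha>\<close>-eigenspace, \<open>z\<^sup>2\<close> is a
  0-eigenvector, \<open>z v\<close> is an \<open>\<alpha>\<close>-eigenvector, and \<open>v\<^sup>2\<close> has no \<open>\<alpha>\<close>-component. Hence the
  \<open>\<alpha>\<close>-component of \<open>w\<^sup>2\<close> is \<open>2 z v\<close> and that of \<open>w v\<close> is \<open>z v\<close>.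
\<close>

lemma even_square:
  assumes a: "primitive_axis a" and w: "lam a w = 0" "pb a w = 0"
  shows "pa a (w \<odot> w) = 2 *s pa a (w \<odot> pa a w)" "lam a (w \<odot> w) = lam a (w \<odot> pa a w)"
    "pa a w \<odot> pa a w = w \<odot> pa a w - (1/2) *s pa a (w \<odot> w)"
proof -
  let ?z = "pz a w" and ?v = "pa a w"
  have dec: "w = ?z + ?v" using axis_decomp[OF a, of w] w by simp
  have ww: "w \<odot> w = ?z \<odot> ?z + 2 *s (?z \<odot> ?v) + ?v \<odot> ?v"
  proof -
    have "(z + v) \<odot> (z + v) = z \<odot> z + 2 *s (z \<odot> v) + v \<odot> v" for z v
      by (rule eq_by_functionals) (simp add: bilinear mult_commute[of v z] linear_form_simps)
    from this[of ?z ?v] show ?thesis by (simp only: dec[symmetric])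
  qed
  have wv: "w \<odot> ?v = ?z \<odot> ?v + ?v \<odot> ?v" using dec by (metis bilinear(1))
  note e = axis_eigen[OF a, of w]
  have zz: "lam a (?z \<odot> ?z) = 0" "pa a (?z \<odot> ?z) = 0"
    using proj_zero_eigen[OF a fusion_zero_zero[OF a e(1) e(1)]] by simp_all
  have zv: "lam a (?z \<odot> ?v) = 0" "pa a (?z \<odot> ?v) = ?z \<odot> ?v"
    using proj_alpha_eigen[OF a fusion_zero_alpha[OF a e(1) e(2)]] by simp_all
  have vv: "pa a (?v \<odot> ?v) = 0"
    using fusion_alpha_alpha[OF a e(2) e(2)] by simp
  show "pa a (w \<odot> w) = 2 *s pa a (w \<odot> ?v)" "lam a (w \<odot> w) = lam a (w \<odot> ?v)"
    by (simp_all add: ww wv axis_linear[OF a] zz zv vv)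
  have "pa a (w \<odot> w) = 2 *s (?z \<odot> ?v)" by (simp add: ww axis_linear[OF a] zz zv vv)
  then show "?v \<odot> ?v = w \<odot> ?v - (1/2) *s pa a (w \<odot> w)" by (simp add: wv)
qed

lemma dihedral_sg:
  assumes "dihedral A"
  shows "sg (A i) (A (2 * i - j)) = sg (A i) (A j)"
  using sg_tau[OF dihedral_axis[OF assms, of i], of "A j"] by (simp add: dihedral_tau[OF assms])

text \<open>
  The value of \<open>sg\<close> on \<open>A i\<close> and its neighbour at distance \<open>d\<close> is invariant under the
  reflection at \<open>i\<close>, which moves the neighbour to the other side; so the value does not change
  along an arithmetic progression of difference \<open>d\<close>.
\<close>

lemma dihedral_sg_shift:
  assumes A: "dihedral A"
  shows "sg (A (i + k * d)) (A (i + (k + 1) * d)) = sg (A i) (A (i + d))"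
proof (induction k rule: int_induct[of _ 0])
  case base
  show ?case by simp
next
  case (step1 k)
  have "sg (A (i + (k + 1) * d)) (A (2 * (i + (k + 1) * d) - (i + k * d))) = sg (A (i + (k + 1) * d)) (A (i + k * d))"
    by (rule dihedral_sg[OF A])
  moreover have "2 * (i + (k + 1) * d) - (i + k * d) = i + (k + 1 + 1) * d" by (simp add: algebra_simps)
  ultimately show ?case using step1 by (simp add: sg_commute)
next
  case (step2 k)
  have "sg (A (i + k * d)) (A (2 * (i + k * d) - (i + (k + 1) * d))) = sg (A (i + k * d)) (A (i + (k + 1) * d))"
    by (rule dihedral_sg[OF A])
  moreover have "2 * (i + k * d) - (i + (k + 1) * d) = i + (k - 1) * d" by (simp add: algebra_simps)
  ultimately show ?case using step2 by (simp add: sg_commute)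
qed

lemma dihedral_sg_1:
  assumes A: "dihedral A" shows "sg (A n) (A (n + 1)) = sg (A 0) (A 1)"
  using dihedral_sg_shift[OF A, of 0 n 1] by simp

lemma dihedral_sg_2:
  assumes A: "dihedral A"
  shows "sg (A n) (A (n + 2)) = (if even n then sg (A 0) (A 2) else sg (A 1) (A (- 1)))"
proof (cases "even n")
  case True
  then obtain k where "n = k * 2" by (metis evenE mult.commute)
  then show ?thesis using dihedral_sg_shift[OF A, of 0 k 2] True by (simp add: algebra_simps)
next
  case False
  then obtain k where "n = 1 + k * 2" by (metis oddE mult.commute add.commute)
  then show ?thesis
    using dihedral_sg_shift[OF A, of 1 k 2] dihedral_sg[OF A, of 1 "-1"] False by (simp add: algebra_simps)
qed

lemma dihedral_lam_shift:
  assumes A: "dihedral A" shows "lam (A (i + 2 * k)) (A (j + 2 * k)) = lam (A i) (A j)"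
proof -
  have "lam (A (2 * k - (- i))) (A (2 * k - (- j))) = lam (A (2 * 0 - i)) (A (2 * 0 - j))"
    using lam_reflect[OF A, of k "- i" "- j"] by simp
  also have "\<dots> = lam (A i) (A j)" by (rule lam_reflect[OF A])
  finally show ?thesis by (simp add: algebra_simps)
qed

lemma inv_sg:
  assumes A: "dihedral A"
  shows "sg (A 0) (A 1) \<in> inv_space A" "sg (A 0) (A 2) \<in> inv_space A" "sg (A 1) (A (- 1)) \<in> inv_space A"
proof -
  note im = sg_image[OF automorphism_tau[OF dihedral_axis[OF A]]]
  note d = dihedral_tau[OF A] dihedral_sg[OF A, of 0 1] dihedral_sg[OF A, of 1 0] dihedral_sg[OF A, of 0 2]
    dihedral_sg[OF A, of 1 "-1"]
  show "sg (A 0) (A 1) \<in> inv_space A"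
    by (rule inv_spaceI[OF A]) (use d in \<open>simp_all add: im sg_commute\<close>)
  show "sg (A 0) (A 2) \<in> inv_space A"
    by (rule inv_spaceI[OF A]) (use d in \<open>simp_all add: im sg_commute\<close>)
  show "sg (A 1) (A (- 1)) \<in> inv_space A"
    by (rule inv_spaceI[OF A]) (use d in \<open>simp_all add: im sg_commute\<close>)
qed

text \<open>
  The coefficients of the square of \<open>s = sg (A 0) (A 1)\<close>, multiplied by \<open>\<alpha> - 2 * \<beta>\<close>:
  \<open>cc\<close>, \<open>dd\<close>, \<open>ee\<close> belong to the axes at distance 2, 1, 0 from \<open>A 0\<close>, while \<open>kk\<close>, \<open>ll\<close>, \<open>mm\<close>
  belong to \<open>sg (A 0) (A 2)\<close>, \<open>sg (A 1) (A (-1))\<close> and \<open>s\<close>. The arguments are the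
  projections \<open>l = lam (A 0) (A 1)\<close>, \<open>m = lam (A 1) (A 0)\<close> and
  \<open>l2 = lam (A 0) (A 2)\<close>.
\<close>

definition cc :: 'f where "cc = \<beta> * (\<alpha> - \<beta>)^2 * (\<alpha> - 4 * \<beta>) / 4"
definition dd :: "'f \<Rightarrow> 'f \<Rightarrow> 'f" where
  "dd l m = \<alpha> * \<beta> * (\<alpha> - \<beta>) * l - (\<alpha> - \<beta>) * (\<alpha> - 1) * (\<alpha> - 4 * \<beta>) / 2 * m
    + (- 10 * \<alpha>^2 * \<beta>^2 - \<alpha>^2 * \<beta> + 14 * \<alpha> * \<beta>^3 + 7 * \<alpha> * \<beta>^2 - 4 * \<beta>^4 - 6 * \<beta>^3) / 4"
definition ee :: "'f \<Rightarrow> 'f \<Rightarrow> 'f \<Rightarrow> 'f" where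
  "ee l m l2 = (- 3 * \<alpha>^2 + 4 * \<alpha> * \<beta> + \<alpha> - 2 * \<beta>) * l^2 + \<alpha> * (1 - \<alpha>) * l * m
    + (\<alpha>^3 + 4 * \<alpha>^2 * \<beta> - 6 * \<alpha> * \<beta>^2 - 3 * \<alpha> * \<beta> + 4 * \<beta>^2) * l + \<alpha> * \<beta> * (\<alpha> - 1) * m
    + \<alpha> * \<beta> * (\<alpha> - \<beta>) / 2 * l2
    + (- (\<alpha>^3 * \<beta>) - 8 * \<alpha>^2 * \<beta>^2 + 13 * \<alpha> * \<beta>^3 + 4 * \<alpha> * \<beta>^2 - 4 * \<beta>^4 - 4 * \<beta>^3) / 2"
definition kk :: 'f where "kk = - \<alpha> * \<beta> * (\<alpha> - \<beta>) / 2"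
definition ll :: 'f where "ll = \<beta> * (\<alpha> - \<beta>) * (\<alpha> - 2 * \<beta>) / 2"
definition mm :: "'f \<Rightarrow> 'f \<Rightarrow> 'f" where
  "mm l m = 2 * \<alpha> * (\<alpha> - \<beta>) * l + \<alpha> * (\<alpha> - 1) * m + (- 6 * \<alpha>^2 * \<beta> + 10 * \<alpha> * \<beta>^2 + \<alpha> * \<beta> - 4 * \<beta>^3)"

text \<open>
  For \<open>q = sg (A 1) (A (-1))\<close> and the same arguments, \<open>lq\<close> is the projection of \<open>q\<close> on
  \<open>A 0\<close>. After multiplication with \<open>\<alpha> - 2 * \<beta>\<close>, \<open>xx\<close> is the coefficient of the
  \<open>\<alpha>\<close>-component of \<open>A 1\<close> in that of \<open>q\<close>, and \<open>ww\<close> is the coefficient of \<open>A 0\<close> in the product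
  of \<open>A 0\<close> and \<open>q\<close>.
\<close>

definition xx :: "'f \<Rightarrow> 'f \<Rightarrow> 'f" where
  "xx l m = 4 * ((\<alpha> - \<beta>)^2 + gg m - l * \<alpha> * (\<alpha> - \<beta>) - \<alpha> * ls l) - (\<alpha> - 2 * \<beta>) * (1 + 2 * \<beta> - 4 * l * \<alpha>)"

definition lq :: "'f \<Rightarrow> 'f \<Rightarrow> 'f \<Rightarrow> 'f" where
  "lq l m l2 = 2 * ((\<alpha> - \<beta>) * ls l + gg m * l + hh * (1 + l2) - l * ls l) / (\<alpha> - \<beta>) - (1 + 2 * \<beta>) * l + 2 * l^2"

definition ww :: "'f \<Rightarrow> 'f \<Rightarrow> 'f \<Rightarrow> 'f" where
  "ww l m l2 = (\<alpha> - 2 * \<beta>) * lq l m l2 + xx l m * (\<beta> - l) + 4 * hh * (\<beta> - l2)"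

definition z_inv :: "(int \<Rightarrow> 'w) \<Rightarrow> 'w" where
  "z_inv A = cc *s (A 2 + A (- 2)) + dd (lam (A 0) (A 1)) (lam (A 1) (A 0)) *s (A 1 + A (- 1))
     + ee (lam (A 0) (A 1)) (lam (A 1) (A 0)) (lam (A 0) (A 2)) *s A 0"

text \<open>
  All four formulas come from applying \<open>even_square\<close> to
  \<open>w = (A 1 + A (-1)) / 2 - l A 0\<close>, whose \<open>\<alpha>\<close>-component is that of \<open>A 1\<close>; call it
  \<open>v\<close>. By \<open>scaled_alpha_part\<close>, \<open>\<alpha> v\<close> is a combination of \<open>s\<close>, \<open>A 0\<close> and \<open>w\<close>, so \<open>w v\<close> is
  known in terms of \<open>w s\<close>, \<open>w\<^sup>2\<close> and \<open>v\<close>. Here \<open>w\<^sup>2\<close> contains \<open>q\<close>, because it contains the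
  product of \<open>A 1\<close> and \<open>A (-1)\<close>, and \<open>w s\<close> is known from \<open>axis_mult_sg\<close> for the axes
  \<open>A 1\<close>, \<open>A 0\<close>, \<open>A (-1)\<close>. Therefore the two statements of \<open>even_square\<close> about the
  components of \<open>w\<^sup>2\<close> become linear equations for the \<open>\<alpha>\<close>-component and the projection of \<open>q\<close>.
  Finally \<open>s\<close> is a combination of \<open>A 0\<close>, \<open>v\<close> and \<open>w\<close>, and the third statement gives the only
  missing product \<open>v\<^sup>2\<close> for \<open>s\<^sup>2\<close>.
\<close>

lemma
  assumes A: "dihedral A"
  defines "l \<equiv> lam (A 0) (A 1)" and "m \<equiv> lam (A 1) (A 0)" and "l2 \<equiv> lam (A 0) (A 2)"
    and "s \<equiv> sg (A 0) (A 1)" and "p \<equiv> sg (A 0) (A 2)" and "q \<equiv> sg (A 1) (A (- 1))"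
  shows alpha_part_q: "(\<alpha> - 2 * \<beta>) *s pa (A 0) q = xx l m *s pa (A 0) (A 1) + (4 * hh) *s pa (A 0) (A 2)"
    and lam_q: "lam (A 0) q = lq l m l2"
    and axis_mult_q: "(\<alpha> - 2 * \<beta>) *s (A 0 \<odot> q) = ww l m l2 *s A 0 + xx l m *s s + (4 * hh) *s p
      + (\<beta> / 2 * xx l m) *s (A 1 + A (- 1)) + (2 * \<beta> * hh) *s (A 2 + A (- 2))"
    and square_s: "(\<alpha> - 2 * \<beta>) *s (s \<odot> s) = z_inv A + kk *s p + ll *s q + mm l m *s s"
proof -
  let ?a = "A 0" let ?v = "pa ?a (A 1)" and ?v2 = "pa ?a (A 2)"
  note ax = dihedral_axis[OF A]
  note a = ax[of 0]
  note lin = axis_linear[OF a] axis_self[OF a]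
  have q: "pb ?a q = 0"
    using inv_sg(3)[OF A] tau_fixed_iff[OF a, of q] by (simp add: q_def inv_space_def)
  have s: "pb ?a s = 0" "lam ?a s = ls l" "pa ?a s = (\<alpha> - \<beta>) *s ?v"
    using proj_sg[OF a, of "A 1"] by (simp_all add: s_def l_def)
  have tau0: "tau ?a (A n) = A (- n)" for n using dihedral_tau[OF A, of 0 n] by simp
  have neg: "lam ?a (A (- n)) = lam ?a (A n)" "pa ?a (A (- n)) = pa ?a (A n)" "pb ?a (A (- n)) = - pb ?a (A n)" for n
  proof -
    have "A (- n) = A n - 2 *s pb ?a (A n)" using tau0[of n] tau_eq[OF a] by simp
    moreover have "2 *s pb ?a (A n) = pb ?a (A n) + pb ?a (A n)" using scale_left_distrib[of 1 1 "pb ?a (A n)"] by simp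
    ultimately show "lam ?a (A (- n)) = lam ?a (A n)" "pa ?a (A (- n)) = pa ?a (A n)" "pb ?a (A (- n)) = - pb ?a (A n)"
      using a by (simp_all add: lin)
  qed
  note neg1 = neg[of 1] and neg2 = neg[of 2]
  have av: "\<alpha> *s ?v = s + (\<beta> - l) *s ?a + (\<beta> / 2) *s (A 1 + A (- 1))"
    using scaled_alpha_part[OF a, of "A 1"] by (simp add: s_def l_def tau0)
  have av2: "\<alpha> *s ?v2 = p + (\<beta> - l2) *s ?a + (\<beta> / 2) *s (A 2 + A (- 2))"
    using scaled_alpha_part[OF a, of "A 2"] by (simp add: p_def l2_def tau0)
  \<comment> \<open>the even vector without component along A 0 whose \<open>\<alpha>\<close>-component is that of A 1\<close>
  define w where "w = (1/2) *s (A 1 + A (- 1)) - l *s ?a"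
  have w: "lam ?a w = 0" "pb ?a w = 0" "pa ?a w = ?v"
    unfolding w_def using neg1 scale_left_distrib[of "1/2" "1/2" ?v]
    by (simp_all add: lin l_def scale_right_distrib)
  have as: "?a \<odot> s = ls l *s ?a + (\<alpha> * (\<alpha> - \<beta>)) *s ?v"
    using axis_mult[OF a, of s] s by simp
  have a1s: "A 1 \<odot> s = (\<alpha> - \<beta>) *s s + gg m *s A 1 + hh *s (?a + A 2)"
    using axis_mult_sg[OF ax[of 1], of ?a] by (simp add: s_def m_def sg_commute dihedral_tau[OF A])
  have am1s: "A (- 1) \<odot> s = (\<alpha> - \<beta>) *s s + gg m *s A (- 1) + hh *s (?a + A (- 2))"
  proof -
    have "lam (A (- 1)) ?a = m" using lam_reflect[OF A, of 0 1 0] by (simp add: m_def)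
    moreover have "sg (A (- 1)) ?a = s" using dihedral_sg[OF A, of 0 1] by (simp add: s_def sg_commute)
    ultimately show ?thesis
      using axis_mult_sg[OF ax[of "-1"], of ?a] by (simp add: dihedral_tau[OF A])
  qed
  have ws: "w \<odot> s = (\<alpha> - \<beta>) *s s + (gg m / 2) *s (A 1 + A (- 1)) + (hh / 2) *s (2 *s ?a + (A 2 + A (- 2))) - l *s (?a \<odot> s)"
    unfolding w_def by (rule eq_by_functionals) (simp add: bilinear a1s am1s linear_form_simps field_simps)
  have aw: "?a \<odot> w = \<alpha> *s ?v" using axis_mult[OF a, of w] w by simp
  have ae: "?a \<odot> A 1 + ?a \<odot> A (- 1) = (2 * l) *s ?a + (2 * \<alpha>) *s ?v"
    by (rule eq_by_functionals) (simp add: axis_mult[OF a] neg1 l_def linear_form_simps)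
  have prod_1: "A 1 \<odot> A (- 1) = q + \<beta> *s (A 1 + A (- 1))" "A (- 1) \<odot> A 1 = q + \<beta> *s (A 1 + A (- 1))"
    by (simp_all add: q_def mult_sg[of "A 1"] mult_commute[of "A (-1)"])
  have w2: "w \<odot> w = ((1 + 2 * \<beta>) / 4) *s (A 1 + A (- 1)) + (1/2) *s q - (l^2) *s ?a - (2 * l * \<alpha>) *s ?v"
  proof (rule eq_by_functionals)
    fix f :: "'w \<Rightarrow> 'f" assume f: "linear_form f"
    have 1: "f (?a \<odot> A 1) + f (?a \<odot> A (- 1)) = 2 * l * f ?a + 2 * \<alpha> * f ?v"
      using arg_cong[where f = f, OF ae] f by (simp add: linear_form_simps)
    have 2: "f (w \<odot> w) = (f (A 1) + f (A (- 1)) + 2 * f (A 1 \<odot> A (- 1))) / 4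
        - l * (f (?a \<odot> A 1) + f (?a \<odot> A (- 1))) + l^2 * f ?a"
      using f by (simp add: w_def bilinear linear_form_simps axis_idem ax mult_commute[of "A 1" ?a]
        mult_commute[of "A (- 1)" ?a] mult_commute[of "A (- 1)" "A 1"] field_simps power2_eq_square)
    show "f (w \<odot> w) = f (((1 + 2 * \<beta>) / 4) *s (A 1 + A (- 1)) + (1/2) *s q - (l^2) *s ?a - (2 * l * \<alpha>) *s ?v)"
      unfolding 2 1 prod_1 using f by (simp add: linear_form_simps field_simps power2_eq_square)
  qed
  have pw2: "pa ?a (w \<odot> w) = (1/2 + \<beta> - 2 * l * \<alpha>) *s ?v + (1/2) *s pa ?a q"
    unfolding w2 by (rule eq_by_functionals) (simp add: lin neg1 a linear_form_simps field_simps)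
  have lw2: "lam ?a (w \<odot> w) = (1 + 2 * \<beta>) / 2 * l + lam ?a q / 2 - l^2"
    unfolding w2 using a neg1 by (simp add: lin l_def field_simps)
  have pws: "pa ?a (w \<odot> s) = ((\<alpha> - \<beta>)^2 + gg m - l * \<alpha> * (\<alpha> - \<beta>)) *s ?v + hh *s ?v2"
    unfolding ws as by (rule eq_by_functionals)
      (simp add: lin neg1 neg2 s a linear_form_simps field_simps power2_eq_square)
  have lws: "lam ?a (w \<odot> s) = (\<alpha> - \<beta>) * ls l + gg m * l + hh * (1 + l2) - l * ls l"
    unfolding ws as using a neg1 neg2 s by (simp add: lin l_def l2_def field_simps)
  have awv: "\<alpha> *s (w \<odot> ?v) = w \<odot> s - (ls l * \<alpha>) *s ?v + \<beta> *s (w \<odot> w)"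
  proof -
    have "\<alpha> *s ?v = s + (\<beta> - l + \<beta> * l) *s ?a + \<beta> *s w"
      unfolding av w_def by (rule eq_by_functionals) (simp add: linear_form_simps field_simps)
    then have "w \<odot> (\<alpha> *s ?v) = w \<odot> s + (\<beta> - l + \<beta> * l) *s (?a \<odot> w) + \<beta> *s (w \<odot> w)"
      by (simp add: bilinear mult_commute[of w ?a])
    then have *: "\<alpha> *s (w \<odot> ?v) = w \<odot> s + (\<beta> - l + \<beta> * l) *s (?a \<odot> w) + \<beta> *s (w \<odot> w)"
      by (simp only: mult_scale_right)
    show ?thesis
      unfolding * aw by (rule eq_by_functionals) (simp add: ls_def linear_form_simps algebra_simps)
  qed
  note sq = even_square[OF a w(1,2), unfolded w(3)]
  have ppa: "pa ?a (pa ?a x) = pa ?a x" "lam ?a (pa ?a x) = 0" for x using a by simp_all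
  show Q: "(\<alpha> - 2 * \<beta>) *s pa ?a q = xx l m *s ?v + (4 * hh) *s ?v2"
  proof (rule eq_by_functionals)
    fix f :: "'w \<Rightarrow> 'f" assume f: "linear_form f"
    have 1: "\<alpha> * f (pa ?a (w \<odot> ?v)) = f (pa ?a (w \<odot> s)) - ls l * \<alpha> * f ?v + \<beta> * f (pa ?a (w \<odot> w))"
      using arg_cong[where f = "\<lambda>x. f (pa ?a x)", OF awv] f by (simp add: lin ppa linear_form_simps)
    have 2: "f (pa ?a (w \<odot> w)) = 2 * f (pa ?a (w \<odot> ?v))"
      using arg_cong[where f = f, OF sq(1)] f by (simp add: linear_form_simps)
    have 3: "f (pa ?a (w \<odot> w)) = (1/2 + \<beta> - 2 * l * \<alpha>) * f ?v + (1/2) * f (pa ?a q)"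
      using arg_cong[where f = f, OF pw2] f by (simp add: linear_form_simps)
    have 4: "f (pa ?a (w \<odot> s)) = ((\<alpha> - \<beta>)^2 + gg m - l * \<alpha> * (\<alpha> - \<beta>)) * f ?v + hh * f ?v2"
      using arg_cong[where f = f, OF pws] f by (simp add: linear_form_simps)
    have "(\<alpha> - 2 * \<beta>) * f (pa ?a (w \<odot> w)) = 2 * (f (pa ?a (w \<odot> s)) - ls l * \<alpha> * f ?v)"
      by (rule lincomb2[OF 1 2, where k = 2 and k' = "\<alpha>"]) (simp add: algebra_simps)
    note 5 = this
    have 6: "2 * f (pa ?a (w \<odot> w)) = (1 + 2 * \<beta> - 4 * l * \<alpha>) * f ?v + f (pa ?a q)"
      unfolding 3 by (simp add: algebra_simps)
    have "(\<alpha> - 2 * \<beta>) * f (pa ?a q) = xx l m * f ?v + 4 * hh * f ?v2"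
      by (rule lincomb3[OF 5 6 4, where k = 2 and k' = "- (\<alpha> - 2 * \<beta>)" and k'' = 4])
        (simp add: xx_def algebra_simps)
    then show "f ((\<alpha> - 2 * \<beta>) *s pa ?a q) = f (xx l m *s ?v + (4 * hh) *s ?v2)"
      using f by (simp add: linear_form_simps)
  qed
  have ab: "\<alpha> - \<beta> \<noteq> 0" by simp
  show LQ: "lam ?a q = lq l m l2"
  proof -
    have "\<alpha> * lam ?a (w \<odot> ?v) = lam ?a (w \<odot> s) + \<beta> * lam ?a (w \<odot> w)"
      using arg_cong[where f = "lam ?a", OF awv] by (simp add: lin ppa)
    from this sq(2) have "(\<alpha> - \<beta>) * lam ?a (w \<odot> w) = lam ?a (w \<odot> s)"
      by (rule lincomb2[where k = 1 and k' = "\<alpha>"]) (simp add: algebra_simps)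
    then have "lam ?a (w \<odot> w) = lam ?a (w \<odot> s) / (\<alpha> - \<beta>)" using ab by (simp add: field_simps)
    then have "lam ?a q = 2 * (lam ?a (w \<odot> s) / (\<alpha> - \<beta>)) - (1 + 2 * \<beta>) * l + 2 * l^2"
      unfolding lw2 by (simp add: field_simps)
    then show ?thesis unfolding lws lq_def by simp
  qed
  have aq: "?a \<odot> q = lam ?a q *s ?a + \<alpha> *s pa ?a q" using axis_mult[OF a, of q] q by simp
  show "(\<alpha> - 2 * \<beta>) *s (?a \<odot> q) = ww l m l2 *s ?a + xx l m *s s + (4 * hh) *s p
      + (\<beta> / 2 * xx l m) *s (A 1 + A (- 1)) + (2 * \<beta> * hh) *s (A 2 + A (- 2))"
  proof -
    have "(\<alpha> - 2 * \<beta>) *s (?a \<odot> q) = ((\<alpha> - 2 * \<beta>) * lq l m l2) *s ?a + \<alpha> *s ((\<alpha> - 2 * \<beta>) *s pa ?a q)"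
      unfolding aq LQ by (simp add: scale_right_distrib scale_left_commute)
    also have "\<alpha> *s ((\<alpha> - 2 * \<beta>) *s pa ?a q) = xx l m *s (\<alpha> *s ?v) + (4 * hh) *s (\<alpha> *s ?v2)"
      unfolding Q by (simp add: scale_right_distrib mult.assoc mult.commute mult.left_commute)
    finally have *: "(\<alpha> - 2 * \<beta>) *s (?a \<odot> q) = ((\<alpha> - 2 * \<beta>) * lq l m l2) *s ?a
        + (xx l m *s (\<alpha> *s ?v) + (4 * hh) *s (\<alpha> *s ?v2))" .
    show ?thesis
      unfolding * av av2 ww_def by (rule eq_by_functionals) (simp add: linear_form_simps algebra_simps)
  qed
  have sdec: "s = ls l *s ?a + \<alpha> *s ?v - \<beta> *s w"
    unfolding av w_def ls_def by (rule eq_by_functionals) (simp add: linear_form_simps field_simps)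
  have ss: "s \<odot> s = ((ls l)^2) *s ?a + (\<alpha> - 2 * \<beta>) *s (w \<odot> s) + (\<beta> * (\<alpha> - \<beta>)) *s (w \<odot> w)
      + (ls l * \<alpha>^2) *s ?v - (\<alpha>^2 / 2) *s pa ?a (w \<odot> w)"
  proof (rule eq_by_functionals)
    fix f :: "'w \<Rightarrow> 'f" assume f: "linear_form f"
    have vv: "f (?v \<odot> ?v) = f (w \<odot> ?v) - (1/2) * f (pa ?a (w \<odot> w))"
      using arg_cong[where f = f, OF sq(3)] f by (simp add: linear_form_simps)
    have wv: "\<alpha> * f (w \<odot> ?v) = f (w \<odot> s) - ls l * \<alpha> * f ?v + \<beta> * f (w \<odot> w)"
      using arg_cong[where f = f, OF awv] f by (simp add: linear_form_simps)
    have va: "?a \<odot> ?v = \<alpha> *s ?v" "?v \<odot> ?a = \<alpha> *s ?v" using axis_eigen(2)[OF a, of "A 1"] by (simp_all add: mult_commute)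
    have "s \<odot> s = (ls l *s ?a + \<alpha> *s ?v - \<beta> *s w) \<odot> (ls l *s ?a + \<alpha> *s ?v - \<beta> *s w)" using sdec by simp
    then have "f (s \<odot> s) = f ((ls l *s ?a + \<alpha> *s ?v - \<beta> *s w) \<odot> (ls l *s ?a + \<alpha> *s ?v - \<beta> *s w))" by simp
    also have "\<dots> = (ls l)^2 * f ?a + \<alpha>^2 * f (?v \<odot> ?v) + \<beta>^2 * f (w \<odot> w) + 2 * ls l * \<alpha> * \<alpha> * f ?v
        - 2 * \<alpha> * \<beta> * f (w \<odot> ?v) - 2 * ls l * \<beta> * \<alpha> * f ?v"
      using f by (simp add: bilinear va aw mult_commute[of w ?a] mult_commute[of ?v w] axis_idem[OF a] linear_form_simps
        algebra_simps power2_eq_square)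
    also have "\<dots> = (ls l)^2 * f ?a + (\<alpha> - 2 * \<beta>) * (\<alpha> * f (w \<odot> ?v)) + \<beta>^2 * f (w \<odot> w) + 2 * ls l * \<alpha> * \<alpha> * f ?v
        - \<alpha>^2 / 2 * f (pa ?a (w \<odot> w)) - 2 * ls l * \<beta> * \<alpha> * f ?v"
      unfolding vv by (simp add: algebra_simps power2_eq_square)
    also have "\<dots> = f (((ls l)^2) *s ?a + (\<alpha> - 2 * \<beta>) *s (w \<odot> s) + (\<beta> * (\<alpha> - \<beta>)) *s (w \<odot> w)
      + (ls l * \<alpha>^2) *s ?v - (\<alpha>^2 / 2) *s pa ?a (w \<odot> w))"
      unfolding wv using f by (simp add: linear_form_simps algebra_simps power2_eq_square)
    finally show "f (s \<odot> s) = f (((ls l)^2) *s ?a + (\<alpha> - 2 * \<beta>) *s (w \<odot> s) + (\<beta> * (\<alpha> - \<beta>)) *s (w \<odot> w)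
      + (ls l * \<alpha>^2) *s ?v - (\<alpha>^2 / 2) *s pa ?a (w \<odot> w))" .
  qed
  show "(\<alpha> - 2 * \<beta>) *s (s \<odot> s) = z_inv A + kk *s p + ll *s q + mm l m *s s"
  proof (rule eq_by_functionals)
    fix f :: "'w \<Rightarrow> 'f" assume f: "linear_form f"
    define v0 where "v0 = \<alpha> * f ?v"
    define v2 where "v2 = \<alpha> * f ?v2"
    define f0 where "f0 = f ?a"
    define e1 where "e1 = f (A 1) + f (A (- 1))"
    define e2 where "e2 = f (A 2) + f (A (- 2))"
    define fs where "fs = f s"
    define fp where "fp = f p"
    define fq where "fq = f q"
    define aq where "aq = \<alpha> * f (pa ?a q)"
    have V0: "v0 = fs + (\<beta> - l) * f0 + \<beta> / 2 * e1"
      using arg_cong[where f = f, OF av] f by (simp add: linear_form_simps v0_def fs_def f0_def e1_def)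
    have V2: "v2 = fp + (\<beta> - l2) * f0 + \<beta> / 2 * e2"
      using arg_cong[where f = f, OF av2] f by (simp add: linear_form_simps v2_def fp_def f0_def e2_def)
    have AQ: "(\<alpha> - 2 * \<beta>) * aq = xx l m * v0 + 4 * hh * v2"
    proof -
      have "(\<alpha> - 2 * \<beta>) * f (pa ?a q) = xx l m * f ?v + 4 * hh * f ?v2"
        using arg_cong[where f = f, OF Q] f by (simp add: linear_form_simps)
      then have "\<alpha> * ((\<alpha> - 2 * \<beta>) * f (pa ?a q)) = \<alpha> * (xx l m * f ?v + 4 * hh * f ?v2)" by simp
      then show ?thesis by (simp add: aq_def v0_def v2_def algebra_simps)
    qed
    have WS: "f (w \<odot> s) = (\<alpha> - \<beta>) * fs + gg m / 2 * e1 + hh / 2 * (2 * f0 + e2) - l * (ls l * f0 + (\<alpha> - \<beta>) * v0)"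
      unfolding ws as using f by (simp add: linear_form_simps fs_def f0_def e1_def e2_def v0_def algebra_simps)
    have W2: "f (w \<odot> w) = (1 + 2 * \<beta>) / 4 * e1 + fq / 2 - l^2 * f0 - 2 * l * v0"
      unfolding w2 using f by (simp add: linear_form_simps fq_def f0_def e1_def v0_def field_simps)
    have PW2: "\<alpha> * f (pa ?a (w \<odot> w)) = (1/2 + \<beta> - 2 * l * \<alpha>) * v0 + aq / 2"
      unfolding pw2 using f by (simp add: linear_form_simps v0_def aq_def algebra_simps)
    have SS: "f (s \<odot> s) = (ls l)^2 * f0 + (\<alpha> - 2 * \<beta>) * f (w \<odot> s) + \<beta> * (\<alpha> - \<beta>) * f (w \<odot> w)
        + ls l * \<alpha> * v0 - \<alpha> / 2 * (\<alpha> * f (pa ?a (w \<odot> w)))"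
      unfolding ss using f by (simp add: linear_form_simps f0_def v0_def power2_eq_square)
    have "(\<alpha> - 2 * \<beta>) * f (s \<odot> s) = (\<alpha> - 2 * \<beta>) * ((ls l)^2 * f0 + (\<alpha> - 2 * \<beta>) * f (w \<odot> s) + \<beta> * (\<alpha> - \<beta>) * f (w \<odot> w)
        + ls l * \<alpha> * v0 - \<alpha> / 2 * ((1/2 + \<beta> - 2 * l * \<alpha>) * v0)) - \<alpha> / 4 * ((\<alpha> - 2 * \<beta>) * aq)"
      unfolding SS PW2 by (simp add: field_simps)
    also have "\<dots> = cc * e2 + dd l m * e1 + ee l m l2 * f0 + kk * fp + ll * fq + mm l m * fs"
      unfolding AQ WS W2 V0 V2 xx_def gg_def ls_def hh_def cc_def dd_def ee_def kk_def ll_def mm_def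
      by (simp add: field_simps power2_eq_square power3_eq_cube power4_eq_xxxx)
    finally show "f ((\<alpha> - 2 * \<beta>) *s (s \<odot> s)) = f (z_inv A + kk *s p + ll *s q + mm l m *s s)"
      using f by (simp add: linear_form_simps z_inv_def l_def m_def l2_def f0_def e1_def e2_def fp_def fq_def fs_def)
  qed
qed

section \<open>Computing modulo the invariants\<close>

text \<open>
  The point \<open>(3, 2)\<close> is one at which none of the finitely many expressions that have to be
  non-zero vanishes.
\<close>

abbreviation sp :: "'f \<Rightarrow> rat \<Rightarrow> bool" where "sp \<equiv> specializes \<alpha> \<beta> 3 2"

lemma sp_eq: "sp x r \<Longrightarrow> r = s \<Longrightarrow> sp x s"
  by simp

lemma sp_nonzero: "sp x r \<Longrightarrow> r \<noteq> 0 \<Longrightarrow> x \<noteq> 0"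
  by (rule generic)

lemma sp_unique: "sp x r \<Longrightarrow> sp x s \<Longrightarrow> r = s"
  using generic[OF sp_diff[of \<alpha> \<beta> 3 2 x r x s]] by auto

lemma sp_solve: assumes "m * x + n = 0" "sp m a" "sp n b" "a \<noteq> 0" shows "sp x (- b / a)"
proof -
  have "m \<noteq> 0" by (rule sp_nonzero[OF assms(2,4)])
  then have "x = - n / m" using assms(1) by (simp add: field_simps eq_neg_iff_add_eq_0)
  then show ?thesis by (simp add: sp_divide sp_minus assms)
qed

lemma sp_solve':
  assumes "m * x + n = 0" "sp m a" "sp n b" "a \<noteq> 0" "- b / a = r" shows "sp x r"
  using sp_solve[OF assms(1-4)] assms(5) by simp

lemma nonzero_scalars [simp]:
  "\<alpha> - 2 * \<beta> \<noteq> 0" "hh \<noteq> 0" "cc \<noteq> 0" "kk - ll \<noteq> 0" "1 - 2 * \<beta> \<noteq> 0" "\<alpha> - 4 * \<beta> \<noteq> 0"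
proof -
  show "\<alpha> - 2 * \<beta> \<noteq> 0"
    by (rule sp_nonzero, (rule sp_intros | (simp; fail))+)
  show "hh \<noteq> 0" unfolding hh_def
    by (rule sp_nonzero, (rule sp_intros | (simp; fail))+)
  show "cc \<noteq> 0" unfolding cc_def
    by (rule sp_nonzero, (rule sp_intros | (simp; fail))+)
  show "kk - ll \<noteq> 0" unfolding kk_def ll_def
    by (rule sp_nonzero, (rule sp_intros | (simp; fail))+)
  show "1 - 2 * \<beta> \<noteq> 0"
    by (rule sp_nonzero, (rule sp_intros | (simp; fail))+)
  show "\<alpha> - 4 * \<beta> \<noteq> 0"
    by (rule sp_nonzero, (rule sp_intros | (simp; fail))+)
qed

text \<open>
  The functionals on the algebra modulo the invariants of the dihedral group.
\<close>

definition kills :: "(int \<Rightarrow> 'w) \<Rightarrow> ('w \<Rightarrow> 'f) \<Rightarrow> bool" where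
  "kills A f \<longleftrightarrow> linear_form f \<and> (\<forall>z\<in>inv_space A. f z = 0)"

lemma inv_space_iff: "dihedral A \<Longrightarrow> x \<in> inv_space A \<longleftrightarrow> (\<forall>f. kills A f \<longrightarrow> f x = 0)"
  using mem_subspaceI[OF subspace_inv, of A x] by (auto simp: kills_def)

lemma kills_zero: "kills A f \<Longrightarrow> z \<in> inv_space A \<Longrightarrow> f z = 0"
  by (simp add: kills_def)

lemma kills_linear:
  assumes "kills A f"
  shows "f (x + y) = f x + f y" "f (c *s x) = c * f x" "f 0 = 0" "f (- x) = - f x" "f (x - y) = f x - f y"
  using assms by (simp_all add: kills_def linear_form_simps)

lemma kills_flip: "kills (\<lambda>n. A (i - n)) f \<longleftrightarrow> kills A f"
  by (simp add: kills_def inv_space_flip)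

definition lam1 :: "(int \<Rightarrow> 'w) \<Rightarrow> int \<Rightarrow> 'f" where "lam1 A i = lam (A i) (A (i + 1))"
definition lam2 :: "(int \<Rightarrow> 'w) \<Rightarrow> int \<Rightarrow> 'f" where "lam2 A i = lam (A i) (A (i + 2))"
definition sg1 :: "(int \<Rightarrow> 'w) \<Rightarrow> 'w" where "sg1 A = sg (A 0) (A 1)"
definition sg2 :: "(int \<Rightarrow> 'w) \<Rightarrow> int \<Rightarrow> 'w" where "sg2 A i = sg (A i) (A (i + 2))"

lemma lam1_back: assumes "dihedral A" shows "lam (A i) (A (i - 1)) = lam1 A i"
  using lam_reflect[OF assms, of i i "i + 1"] by (simp add: lam1_def)

lemma lam2_back: assumes "dihedral A" shows "lam (A i) (A (i - 2)) = lam2 A i"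
  using lam_reflect[OF assms, of i i "i + 2"] by (simp add: lam2_def)

lemma lam1_period: assumes "dihedral A" shows "lam1 A (i + 2) = lam1 A i"
  using dihedral_lam_shift[OF assms, of i 1 "i + 1"] by (simp add: lam1_def algebra_simps)

lemma lam2_period: assumes "dihedral A" shows "lam2 A (i + 2) = lam2 A i"
  using dihedral_lam_shift[OF assms, of i 1 "i + 2"] by (simp add: lam2_def algebra_simps)

lemma lam_flip:
  assumes "dihedral A"
  shows "lam1 (\<lambda>n. A (j - n)) i = lam1 A (j - i)" "lam2 (\<lambda>n. A (j - n)) i = lam2 A (j - i)"
proof -
  have "j - (i + 1) = (j - i) - 1" "j - (i + 2) = (j - i) - 2" by simp_all
  then show "lam1 (\<lambda>n. A (j - n)) i = lam1 A (j - i)" "lam2 (\<lambda>n. A (j - n)) i = lam2 A (j - i)"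
    using lam1_back[OF assms, of "j - i"] lam2_back[OF assms, of "j - i"]
    by (simp_all only: lam1_def lam2_def)
qed

text \<open>
  A property of period 2 needs to be checked for two consecutive indices only. All projections
  and all values of \<open>sg\<close> at fixed distance have period 2, since the dihedral group contains
  the translation by 2.
\<close>

lemma parity_induct:
  fixes i :: int
  assumes "P 0" "P 1" "\<And>i. P (i + 2) = P i"
  shows "P i"
proof -
  have "P i = P (i mod 2)"
  proof -
    have "P (j + 2 * k) = P j" for j k
    proof (induction k rule: int_induct[of _ 0])
      case base
      show ?case by simp
    next
      case (step1 k)
      have "j + 2 * (k + 1) = (j + 2 * k) + 2" by simp
      then show ?case using step1 assms(3) by metis
    next
      case (step2 k)
      have "(j + 2 * (k - 1)) + 2 = j + 2 * k" by simp
      then show ?case using step2 assms(3) by metis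
    qed
    from this[of "i mod 2" "i div 2"] show ?thesis by (simp add: mod_mult_div_eq)
  qed
  moreover have "i mod 2 = 0 \<or> i mod 2 = 1" by presburger
  ultimately show ?thesis using assms(1,2) by metis
qed

lemma sg2_period: assumes "dihedral A" shows "sg2 A (i + 2) = sg2 A i"
  using dihedral_sg_2[OF assms, of i] dihedral_sg_2[OF assms, of "i + 2"] by (simp add: sg2_def)

lemma sg2_pred: assumes "dihedral A" shows "sg2 A (i - 1) = sg2 A (i + 1)"
  using sg2_period[OF assms, of "i - 1"] by (simp add: add.commute)

lemma sg1_shift: assumes "dihedral A" shows "sg (A i) (A (i + 1)) = sg1 A"
  using dihedral_sg_1[OF assms, of i] by (simp add: sg1_def)

lemma inv_sg1: "dihedral A \<Longrightarrow> sg1 A \<in> inv_space A"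
  by (simp add: sg1_def inv_sg)

lemma inv_sg2: assumes A: "dihedral A" shows "sg2 A i \<in> inv_space A"
proof (rule parity_induct[where P = "\<lambda>i. sg2 A i \<in> inv_space A"])
  show "sg2 A 0 \<in> inv_space A" using inv_sg(2)[OF A] by (simp add: sg2_def)
  show "sg2 A 1 \<in> inv_space A"
    using inv_sg(3)[OF A] dihedral_sg[OF A, of 1 "-1"] by (simp add: sg2_def)
qed (simp add: sg2_period[OF A])

text \<open>
  The part that is spanned by axes of \<open>\<alpha> - 2 * \<beta>\<close> times the square of \<open>sg1 A\<close>, in the
  formula centred at \<open>A i\<close>.
\<close>

definition zc :: "(int \<Rightarrow> 'w) \<Rightarrow> int \<Rightarrow> 'w" where
  "zc A i = cc *s (A (i + 2) + A (i - 2)) + dd (lam1 A i) (lam1 A (i + 1)) *s (A (i + 1) + A (i - 1))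
     + ee (lam1 A i) (lam1 A (i + 1)) (lam2 A i) *s A i"

lemma shifted:
  assumes A: "dihedral A"
  shows "sg (A i) (A (i + 1)) = sg1 A" "sg (A i) (A (i + 2)) = sg2 A i"
    "sg (A (i + 1)) (A (i - 1)) = sg2 A (i + 1)" "lam (A (i + 1)) (A i) = lam1 A (i + 1)"
    "z_inv (\<lambda>n. A (i + n)) = zc A i"
proof -
  show 1: "sg (A i) (A (i + 1)) = sg1 A" "sg (A i) (A (i + 2)) = sg2 A i"
    by (simp_all add: sg1_shift[OF A] sg2_def)
  show "sg (A (i + 1)) (A (i - 1)) = sg2 A (i + 1)"
    using sg2_pred[OF A, of i] by (simp add: sg2_def sg_commute add.commute)
  show 2: "lam (A (i + 1)) (A i) = lam1 A (i + 1)" using lam1_back[OF A, of "i + 1"] by simp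
  show "z_inv (\<lambda>n. A (i + n)) = zc A i"
    by (simp add: z_inv_def zc_def 2 lam1_def lam2_def)
qed

lemma square_sg1:
  assumes A: "dihedral A"
  shows "(\<alpha> - 2 * \<beta>) *s (sg1 A \<odot> sg1 A) = zc A i + kk *s sg2 A i + ll *s sg2 A (i + 1)
      + mm (lam1 A i) (lam1 A (i + 1)) *s sg1 A"
  using square_s[OF dihedral_shift[OF A, of i]] by (simp add: shifted[OF A] flip: lam1_def)

text \<open>
  The recurrence for five consecutive axes modulo the invariants: everything else in the
  formula for the square of \<open>sg1 A\<close> is invariant.
\<close>

lemma inv_zc: assumes A: "dihedral A" shows "zc A i \<in> inv_space A"
proof -
  have "zc A i = (\<alpha> - 2 * \<beta>) *s (sg1 A \<odot> sg1 A) - kk *s sg2 A i - ll *s sg2 A (i + 1)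
      - mm (lam1 A i) (lam1 A (i + 1)) *s sg1 A"
    by (simp add: square_sg1[OF A, of i])
  also have "\<dots> \<in> inv_space A"
    by (intro subspace_diff subspace_scale subspace_inv A inv_mult inv_sg1 inv_sg2)
  finally show ?thesis .
qed

text \<open>
  The square of \<open>sg1 A\<close> can be computed from \<open>A i\<close> and from \<open>A (i + 1)\<close>.
\<close>

lemma two_squares:
  assumes A: "dihedral A"
  shows "zc A i + (kk - ll) *s (sg2 A i - sg2 A (i + 1)) + (mm (lam1 A i) (lam1 A (i + 1)) - mm (lam1 A (i + 1)) (lam1 A i)) *s sg1 A
    = zc A (i + 1)"
proof -
  have *: "zc A i + kk *s sg2 A i + ll *s sg2 A (i + 1) + mm (lam1 A i) (lam1 A (i + 1)) *s sg1 A
    = zc A (i + 1) + kk *s sg2 A (i + 1) + ll *s sg2 A i + mm (lam1 A (i + 1)) (lam1 A i) *s sg1 A"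
    using square_sg1[OF A, of i] square_sg1[OF A, of "i + 1"] lam1_period[OF A, of i] sg2_period[OF A, of i]
    by (simp add: algebra_simps)
  show ?thesis
  proof (rule eq_by_functionals)
    fix f :: "'w \<Rightarrow> 'f" assume f: "linear_form f"
    show "f (zc A i + (kk - ll) *s (sg2 A i - sg2 A (i + 1))
        + (mm (lam1 A i) (lam1 A (i + 1)) - mm (lam1 A (i + 1)) (lam1 A i)) *s sg1 A) = f (zc A (i + 1))"
      by (rule lincomb1[OF arg_cong[where f = f, OF *], where k = 1])
        (simp add: linear_form_simps[OF f] algebra_simps)
  qed
qed

lemma mult_sg_center:
  assumes A: "dihedral A"
  shows "A i \<odot> sg1 A = (\<alpha> - \<beta>) *s sg1 A + gg (lam1 A i) *s A i + hh *s (A (i + 1) + A (i - 1))"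
    "A i \<odot> sg2 A i = (\<alpha> - \<beta>) *s sg2 A i + gg (lam2 A i) *s A i + hh *s (A (i + 2) + A (i - 2))"
    "(\<alpha> - 2 * \<beta>) *s (A i \<odot> sg2 A (i + 1)) = ww (lam1 A i) (lam1 A (i + 1)) (lam2 A i) *s A i
      + xx (lam1 A i) (lam1 A (i + 1)) *s sg1 A + (4 * hh) *s sg2 A i
      + (\<beta> / 2 * xx (lam1 A i) (lam1 A (i + 1))) *s (A (i + 1) + A (i - 1)) + (2 * \<beta> * hh) *s (A (i + 2) + A (i - 2))"
proof -
  have t: "tau (A i) (A (i + 1)) = A (i - 1)" "tau (A i) (A (i + 2)) = A (i - 2)"
    by (simp_all add: dihedral_tau[OF A])
  show "A i \<odot> sg1 A = (\<alpha> - \<beta>) *s sg1 A + gg (lam1 A i) *s A i + hh *s (A (i + 1) + A (i - 1))"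
    using axis_mult_sg[OF dihedral_axis[OF A], of i "A (i + 1)"] by (simp add: shifted[OF A] t lam1_def)
  show "A i \<odot> sg2 A i = (\<alpha> - \<beta>) *s sg2 A i + gg (lam2 A i) *s A i + hh *s (A (i + 2) + A (i - 2))"
    using axis_mult_sg[OF dihedral_axis[OF A], of i "A (i + 2)"] by (simp add: shifted[OF A] t lam2_def)
  show "(\<alpha> - 2 * \<beta>) *s (A i \<odot> sg2 A (i + 1)) = ww (lam1 A i) (lam1 A (i + 1)) (lam2 A i) *s A i
      + xx (lam1 A i) (lam1 A (i + 1)) *s sg1 A + (4 * hh) *s sg2 A i
      + (\<beta> / 2 * xx (lam1 A i) (lam1 A (i + 1))) *s (A (i + 1) + A (i - 1)) + (2 * \<beta> * hh) *s (A (i + 2) + A (i - 2))"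
    using axis_mult_q[OF dihedral_shift[OF A, of i]] by (simp add: shifted[OF A] flip: lam1_def lam2_def)
qed

lemma kills_mult:
  assumes A: "dihedral A" and f: "kills A f"
  shows "f (A i \<odot> sg1 A) = gg (lam1 A i) * f (A i) + hh * (f (A (i + 1)) + f (A (i - 1)))"
    "f (A i \<odot> sg2 A i) = gg (lam2 A i) * f (A i) + hh * (f (A (i + 2)) + f (A (i - 2)))"
    "(\<alpha> - 2 * \<beta>) * f (A i \<odot> sg2 A (i + 1)) = ww (lam1 A i) (lam1 A (i + 1)) (lam2 A i) * f (A i)
      + \<beta> / 2 * xx (lam1 A i) (lam1 A (i + 1)) * (f (A (i + 1)) + f (A (i - 1))) + 2 * \<beta> * hh * (f (A (i + 2)) + f (A (i - 2)))"
    "f (A i \<odot> A (i + 1)) = \<beta> * (f (A i) + f (A (i + 1)))"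
    "f (A i \<odot> A (i + 2)) = \<beta> * (f (A i) + f (A (i + 2)))"
    "cc * (f (A (i + 2)) + f (A (i - 2))) + dd (lam1 A i) (lam1 A (i + 1)) * (f (A (i + 1)) + f (A (i - 1)))
     + ee (lam1 A i) (lam1 A (i + 1)) (lam2 A i) * f (A i) = 0"
proof -
  note l = kills_linear[OF f]
  have z: "f (sg1 A) = 0" "f (sg2 A j) = 0" "f (zc A j) = 0" for j
    using kills_zero[OF f] inv_sg1[OF A] inv_sg2[OF A] inv_zc[OF A] by blast+
  show "f (A i \<odot> sg1 A) = gg (lam1 A i) * f (A i) + hh * (f (A (i + 1)) + f (A (i - 1)))"
    "f (A i \<odot> sg2 A i) = gg (lam2 A i) * f (A i) + hh * (f (A (i + 2)) + f (A (i - 2)))"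
    by (simp_all add: mult_sg_center[OF A] l z)
  show "(\<alpha> - 2 * \<beta>) * f (A i \<odot> sg2 A (i + 1)) = ww (lam1 A i) (lam1 A (i + 1)) (lam2 A i) * f (A i)
      + \<beta> / 2 * xx (lam1 A i) (lam1 A (i + 1)) * (f (A (i + 1)) + f (A (i - 1))) + 2 * \<beta> * hh * (f (A (i + 2)) + f (A (i - 2)))"
    using arg_cong[where f = f, OF mult_sg_center(3)[OF A, of i]] by (simp add: l z)
  show "f (A i \<odot> A (i + 1)) = \<beta> * (f (A i) + f (A (i + 1)))"
    "f (A i \<odot> A (i + 2)) = \<beta> * (f (A i) + f (A (i + 2)))"
    using z(1) z(2)[of i] by (simp_all add: mult_sg[of "A i"] shifted[OF A] l)
  show "cc * (f (A (i + 2)) + f (A (i - 2))) + dd (lam1 A i) (lam1 A (i + 1)) * (f (A (i + 1)) + f (A (i - 1)))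
     + ee (lam1 A i) (lam1 A (i + 1)) (lam2 A i) * f (A i) = 0"
    using z(3)[of i] by (simp add: zc_def l)
qed

lemma kills_inv_mult: "dihedral A \<Longrightarrow> kills A f \<Longrightarrow> x \<in> inv_space A \<Longrightarrow> y \<in> inv_space A \<Longrightarrow> f (x \<odot> y) = 0"
  by (rule kills_zero[OF _ inv_mult])

text \<open>
  Squares of invariants are invariant, and modulo the invariants the product of two axes at
  distance 1 or 2 is \<open>\<beta>\<close> times their sum. So the square of the given invariant is again a
  multiple of \<open>A i\<close> modulo the invariants, and the factor
  \<open>N * (N + 1) * (1 - 2 * \<beta>)\<close> has to vanish.
\<close>

lemma ratio_zero_or_minus_one:
  assumes A: "dihedral A" and y: "A (i + 1) + A (i - 1) - N *s A i \<in> inv_space A" and i: "A i \<notin> inv_space A"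
  shows "N = 0 \<or> N = -1"
proof -
  obtain f where f: "kills A f" "f (A i) \<noteq> 0" using inv_space_iff[OF A] i by blast
  note l = kills_linear[OF f(1)]
  let ?E = "f (A (i + 1)) + f (A (i - 1))"
  have E: "?E = N * f (A i)" using kills_zero[OF f(1) y] by (simp add: l)
  have p: "f (A i \<odot> A (i + 1)) = \<beta> * (f (A i) + f (A (i + 1)))"
    "f (A i \<odot> A (i - 1)) = \<beta> * (f (A i) + f (A (i - 1)))"
    "f (A (i + 1) \<odot> A (i - 1)) = \<beta> * ?E"
    using kills_mult(4)[OF A f(1), of i] kills_mult(4)[OF A f(1), of "i - 1"] kills_mult(5)[OF A f(1), of "i - 1"]
    by (simp_all add: mult_commute add.commute)
  define a b c where "a = A i" and "b = A (i + 1)" and "c = A (i - 1)"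
  have idem: "a \<odot> a = a" "b \<odot> b = b" "c \<odot> c = c"
    by (simp_all add: a_def b_def c_def axis_idem dihedral_axis[OF A])
  let ?y = "b + c - N *s a"
  note y' = y[folded a_def b_def c_def] and p' = p[folded a_def b_def c_def] and E' = E[folded a_def b_def c_def]
  have "0 = f (?y \<odot> ?y)" using kills_inv_mult[OF A f(1) y' y'] by simp
  also have "\<dots> = f b + f c + 2 * f (b \<odot> c) - 2 * N * (f (a \<odot> b) + f (a \<odot> c)) + N^2 * f a"
    by (simp add: bilinear l idem mult_commute[of b a] mult_commute[of c a] mult_commute[of c b]
      algebra_simps power2_eq_square)
  also have "\<dots> = (1 + 2 * \<beta>) * (f b + f c) - 2 * N * \<beta> * (2 * f a + (f b + f c)) + N^2 * f a"
    unfolding p' by (simp add: algebra_simps)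
  also have "\<dots> = N * (N + 1) * (1 - 2 * \<beta>) * f a"
    unfolding E' by (simp add: algebra_simps power2_eq_square)
  finally have "N * (N + 1) * (1 - 2 * \<beta>) * f a = 0" by simp
  then have "N = 0 \<or> N + 1 = 0"
    using f(2) nonzero_scalars(5) unfolding a_def mult_eq_0_iff by blast
  then show ?thesis by (simp add: eq_neg_iff_add_eq_0)
qed

text \<open>
  In a sequence with \<open>lam1\<close> constantly \<open>l\<close> and \<open>lam2\<close> constantly \<open>l2\<close>, multiplication of
  \<open>A i\<close> by \<open>sg2 A (i + 1) - sg2 A i\<close> gives, modulo the invariants and up to the
  factor \<open>\<alpha> - 2 * \<beta>\<close>, the combination of the axes at distance 0, 1, 2 from \<open>A i\<close> with the
  coefficients \<open>P0\<close>, \<open>P1\<close>, \<open>P2\<close>.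
\<close>

definition P2 :: 'f where "P2 = - hh * (\<alpha> - 4 * \<beta>)"
definition P1 :: "'f \<Rightarrow> 'f" where "P1 l = \<beta> / 2 * xx l l"
definition P0 :: "'f \<Rightarrow> 'f \<Rightarrow> 'f" where "P0 l l2 = ww l l l2 - (\<alpha> - 2 * \<beta>) * gg l2"

text \<open>
  The first three relations are instances of the recurrence, symmetrised about \<open>A 0\<close>. For the
  fourth one the invariant vector \<open>zc A 0\<close> is multiplied by the invariant \<open>sg2 A 0\<close>; the
  result vanishes modulo the invariants, and the recurrence eliminates the axes at distances
  2, 3 and 4. For the last one the relation \<open>two_squares\<close> is multiplied by \<open>A 1\<close>. The only
  product that is not known modulo the invariants is the one of \<open>A 1\<close> and \<open>A (-2)\<close>, at
  distance 3. It is symmetric in the two axes, so the reflection \<open>n \<mapsto> -1 - n\<close> of the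
  sequence expresses it in a second way; the difference of both expressions is then
  symmetrised about \<open>A 0\<close>.
\<close>

lemma symmetric_relations:
  assumes A: "dihedral A" and f: "kills A f" and sym: "lam1 A 0 = l" "lam1 A 1 = l" "lam2 A 0 = l2" "lam2 A 1 = l2"
  defines "d \<equiv> dd l l" and "e \<equiv> ee l l l2"
  defines "E1 \<equiv> f (A 1) + f (A (-1))" and "E2 \<equiv> f (A 2) + f (A (-2))" and "E3 \<equiv> f (A 3) + f (A (-3))"
    and "E4 \<equiv> f (A 4) + f (A (-4))" and "F \<equiv> f (A 0)"
  shows "cc * E2 + d * E1 + e * F = 0" "cc * (E3 + E1) + d * (E2 + 2 * F) + e * E1 = 0"
    "cc * (E4 + 2 * F) + d * (E3 + E1) + e * E2 = 0"
    "d * ((cc^2 * P0 l l2 - cc * d * P1 l + P2 * (d^2 - cc * e)) * E1 + (2 * cc - e) * (cc * P1 l - P2 * d) * F) = 0"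
    "(\<alpha> - 2 * \<beta>) * (1 - 2 * \<beta>) * (e - d) * (E1 - E2) = (kk - ll) * (P0 l l2 * (E1 - E2)
      + P1 l * (E2 + 2 * F - E3 - E1) + P2 * (E3 + E1 - E4 - 2 * F))"
proof -
  have l1: "lam1 A i = l" and l2: "lam2 A i = l2" for i
    by (rule parity_induct[of "\<lambda>i. lam1 A i = l"], use sym lam1_period[OF A] in simp_all)
      (rule parity_induct[of "\<lambda>i. lam2 A i = l2"], use sym lam2_period[OF A] in simp_all)
  note m = kills_mult[OF A, unfolded l1 l2, folded d_def e_def]
  have rec: "cc * (f (A (i + 2)) + f (A (i - 2))) + d * (f (A (i + 1)) + f (A (i - 1))) + e * f (A i) = 0"
    if "kills A f" for f i by (rule m(6)[OF that])
  show R0: "cc * E2 + d * E1 + e * F = 0"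
    using rec[OF f, of 0] by (simp add: E2_def E1_def F_def)
  show R1: "cc * (E3 + E1) + d * (E2 + 2 * F) + e * E1 = 0"
    by (rule lincomb2[OF rec[OF f, of 1] rec[OF f, of "-1"], where k = 1 and k' = 1])
      (simp add: E1_def E2_def E3_def F_def algebra_simps)
  show R2: "cc * (E4 + 2 * F) + d * (E3 + E1) + e * E2 = 0"
    by (rule lincomb2[OF rec[OF f, of 2] rec[OF f, of "-2"], where k = 1 and k' = 1])
      (simp add: E1_def E2_def E3_def E4_def F_def algebra_simps)
  let ?G = "\<alpha> - 2 * \<beta>"
  note lf = kills_linear[OF f]
  have sg: "sg2 A (-1) = sg2 A 1" "sg2 A (-2) = sg2 A 0" "sg2 A 2 = sg2 A 0" "sg2 A 3 = sg2 A 1"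
    using sg2_period[OF A, of "-1"] sg2_period[OF A, of "-2"] sg2_period[OF A, of 0] sg2_period[OF A, of 1] by simp_all
  have even: "f (A i \<odot> sg2 A 0) = gg l2 * f (A i) + hh * (f (A (i + 2)) + f (A (i - 2)))" if "i \<in> {0, 2, -2}" for i
    using m(2)[OF f, of i] that sg by auto
  have odd: "?G * f (A i \<odot> sg2 A 0) = ww l l l2 * f (A i)
      + P1 l * (f (A (i + 1)) + f (A (i - 1))) + 2 * \<beta> * hh * (f (A (i + 2)) + f (A (i - 2)))" if "i \<in> {1, -1}" for i
    using m(3)[OF f, of i] that sg by (auto simp: P1_def)
  have "f (sg2 A 0 \<odot> zc A 0) = 0"
    by (rule kills_inv_mult[OF A f inv_sg2[OF A] inv_zc[OF A]])
  then have Z: "cc * (f (A 2 \<odot> sg2 A 0) + f (A (-2) \<odot> sg2 A 0)) + d * (f (A 1 \<odot> sg2 A 0) + f (A (-1) \<odot> sg2 A 0))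
      + e * f (A 0 \<odot> sg2 A 0) = 0"
    by (simp add: zc_def l1 l2 d_def e_def bilinear lf mult_commute[of "sg2 A 0"])
  have PZ: "cc * (?G * (gg l2 * E2 + hh * (E4 + 2 * F))) + d * (ww l l l2 * E1 + P1 l * (E2 + 2 * F) + 2 * \<beta> * hh * (E3 + E1))
      + e * (?G * (gg l2 * F + hh * E2)) = 0"
  proof -
    have "cc * (?G * (gg l2 * E2 + hh * (E4 + 2 * F))) + d * (ww l l l2 * E1 + P1 l * (E2 + 2 * F) + 2 * \<beta> * hh * (E3 + E1))
      + e * (?G * (gg l2 * F + hh * E2))
      = cc * ?G * (f (A 2 \<odot> sg2 A 0) + f (A (-2) \<odot> sg2 A 0)) + d * (?G * f (A 1 \<odot> sg2 A 0) + ?G * f (A (-1) \<odot> sg2 A 0))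
        + e * ?G * f (A 0 \<odot> sg2 A 0)"
      unfolding odd[of 1, simplified] odd[of "-1", simplified] even[of 0, simplified] even[of 2, simplified] even[of "-2", simplified]
      by (simp add: E1_def E2_def E3_def E4_def F_def algebra_simps)
    also have "\<dots> = ?G * (cc * (f (A 2 \<odot> sg2 A 0) + f (A (-2) \<odot> sg2 A 0)) + d * (f (A 1 \<odot> sg2 A 0) + f (A (-1) \<odot> sg2 A 0))
      + e * f (A 0 \<odot> sg2 A 0))" by (simp add: algebra_simps)
    finally show ?thesis using Z by simp
  qed
  have P2': "2 * \<beta> * hh - ?G * hh = P2" by (simp add: P2_def algebra_simps)
  have PZ2: "d * (P0 l l2 * E1 + P1 l * (E2 + 2 * F) + P2 * (E3 + E1)) = 0"
    by (rule lincomb3[OF PZ R0 R2, where k = 1 and k' = "- ?G * gg l2" and k'' = "- ?G * hh"])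
      (simp add: P2'[symmetric] P0_def algebra_simps)
  have "cc^2 * (d * (P0 l l2 * E1 + P1 l * (E2 + 2 * F) + P2 * (E3 + E1))) = 0" using PZ2 by simp
  from this R1 R0
  show "d * ((cc^2 * P0 l l2 - cc * d * P1 l + P2 * (d^2 - cc * e)) * E1 + (2 * cc - e) * (cc * P1 l - P2 * d) * F) = 0"
    by (rule lincomb3[where k = 1 and k' = "- cc * d * P2" and k'' = "- d * (cc * P1 l - P2 * d)"])
      (simp add: algebra_simps power2_eq_square)
  have S: "?G * (1 - 2 * \<beta>) * (e - d) * (f (A 1) - f (A (-2))) = (kk - ll) * (P0 l l2 * (f (A 1) - f (A (-2)))
      + P1 l * (f (A 2) + f (A 0) - f (A (-3)) - f (A (-1))) + P2 * (f (A 3) + f (A (-1)) - f (A (-4)) - f (A 0)))"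
    if A: "dihedral A" and f: "kills A f" and l1: "\<And>i. lam1 A i = l" and l2: "\<And>i. lam2 A i = l2" for A f
  proof -
    have T: "?G * cc * (f (A 1 \<odot> A (-2)) - \<beta> * (f (A 1) + f (A (-2))))
       = ?G * (1 - 2 * \<beta>) * (e - d) * f (A 1) - (kk - ll) * (P0 l l2 * f (A 1) + P1 l * (f (A 2) + f (A 0)) + P2 * (f (A 3) + f (A (-1))))"
      if A: "dihedral A" and f: "kills A f" and l1: "\<And>i. lam1 A i = l" and l2: "\<And>i. lam2 A i = l2" for A f
    proof -
      note lf = kills_linear[OF f]
      note m = kills_mult[OF A f, unfolded l1 l2, folded d_def e_def]
      have R: "zc A 0 + (kk - ll) *s (sg2 A 0 - sg2 A 1) = zc A 1"
        using two_squares[OF A, of 0] by (simp add: l1)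
      have 1: "f (A 1 \<odot> zc A 0) + (kk - ll) * (f (A 1 \<odot> sg2 A 0) - f (A 1 \<odot> sg2 A 1)) = f (A 1 \<odot> zc A 1)"
        using arg_cong[where f = "\<lambda>x. f (A 1 \<odot> x)", OF R] by (simp add: bilinear lf)
      have p: "f (A 1 \<odot> A 2) = \<beta> * (f (A 1) + f (A 2))" "f (A 1 \<odot> A 0) = \<beta> * (f (A 1) + f (A 0))"
        "f (A 1 \<odot> A 3) = \<beta> * (f (A 1) + f (A 3))" "f (A 1 \<odot> A (-1)) = \<beta> * (f (A 1) + f (A (-1)))"
        using m(4)[of 1] m(4)[of 0] m(5)[of 1] m(5)[of "-1"] by (simp_all add: mult_commute add.commute)
      have a1: "A 1 \<odot> A 1 = A 1" by (rule axis_idem[OF dihedral_axis[OF A]])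
      have z0: "f (A 1 \<odot> zc A 0) = cc * (\<beta> * (f (A 1) + f (A 2)) + f (A 1 \<odot> A (-2)))
          + d * (f (A 1) + \<beta> * (f (A 1) + f (A (-1)))) + e * (\<beta> * (f (A 1) + f (A 0)))"
        by (simp add: zc_def l1 l2 bilinear lf p a1 d_def e_def)
      have z1: "f (A 1 \<odot> zc A 1) = cc * (\<beta> * (f (A 1) + f (A 3)) + \<beta> * (f (A 1) + f (A (-1))))
          + d * (\<beta> * (f (A 1) + f (A 2)) + \<beta> * (f (A 1) + f (A 0))) + e * f (A 1)"
        by (simp add: zc_def l1 l2 bilinear lf p a1 d_def e_def)
      have s1: "f (A 1 \<odot> sg2 A 1) = gg l2 * f (A 1) + hh * (f (A 3) + f (A (-1)))" using m(2)[of 1] by simp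
      have s0: "?G * f (A 1 \<odot> sg2 A 0) = ww l l l2 * f (A 1) + P1 l * (f (A 2) + f (A 0)) + 2 * \<beta> * hh * (f (A 3) + f (A (-1)))"
        using m(3)[of 1] sg2_period[OF A, of 0] by (simp add: P1_def)
      have r: "cc * (f (A 2) + f (A (-2))) + d * (f (A 1) + f (A (-1))) + e * f (A 0) = 0"
        "cc * (f (A 3) + f (A (-1))) + d * (f (A 2) + f (A 0)) + e * f (A 1) = 0"
        using m(6)[of 0] m(6)[of 1] by simp_all
      have "?G * (cc * (f (A 1 \<odot> A (-2)) - \<beta> * (f (A 1) + f (A (-2)))) - (1 - 2 * \<beta>) * (e - d) * f (A 1))
          = - (kk - ll) * (?G * f (A 1 \<odot> sg2 A 0) - ?G * f (A 1 \<odot> sg2 A 1))"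
        by (rule lincomb3[OF 1[unfolded z0 z1] r, where k = ?G and k' = "- ?G * \<beta>" and k'' = "?G * \<beta>"])
          (simp add: algebra_simps)
      also have "\<dots> = - (kk - ll) * (P0 l l2 * f (A 1) + P1 l * (f (A 2) + f (A 0)) + P2 * (f (A 3) + f (A (-1))))"
        unfolding s0 s1 P2'[symmetric] P0_def by (simp add: algebra_simps)
      finally show ?thesis by (simp add: algebra_simps)
    qed
    let ?B = "\<lambda>n. A (- 1 - n)"
    have B: "dihedral ?B" "kills ?B f" using dihedral_flip[OF A] f by (simp_all add: kills_flip)
    have Bl: "lam1 ?B i = l" "lam2 ?B i = l2" for i by (simp_all add: lam_flip[OF A] l1 l2)
    show ?thesis
      by (rule lincomb2[OF T[OF A f l1 l2] T[OF B Bl], where k = "-1" and k' = 1])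
        (simp add: mult_commute algebra_simps)
  qed
  let ?B = "\<lambda>n. A (0 - n)"
  have B: "dihedral ?B" "kills ?B f" using dihedral_flip[OF A, of 0] f kills_flip[of A 0 f] by simp_all
  have Bl: "lam1 ?B i = l" "lam2 ?B i = l2" for i by (simp_all only: lam_flip[OF A] l1 l2)
  show "?G * (1 - 2 * \<beta>) * (e - d) * (E1 - E2) = (kk - ll) * (P0 l l2 * (E1 - E2)
      + P1 l * (E2 + 2 * F - E3 - E1) + P2 * (E3 + E1 - E4 - 2 * F))"
    by (rule lincomb2[OF S[OF A f l1 l2] S[OF B Bl], where k = 1 and k' = 1])
      (simp add: E1_def E2_def E3_def E4_def F_def algebra_simps)
qed

section \<open>Exceptional parameter values do not occur\<close>

lemmas scalar_defs = P0_def P1_def P2_def cc_def dd_def ee_def kk_def ll_def mm_def xx_def lq_def ww_def gg_def ls_def hh_def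

text \<open>
  The quantities in play are of degree one in \<open>l2\<close>, so one equation determines \<open>l2\<close>.
\<close>

lemma linear_in_second:
  "ee l m l2 = \<alpha> * \<beta> * (\<alpha> - \<beta>) / 2 * l2 + ee l m 0"
  "lq l m l2 = \<beta> * l2 + lq l m 0"
  "ww l m l2 = ((\<alpha> - 2 * \<beta>) * \<beta> - 4 * hh) * l2 + ww l m 0"
  "P0 l l2 = ((\<alpha> - 2 * \<beta>) * \<beta> - 4 * hh - (\<alpha> - 2 * \<beta>) * (1 - \<alpha>)) * l2 + P0 l 0"
proof -
  show "ee l m l2 = \<alpha> * \<beta> * (\<alpha> - \<beta>) / 2 * l2 + ee l m 0" by (simp add: ee_def)
  show lq: "lq l m l2 = \<beta> * l2 + lq l m 0" for l m l2 by (simp add: lq_def hh_def field_simps)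
  show ww: "ww l m l2 = ((\<alpha> - 2 * \<beta>) * \<beta> - 4 * hh) * l2 + ww l m 0" for l m l2
    unfolding ww_def lq[of l m l2] by (simp add: algebra_simps)
  show "P0 l l2 = ((\<alpha> - 2 * \<beta>) * \<beta> - 4 * hh - (\<alpha> - 2 * \<beta>) * (1 - \<alpha>)) * l2 + P0 l 0"
    unfolding P0_def ww[of l l l2] by (simp add: gg_def algebra_simps)
qed

text \<open>
  The hypotheses say that \<open>P0, P1, P2\<close> are proportional to the coefficients \<open>ee, dd, cc\<close>
  of the recurrence. The first equation is linear in \<open>l\<close>, the second one in \<open>l2\<close>.
\<close>

lemma exclude_proportional:
  assumes J: "cc * P1 l - P2 * dd l l = 0" and K: "cc * P0 l l2 - P2 * ee l l l2 = 0"
  shows "ee l l l2 - dd l l \<noteq> 0" "cc + dd l l \<noteq> 0"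
proof -
  let ?J = "\<lambda>l. cc * P1 l - P2 * dd l l" and ?K = "\<lambda>l2. cc * P0 l l2 - P2 * ee l l l2"
  have "(?J 1 - ?J 0) * l + ?J 0 = ?J l"
    unfolding scalar_defs by (simp add: field_simps)
  then have "(?J 1 - ?J 0) * l + ?J 0 = 0" using J by simp
  then have l: "sp l 1"
    by (rule sp_solve') (unfold scalar_defs, (rule sp_intros | (simp; fail))+)
  have "(cc * ((\<alpha> - 2 * \<beta>) * \<beta> - 4 * hh - (\<alpha> - 2 * \<beta>) * (1 - \<alpha>)) - P2 * (\<alpha> * \<beta> * (\<alpha> - \<beta>) / 2)) * l2 + ?K 0 = ?K l2"
    unfolding linear_in_second(1)[of l l l2] linear_in_second(4)[of l l2] by (simp add: algebra_simps)
  then have "(cc * ((\<alpha> - 2 * \<beta>) * \<beta> - 4 * hh - (\<alpha> - 2 * \<beta>) * (1 - \<alpha>)) - P2 * (\<alpha> * \<beta> * (\<alpha> - \<beta>) / 2)) * l2 + ?K 0 = 0"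
    using K by simp
  then have l2: "sp l2 1"
    by (rule sp_solve') (unfold scalar_defs, (rule sp_intros l | (simp; fail))+)
  show "ee l l l2 - dd l l \<noteq> 0"
    by (rule sp_nonzero) (unfold scalar_defs, (rule sp_intros l l2 | (simp; fail))+)
  show "cc + dd l l \<noteq> 0"
    by (rule sp_nonzero) (unfold scalar_defs, (rule sp_intros l l2 | (simp; fail))+)
qed

text \<open>
  In terms of \<open>y = x + 1/x\<close> the characteristic polynomial of the recurrence is
  \<open>cc * (y\<^sup>2 - 2) + dd * y + ee\<close>; for \<open>ee = 2 * cc\<close> it has the roots 0 and \<open>\<nu>\<close>.
  The conclusion says that \<open>P0 + P1 * y + P2 * (y\<^sup>2 - 2)\<close> does not vanish at \<open>\<nu>\<close>.
\<close>

lemma exclude_split: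
  assumes d: "dd l l = - \<nu> * cc" and e: "ee l l l2 = 2 * cc" and \<nu>: "\<nu> = 2 \<or> \<nu> = -1"
  shows "P0 l l2 + \<nu> * P1 l + P2 * (\<nu>^2 - 2) \<noteq> 0"
proof -
  have el: "\<alpha> * \<beta> * (\<alpha> - \<beta>) / 2 * l2 + (ee l l 0 - 2 * cc) = 0"
    using e unfolding linear_in_second(1)[of l l l2] by (simp add: add_diff_eq)
  have dl: "(dd 1 1 - dd 0 0) * l + (dd 0 0 + \<nu> * cc) = 0"
  proof -
    have "(dd 1 1 - dd 0 0) * l + dd 0 0 = dd l l"
      unfolding dd_def by (simp add: field_simps)
    then show ?thesis using d by (simp add: add.assoc[symmetric])
  qed
  from \<nu> show ?thesis
  proof
    assume n: "\<nu> = 2"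
    have l: "sp l (45/22)"
      by (rule sp_solve'[OF dl[unfolded n]]) (unfold scalar_defs, (rule sp_intros | (simp; fail))+)
    have l2: "sp l2 (19/363)"
      by (rule sp_solve'[OF el]) (unfold scalar_defs, (rule sp_intros l | (simp add: power2_eq_square; fail))+)
    show ?thesis unfolding n
      by (rule sp_nonzero) (unfold scalar_defs, (rule sp_intros l l2 | (simp add: power2_eq_square; fail))+)
  next
    assume n: "\<nu> = -1"
    have l: "sp l (15/11)"
      by (rule sp_solve'[OF dl[unfolded n]]) (unfold scalar_defs, (rule sp_intros | (simp; fail))+)
    have l2: "sp l2 (259/363)"
      by (rule sp_solve'[OF el]) (unfold scalar_defs, (rule sp_intros l | (simp add: power2_eq_square; fail))+)
    show ?thesis unfolding n
      by (rule sp_nonzero) (unfold scalar_defs, (rule sp_intros l l2 | (simp add: power2_eq_square; fail))+)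
  qed
qed

text \<open>
  Without the middle coefficient the recurrence relates axes of indices of the same parity
  only. The hypotheses are linear equations for \<open>l\<close> and then for \<open>l2\<close>.
\<close>

lemma exclude_pure:
  assumes d: "dd l l = 0"
  shows "P1 l \<noteq> 0"
    and "ee l l l2 = \<epsilon> * cc \<Longrightarrow> \<epsilon> = 1 \<or> \<epsilon> = -2 \<Longrightarrow>
      (\<alpha> - 2 * \<beta>) * (1 - 2 * \<beta>) * cc * \<epsilon> - (kk - ll) * (P0 l l2 - P2 * \<epsilon>) - (kk - ll) * P1 l * \<epsilon> \<noteq> 0"
proof -
  have "(dd 1 1 - dd 0 0) * l + dd 0 0 = dd l l"
    unfolding scalar_defs by (simp add: field_simps)
  then have "(dd 1 1 - dd 0 0) * l + dd 0 0 = 0" using d by simp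
  then have l: "sp l (35/22)"
    by (rule sp_solve') (unfold scalar_defs, (rule sp_intros | (simp; fail))+)
  show "P1 l \<noteq> 0"
    by (rule sp_nonzero) (unfold scalar_defs, (rule sp_intros l | (simp; fail))+)
  assume e: "ee l l l2 = \<epsilon> * cc" and \<epsilon>: "\<epsilon> = 1 \<or> \<epsilon> = -2"
  have el: "\<alpha> * \<beta> * (\<alpha> - \<beta>) / 2 * l2 + (ee l l 0 - \<epsilon> * cc) = 0"
    using e unfolding linear_in_second(1)[of l l l2] by (simp add: add_diff_eq)
  from \<epsilon> show "(\<alpha> - 2 * \<beta>) * (1 - 2 * \<beta>) * cc * \<epsilon> - (kk - ll) * (P0 l l2 - P2 * \<epsilon>) - (kk - ll) * P1 l * \<epsilon> \<noteq> 0"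
  proof
    assume n: "\<epsilon> = 1"
    have l2: "sp l2 (713/726)"
      by (rule sp_solve'[OF el[unfolded n]]) (unfold scalar_defs, (rule sp_intros l | (simp add: power2_eq_square; fail))+)
    show ?thesis unfolding n
      by (rule sp_nonzero) (unfold scalar_defs, (rule sp_intros l l2 | (simp add: power2_eq_square; fail))+)
  next
    assume n: "\<epsilon> = -2"
    have l2: "sp l2 (1264/363)"
      by (rule sp_solve'[OF el[unfolded n]]) (unfold scalar_defs, (rule sp_intros l | (simp add: power2_eq_square; fail))+)
    show ?thesis unfolding n
      by (rule sp_nonzero) (unfold scalar_defs, (rule sp_intros l l2 | (simp add: power2_eq_square; fail))+)
  qed
qed

section \<open>Symmetric pairs\<close>

text \<open>
  A linear relation between \<open>A 1 + A (-1)\<close> and \<open>A 0\<close> modulo the invariants, stated for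
  functionals, either determines the ratio or is trivial.
\<close>

lemma ratio_or_zero:
  assumes A: "dihedral A" and A0: "A 0 \<notin> inv_space A"
    and eq: "\<And>f. kills A f \<Longrightarrow> u * (f (A 1) + f (A (- 1))) + v * f (A 0) = 0"
  shows "(\<exists>N. A 1 + A (- 1) - N *s A 0 \<in> inv_space A) \<or> u = 0 \<and> v = 0"
proof (cases "u = 0")
  case False
  have "A 1 + A (- 1) - (- v / u) *s A 0 \<in> inv_space A"
    unfolding inv_space_iff[OF A]
  proof (intro allI impI)
    fix f assume f: "kills A f"
    have "u * f (A 1 + A (- 1) - (- v / u) *s A 0) = u * (f (A 1) + f (A (- 1))) + v * f (A 0)"
      using False by (simp add: kills_linear[OF f] algebra_simps)
    with eq[OF f] False show "f (A 1 + A (- 1) - (- v / u) *s A 0) = 0" by simp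
  qed
  then show ?thesis by blast
next
  case True
  obtain f where f: "kills A f" "f (A 0) \<noteq> 0" using inv_space_iff[OF A] A0 by blast
  from eq[OF f(1)] f(2) True show ?thesis by simp
qed

text \<open>
  The fourth relation of \<open>symmetric_relations\<close> involves \<open>A 1 + A (-1)\<close> and \<open>A 0\<close> only. It
  determines the ratio unless its coefficients vanish. This can happen for three reasons:
  \<open>dd l l = 0\<close>; or \<open>P0, P1, P2\<close> are proportional to the coefficients of the recurrence,
  so that multiplying by it yields nothing new; or the characteristic polynomial of the
  recurrence splits and has a root in common with the one formed from \<open>P0, P1, P2\<close>. In each
  of them the fifth relation, after elimination of the axes at distances 2, 3 and 4, is a
  second relation of the same kind, and its coefficients do not vanish.
\<close>

lemma symmetric_ratio:
  assumes A: "dihedral A" and sym: "lam1 A 0 = l" "lam1 A 1 = l" "lam2 A 0 = l2" "lam2 A 1 = l2"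
    and A0: "A 0 \<notin> inv_space A"
  shows "\<exists>N. A 1 + A (- 1) - N *s A 0 \<in> inv_space A"
proof -
  let ?d = "dd l l" and ?e = "ee l l l2"
  let ?J = "cc * P1 l - P2 * ?d" and ?K = "cc^2 * P0 l l2 - cc * ?d * P1 l + P2 * (?d^2 - cc * ?e)"
  let ?G = "\<alpha> - 2 * \<beta>"
  note rel = symmetric_relations[OF A _ sym]
  note ratio = ratio_or_zero[OF A A0]
  consider (pure) "?d = 0" | (proportional) "?d \<noteq> 0" "?J = 0" | (split) "?d \<noteq> 0" "?J \<noteq> 0" by blast
  then show ?thesis
  proof cases
    case pure
    define \<epsilon> where "\<epsilon> = ?e / cc"
    have e: "?e = \<epsilon> * cc" by (simp add: \<epsilon>_def)
    \<comment> \<open>The fifth relation reads \<open>S0 (E1 - E2) + S1 (E2 + 2 F - E3 - E1) = 0\<close> because the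
      recurrence gives \<open>E3 + E1 - E4 - 2 F = - \<epsilon> (E1 - E2)\<close>.\<close>
    define S0 where "S0 = ?G * (1 - 2 * \<beta>) * cc * \<epsilon> - (kk - ll) * (P0 l l2 - P2 * \<epsilon>)"
    define S1 where "S1 = - (kk - ll) * P1 l"
    have "(S0 + S1 * \<epsilon>) * (f (A 1) + f (A (- 1))) + (S0 * \<epsilon> + S1 * (2 - \<epsilon>)) * f (A 0) = 0"
      if f: "kills A f" for f
    proof -
      let ?E1 = "f (A 1) + f (A (-1))" and ?E2 = "f (A 2) + f (A (-2))" and ?E3 = "f (A 3) + f (A (-3))"
        and ?E4 = "f (A 4) + f (A (-4))" and ?F = "f (A 0)"
      have "cc * (?E2 + \<epsilon> * ?F) = 0" "cc * (?E3 + ?E1 + \<epsilon> * ?E1) = 0" "cc * (?E4 + 2 * ?F + \<epsilon> * ?E2) = 0"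
        using rel(1-3)[OF f] by (simp_all add: pure e algebra_simps)
      then have E: "?E2 + \<epsilon> * ?F = 0" "?E3 + ?E1 + \<epsilon> * ?E1 = 0" "?E4 + 2 * ?F + \<epsilon> * ?E2 = 0"
        by (simp_all only: mult_eq_0_iff nonzero_scalars simp_thms)
      define E1 E2 E3 E4 F where "E1 = ?E1" and "E2 = ?E2" and "E3 = ?E3" and "E4 = ?E4" and "F = ?F"
      note E = E[folded E1_def E2_def E3_def E4_def F_def]
      have e2: "E2 = - \<epsilon> * F" using E(1) by (simp add: eq_neg_iff_add_eq_0)
      have e3: "E3 = - \<epsilon> * E1 - E1" using E(2) by (simp add: eq_neg_iff_add_eq_0 eq_diff_eq add.commute add.left_commute)
      have e4: "E4 = - \<epsilon> * E2 - 2 * F" using E(3) by (simp add: eq_neg_iff_add_eq_0 eq_diff_eq add.commute add.left_commute)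
      note r5 = rel(5)[OF f, folded E1_def E2_def E3_def E4_def F_def, unfolded e4 e3 e2 pure e]
      show ?thesis unfolding E1_def[symmetric] F_def[symmetric]
        by (rule lincomb1[OF r5, where k = 1]) (simp add: S0_def S1_def algebra_simps)
    qed
    from ratio[OF this] show ?thesis
    proof
      assume z: "S0 + S1 * \<epsilon> = 0 \<and> S0 * \<epsilon> + S1 * (2 - \<epsilon>) = 0"
      then have "S0 = - S1 * \<epsilon>" by (simp add: eq_neg_iff_add_eq_0)
      with z have "S1 * ((1 - \<epsilon>) * (2 + \<epsilon>)) = 0" by (simp add: algebra_simps)
      moreover have "S1 \<noteq> 0" using exclude_pure(1)[OF pure] nonzero_scalars(4) by (simp add: S1_def)
      ultimately have "1 - \<epsilon> = 0 \<or> 2 + \<epsilon> = 0" by simp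
      then have "\<epsilon> = 1 \<or> \<epsilon> = -2" by (auto simp: add.commute eq_neg_iff_add_eq_0)
      from exclude_pure(2)[OF pure e this] have "S0 + S1 * \<epsilon> \<noteq> 0"
        by (simp add: S0_def S1_def algebra_simps)
      with z show ?thesis by simp
    qed
  next
    case proportional
    have "?K * (f (A 1) + f (A (- 1))) + ((2 * cc - ?e) * ?J) * f (A 0) = 0" if "kills A f" for f
      using rel(4)[OF that] proportional(1) by (simp add: mult.assoc)
    from ratio[OF this] show ?thesis
    proof
      assume z: "?K = 0 \<and> (2 * cc - ?e) * ?J = 0"
      have "?K = cc * (cc * P0 l l2 - P2 * ?e) - ?d * ?J" by (simp add: algebra_simps power2_eq_square)
      with z proportional(2) have K: "cc * P0 l l2 - P2 * ?e = 0" by simp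
      note ne = exclude_proportional[OF proportional(2) K]
      have "(cc + ?d) * (f (A 1) + f (A (- 1))) + ?e * f (A 0) = 0" if f: "kills A f" for f
      proof -
        define E1 E2 E3 E4 F where "E1 = f (A 1) + f (A (-1))" and "E2 = f (A 2) + f (A (-2))"
          and "E3 = f (A 3) + f (A (-3))" and "E4 = f (A 4) + f (A (-4))" and "F = f (A 0)"
        note r = rel[OF f, folded E1_def E2_def E3_def E4_def F_def]
        let ?br = "P0 l l2 * (E1 - E2) + P1 l * (E2 + 2 * F - E3 - E1) + P2 * (E3 + E1 - E4 - 2 * F)"
        have "cc * ?br = (cc * P0 l l2 - P2 * ?e) * (E1 - E2) + ?J * (E2 + 2 * F - E3 - E1)
          + P2 * ((cc * (E3 + E1) + ?d * (E2 + 2 * F) + ?e * E1) - (cc * (E4 + 2 * F) + ?d * (E3 + E1) + ?e * E2))"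
          by (simp add: algebra_simps)
        then have "?br = 0" unfolding r(2,3) K proportional(2) by simp
        with r(5) have "?G * (1 - 2 * \<beta>) * (?e - ?d) * (E1 - E2) = 0" by simp
        then have "E1 - E2 = 0"
          by (simp only: mult_eq_0_iff ne nonzero_scalars simp_thms)
        then have "E2 = E1" by simp
        with r(1) show ?thesis by (simp add: E1_def F_def algebra_simps)
      qed
      from ratio[OF this] ne(2) show ?thesis by simp
    qed
  next
    case split
    have "?K * (f (A 1) + f (A (- 1))) + ((2 * cc - ?e) * ?J) * f (A 0) = 0" if "kills A f" for f
      using rel(4)[OF that] split(1) by (simp add: mult.assoc)
    from ratio[OF this] show ?thesis
    proof
      assume z: "?K = 0 \<and> (2 * cc - ?e) * ?J = 0"
      then have e: "?e = 2 * cc" using split(2) by simp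
      define \<nu> where "\<nu> = - ?d / cc"
      have d: "?d = - \<nu> * cc" by (simp add: \<nu>_def)
      have "cc^2 * (P0 l l2 + \<nu> * P1 l + P2 * (\<nu>^2 - 2)) = ?K"
        unfolding d e by (simp add: algebra_simps power2_eq_square)
      then have K: "P0 l l2 + \<nu> * P1 l + P2 * (\<nu>^2 - 2) = 0" using z by simp
      then have p0: "P0 l l2 = - \<nu> * P1 l - P2 * (\<nu>^2 - 2)" by (simp add: algebra_simps eq_neg_iff_add_eq_0)
      define Q where "Q = P1 l + P2 * \<nu>"
      have "?J = cc * Q" unfolding d by (simp add: Q_def algebra_simps)
      then have Q: "Q \<noteq> 0" using split(2) by auto
      define X where "X = ?G * (1 - 2 * \<beta>) * cc * (2 + \<nu>)"
      define Y where "Y = 2 * (kk - ll) * Q"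
      have Y: "Y \<noteq> 0" using Q nonzero_scalars(4) by (simp add: Y_def)
      have "(X * (1 - \<nu>) - Y) * (f (A 1) + f (A (- 1))) + (2 * X + Y * \<nu>) * f (A 0) = 0"
        if f: "kills A f" for f
      proof -
        define E1 E2 E3 E4 F where "E1 = f (A 1) + f (A (-1))" and "E2 = f (A 2) + f (A (-2))"
          and "E3 = f (A 3) + f (A (-3))" and "E4 = f (A 4) + f (A (-4))" and "F = f (A 0)"
        note r = rel[OF f, folded E1_def E2_def E3_def E4_def F_def]
        have "cc * (E2 - (\<nu> * E1 - 2 * F)) = 0" "cc * (E3 - (\<nu> * (E2 + 2 * F) - 3 * E1)) = 0"
          "cc * (E4 - (\<nu> * (E3 + E1) - 2 * E2 - 2 * F)) = 0"
          using r(1-3) unfolding d e by (simp_all add: algebra_simps)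
        then have E: "E2 = \<nu> * E1 - 2 * F" "E3 = \<nu> * (E2 + 2 * F) - 3 * E1" "E4 = \<nu> * (E3 + E1) - 2 * E2 - 2 * F"
          by (simp_all only: mult_eq_0_iff nonzero_scalars simp_thms right_minus_eq)
        note r5 = r(5)[unfolded E(3) E(2) E(1) d e p0]
        show ?thesis unfolding E1_def[symmetric] F_def[symmetric]
          by (rule lincomb1[OF r5, where k = 1]) (simp add: X_def Y_def Q_def algebra_simps power2_eq_square)
      qed
      from ratio[OF this] show ?thesis
      proof
        assume z: "X * (1 - \<nu>) - Y = 0 \<and> 2 * X + Y * \<nu> = 0"
        then have y: "Y = X * (1 - \<nu>)" by simp
        with z have "X * ((2 - \<nu>) * (1 + \<nu>)) = 0" by (simp add: algebra_simps)
        moreover have "X \<noteq> 0" using y Y by auto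
        ultimately have "2 - \<nu> = 0 \<or> 1 + \<nu> = 0" by simp
        then have "\<nu> = 2 \<or> \<nu> = -1" by (auto simp: add.commute eq_neg_iff_add_eq_0)
        from exclude_split[OF d e this] K show ?thesis by simp
      qed
    qed
  qed
qed

section \<open>Sequences with four axes\<close>

text \<open>
  For a sequence of period 4 with \<open>A 0 + A 2\<close> and \<open>A 1 + A (-1)\<close> invariant and with
  \<open>ee = 2 * cc\<close> at \<open>A 0\<close> and at \<open>A 1\<close>, \<open>RR\<close> is the coefficient of \<open>A 0\<close>, modulo the
  invariants, in the relation \<open>two_squares\<close> multiplied by \<open>A 0\<close>, and \<open>PP\<close> is the coefficient
  of the \<open>\<alpha>\<close>-component of \<open>A 1\<close> in the \<open>\<alpha>\<close>-component of this relation, both up to the factor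
  \<open>\<alpha> - 2 * \<beta>\<close> and a sign. The arguments are \<open>l = lam1 A 0\<close>, \<open>m = lam1 A 1\<close> and
  \<open>l2 = lam2 A 0\<close>.
\<close>

definition RR :: "'f \<Rightarrow> 'f \<Rightarrow> 'f \<Rightarrow> 'f" where
  "RR l m l2 = (\<alpha> - 2 * \<beta>) * (2 * cc + 2 * \<beta> * dd l m - 4 * \<beta> * cc - dd m l)
    + (kk - ll) * ((\<alpha> - 2 * \<beta>) * (gg l2 - 2 * hh) - ww l m l2 + 4 * \<beta> * hh)
    + (\<alpha> - 2 * \<beta>) * (mm l m - mm m l) * gg l"

definition PP :: "'f \<Rightarrow> 'f \<Rightarrow> 'f" where
  "PP l m = 2 * (\<alpha> - 2 * \<beta>) * (2 * cc - dd l m) + (kk - ll) * xx l m - (\<alpha> - 2 * \<beta>) * (\<alpha> - \<beta>) * (mm l m - mm m l)"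

text \<open>
  The coefficients of \<open>ee\<close>, and below those of \<open>RR\<close>, as quadratic polynomials in \<open>l\<close> and \<open>m\<close>;
  \<open>r1\<close> to \<open>r4\<close> are obtained by interpolation.
\<close>

definition e1 :: 'f where "e1 = - 3 * \<alpha>^2 + 4 * \<alpha> * \<beta> + \<alpha> - 2 * \<beta>"
definition e2 :: 'f where "e2 = \<alpha> * (1 - \<alpha>)"
definition e3 :: 'f where "e3 = \<alpha>^3 + 4 * \<alpha>^2 * \<beta> - 6 * \<alpha> * \<beta>^2 - 3 * \<alpha> * \<beta> + 4 * \<beta>^2"
definition e4 :: 'f where "e4 = \<alpha> * \<beta> * (\<alpha> - 1)"

lemma ee_quadratic: "ee l m v = e1 * l^2 + e2 * l * m + e3 * l + e4 * m + ee 0 0 v"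
  by (simp add: ee_def e1_def e2_def e3_def e4_def)

definition r1 :: 'f where "r1 = (RR 2 0 0 - 2 * RR 1 0 0 + RR 0 0 0) / 2"
definition r3 :: 'f where "r3 = RR 1 0 0 - RR 0 0 0 - r1"
definition r4 :: 'f where "r4 = RR 0 1 0 - RR 0 0 0"
definition r2 :: 'f where "r2 = RR 1 1 0 - r1 - r3 - r4 - RR 0 0 0"

lemma dd_linear: "dd l m = (dd 1 0 - dd 0 0) * l + (dd 0 1 - dd 0 0) * m + dd 0 0"
  by (simp add: dd_def algebra_simps)

lemma mm_linear: "mm l m = 2 * \<alpha> * (\<alpha> - \<beta>) * l + \<alpha> * (\<alpha> - 1) * m + mm 0 0"
  by (simp add: mm_def)

lemma RR_quadratic: "RR l m v = r1 * l^2 + r2 * l * m + r3 * l + r4 * m + RR 0 0 v"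
proof -
  define t where "t = inverse (\<alpha> - \<beta>)"
  have lq: "lq l m v = 2 * ls l + 2 * t * (gg m * l - l * ls l) + \<beta> * (1 + v) - (1 + 2 * \<beta>) * l + 2 * l^2" for l m v
    by (simp add: lq_def t_def hh_def field_simps)
  have "2 * (RR l m v - RR 0 0 v) = (RR 2 0 0 - 2 * RR 1 0 0 + RR 0 0 0) * (l^2 - l)
      + 2 * (RR 1 1 0 - RR 1 0 0 - RR 0 1 0 + RR 0 0 0) * l * m
      + 2 * (RR 1 0 0 - RR 0 0 0) * l + 2 * (RR 0 1 0 - RR 0 0 0) * m"
    unfolding RR_def ww_def lq xx_def gg_def ls_def
      dd_linear[of l m] dd_linear[of m l] dd_linear[of 2 0] dd_linear[of 0 2] dd_linear[of 1 1]
      mm_linear[of l m] mm_linear[of m l] mm_linear[of 1 0] mm_linear[of 0 1] mm_linear[of 2 0]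
      mm_linear[of 0 2] mm_linear[of 1 1]
    by (simp add: algebra_simps power2_eq_square)
  also have "\<dots> = 2 * (r1 * l^2 + r2 * l * m + r3 * l + r4 * m)"
    unfolding r2_def r3_def r4_def r1_def by (simp add: field_simps)
  finally have "RR l m v - RR 0 0 v = r1 * l^2 + r2 * l * m + r3 * l + r4 * m"
    by (simp only: mult_cancel_left zero_neq_numeral[symmetric] simp_thms)
  then show ?thesis by (simp add: algebra_simps)
qed

lemma PP_linear: "PP l m = (PP 1 0 - PP 0 0) * l + (PP 0 1 - PP 0 0) * m + PP 0 0"
  unfolding PP_def xx_def gg_def ls_def
    dd_linear[of l m] mm_linear[of l m] mm_linear[of m l] mm_linear[of 1 0] mm_linear[of 0 1]
  by (simp add: algebra_simps)

lemmas four_defs = e1_def e2_def e3_def e4_def r2_def r3_def r4_def r1_def PP_def RR_def scalar_defs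

lemma sp_coeffs:
  "sp e1 (-4)"
  "sp e2 (-6)"
  "sp e3 25"
  "sp e4 12"
  "sp r1 16"
  "sp r2 24"
  "sp r3 (-127)"
  "sp r4 (-46)"
  "sp (RR 0 0 0) (339/2)"
  "sp (RR 0 0 (\<alpha>/2)) (291/2)"
  "sp (ee 0 0 0 - 2 * cc) (-34)"
  "sp (ee 0 0 (\<alpha>/2) - 2 * cc) (-59/2)"
proof -
  show "sp e1 (-4)"
    by (rule sp_eq) (unfold four_defs, (rule sp_intros | (simp; fail))+)
  show "sp e2 (-6)"
    by (rule sp_eq) (unfold four_defs, (rule sp_intros | (simp; fail))+)
  show "sp e3 25"
    by (rule sp_eq) (unfold four_defs, (rule sp_intros | (simp; fail))+)
  show "sp e4 12"
    by (rule sp_eq) (unfold four_defs, (rule sp_intros | (simp; fail))+)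
  show "sp r1 16"
    by (rule sp_eq) (unfold four_defs, (rule sp_intros | (simp; fail))+)
  show "sp r2 24"
    by (rule sp_eq) (unfold four_defs, (rule sp_intros | (simp; fail))+)
  show "sp r3 (-127)"
    by (rule sp_eq) (unfold four_defs, (rule sp_intros | (simp; fail))+)
  show "sp r4 (-46)"
    by (rule sp_eq) (unfold four_defs, (rule sp_intros | (simp; fail))+)
  show "sp (RR 0 0 0) (339/2)"
    by (rule sp_eq) (unfold four_defs, (rule sp_intros | (simp; fail))+)
  show "sp (RR 0 0 (\<alpha>/2)) (291/2)"
    by (rule sp_eq) (unfold four_defs, (rule sp_intros | (simp; fail))+)
  show "sp (ee 0 0 0 - 2 * cc) (-34)"
    by (rule sp_eq) (unfold four_defs, (rule sp_intros | (simp; fail))+)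
  show "sp (ee 0 0 (\<alpha>/2) - 2 * cc) (-59/2)"
    by (rule sp_eq) (unfold four_defs, (rule sp_intros | (simp; fail))+)
qed

text \<open>
  Subtracting the equations from their mirror images and dividing by \<open>l - m\<close> gives two
  values for \<open>l + m\<close> that differ at the point \<open>(3, 2)\<close>, so \<open>l = m\<close>. Two quadratic
  equations for \<open>l\<close> remain; their combination without quadratic term determines \<open>l\<close>, and the
  value does not satisfy them.
\<close>

lemma four_axes_scalars_equal:
  assumes a: "ee l m v = 2 * cc" "ee m l v = 2 * cc" and c: "RR l m v = 0" "RR m l v = 0"
    and v: "v = 0 \<or> v = \<alpha> / 2"
  shows False
proof -
  note [simp] = power2_eq_square
  have "l = m"
  proof (rule ccontr)
    assume ne: "l \<noteq> m"
    have "(l - m) * (e1 * (l + m) + (e3 - e4)) = 0"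
      by (rule lincomb2[OF a[unfolded ee_quadratic[of l] ee_quadratic[of m]], where k = 1 and k' = "-1"])
        (simp add: algebra_simps)
    then have "e1 * (l + m) + (e3 - e4) = 0" using ne by simp
    then have "sp (l + m) (13/4)"
      by (rule sp_solve') (rule sp_intros sp_coeffs | (simp; fail))+
    moreover have "(l - m) * (r1 * (l + m) + (r3 - r4)) = 0"
      by (rule lincomb2[OF c[unfolded RR_quadratic[of l] RR_quadratic[of m]], where k = 1 and k' = "-1"])
        (simp add: algebra_simps)
    then have "r1 * (l + m) + (r3 - r4) = 0" using ne by simp
    then have "sp (l + m) (81/16)"
      by (rule sp_solve') (rule sp_intros sp_coeffs | (simp; fail))+
    ultimately show False using sp_unique by fastforce
  qed
  have n: "(e1 + e2) * l^2 + (e3 + e4) * l + (ee 0 0 v - 2 * cc) = 0"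
    using a unfolding \<open>l = m\<close>[symmetric] ee_quadratic[of l] by (simp add: algebra_simps)
  have r: "(r1 + r2) * l^2 + (r3 + r4) * l + RR 0 0 v = 0"
    using c unfolding \<open>l = m\<close>[symmetric] RR_quadratic[of l] by (simp add: algebra_simps)
  have lin: "((e1 + e2) * (r3 + r4) - (r1 + r2) * (e3 + e4)) * l + ((e1 + e2) * RR 0 0 v - (r1 + r2) * (ee 0 0 v - 2 * cc)) = 0"
    by (rule lincomb2[OF n r, where k = "- (r1 + r2)" and k' = "e1 + e2"]) (simp add: algebra_simps)
  from v show False
  proof
    assume v: "v = 0"
    have l: "sp l (67/50)"
      by (rule sp_solve'[OF lin[unfolded v]]) (rule sp_intros sp_coeffs | (simp; fail))+
    have "(e1 + e2) * l^2 + (e3 + e4) * l + (ee 0 0 v - 2 * cc) \<noteq> 0" unfolding v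
      by (rule sp_nonzero) (rule sp_add[OF _ sp_coeffs(11)] sp_intros l sp_coeffs | (simp; fail))+
    with n show False by simp
  next
    assume v: "v = \<alpha> / 2"
    have l: "sp l (11/10)"
      by (rule sp_solve'[OF lin[unfolded v]]) (rule sp_intros sp_coeffs | (simp; fail))+
    have "(e1 + e2) * l^2 + (e3 + e4) * l + (ee 0 0 v - 2 * cc) \<noteq> 0" unfolding v
      by (rule sp_nonzero) (rule sp_add[OF _ sp_coeffs(12)] sp_intros l sp_coeffs | (simp; fail))+
    with n show False by simp
  qed
qed

text \<open>
  If \<open>l = \<beta>\<close>, then \<open>RR\<close> determines \<open>m\<close>. Otherwise \<open>PP\<close> expresses \<open>l\<close> linearly by \<open>m\<close>, which
  leaves two quadratic equations for \<open>m\<close>. In both cases one equation is violated at the point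
  \<open>(3, 2)\<close>.
\<close>

lemma four_axes_scalars_mixed:
  assumes a: "ee l m 0 = 2 * cc" "ee m l (\<alpha> / 2) = 2 * cc" and c: "RR l m 0 = 0"
    and d: "(\<beta> - l) * PP l m = 0"
  shows False
proof -
  note [simp] = power2_eq_square
  have a1: "e1 * l^2 + e2 * l * m + e3 * l + e4 * m + (ee 0 0 0 - 2 * cc) = 0"
    using a(1) unfolding ee_quadratic[of l] by (simp add: algebra_simps)
  have a2: "e1 * m^2 + e2 * m * l + e3 * m + e4 * l + (ee 0 0 (\<alpha> / 2) - 2 * cc) = 0"
    using a(2) unfolding ee_quadratic[of m] by (simp add: algebra_simps)
  from d have "l = \<beta> \<or> PP l m = 0" by auto
  then show False
  proof
    assume l: "l = \<beta>"
    have "(r2 * \<beta> + r4) * m + (r1 * \<beta>^2 + r3 * \<beta> + RR 0 0 0) = 0"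
      using c unfolding l RR_quadratic[of \<beta>] by (simp add: algebra_simps)
    then have m: "sp m (41/4)"
      by (rule sp_solve') (rule sp_intros sp_coeffs | (simp; fail))+
    have "e1 * m^2 + e2 * m * \<beta> + e3 * m + e4 * \<beta> + (ee 0 0 (\<alpha> / 2) - 2 * cc) \<noteq> 0"
      by (rule sp_nonzero) (rule sp_add[OF _ sp_coeffs(12)] sp_intros m sp_coeffs | (simp; fail))+
    with a2 l show False by simp
  next
    assume z: "PP l m = 0"
    define q1 where "q1 = - (PP 0 1 - PP 0 0) / (PP 1 0 - PP 0 0)"
    define q0 where "q0 = - PP 0 0 / (PP 1 0 - PP 0 0)"
    have nz: "PP 1 0 - PP 0 0 \<noteq> 0"
      by (rule sp_nonzero) (unfold four_defs, (rule sp_intros | (simp; fail))+)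
    have q: "sp q1 (-13/18)" unfolding q1_def
      by (rule sp_eq) (unfold four_defs, (rule sp_intros | (simp; fail))+)
    have q0: "sp q0 (91/36)" unfolding q0_def
      by (rule sp_eq) (unfold four_defs, (rule sp_intros | (simp; fail))+)
    note q = q q0
    have "x = - p' / p * y + - p'' / p" if "p * x + p' * y + p'' = 0" "p \<noteq> 0" for p p' p'' x y :: 'f
      using that by (simp add: field_simps eq_neg_iff_add_eq_0)
    from this[OF z[unfolded PP_linear[of l m]] nz] have l: "l = q1 * m + q0"
      by (simp only: q1_def q0_def)
    have b1: "(e1 * q1^2 + e2 * q1) * m^2 + (2 * e1 * q1 * q0 + e2 * q0 + e3 * q1 + e4) * m + (e1 * q0^2 + e3 * q0 + (ee 0 0 0 - 2 * cc)) = 0"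
      using a1 unfolding l by (simp add: algebra_simps)
    have b2: "(e1 + e2 * q1) * m^2 + (e2 * q0 + e3 + e4 * q1) * m + (e4 * q0 + (ee 0 0 (\<alpha> / 2) - 2 * cc)) = 0"
      using a2 unfolding l by (simp add: algebra_simps)
    let ?u2 = "e1 * q1^2 + e2 * q1" and ?u1 = "2 * e1 * q1 * q0 + e2 * q0 + e3 * q1 + e4" and ?u0 = "e1 * q0^2 + e3 * q0 + (ee 0 0 0 - 2 * cc)"
    let ?v2 = "e1 + e2 * q1" and ?v1 = "e2 * q0 + e3 + e4 * q1" and ?v0 = "e4 * q0 + (ee 0 0 (\<alpha> / 2) - 2 * cc)"
    have "(?u2 * ?v1 - ?v2 * ?u1) * m + (?u2 * ?v0 - ?v2 * ?u0) = 0"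
    proof -
      have "(u2 * v1 - v2 * u1) * m + (u2 * v0 - v2 * u0) = u2 * (v2 * m^2 + v1 * m + v0) - v2 * (u2 * m^2 + u1 * m + u0)"
        for u2 u1 u0 v2 v1 v0 by (simp add: algebra_simps)
      from this[of ?u2 ?v1 ?v2 ?u1 ?v0 ?u0] show ?thesis unfolding b1 b2 by simp
    qed
    then have m: "sp m (-107/782)"
      by (rule sp_solve') (rule sp_add[OF _ sp_coeffs(12)] sp_add[OF _ sp_coeffs(11)] sp_intros q sp_coeffs | (simp; fail))+
    have "?u2 * m^2 + ?u1 * m + ?u0 \<noteq> 0"
      by (rule sp_nonzero) (rule sp_add[OF _ sp_coeffs(11)] sp_intros m q sp_coeffs | (simp; fail))+
    with b1 show False by simp
  qed
qed

lemma four_axes_values: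
  assumes A: "dihedral A" and E: "A 1 + A (- 1) \<in> inv_space A" and F: "A 0 + A 2 \<in> inv_space A"
  shows "A 3 = A (- 1)" "A (- 2) = A 2" "A 4 = A 0" "A (- 4) = A 0" "A 6 = A 2"
proof -
  note t = dihedral_tau[OF A] and lin = tau_linear[OF dihedral_axis[OF A]]
  have "tau (A 1) (A 1 + A (- 1)) = A 1 + A (- 1)" using E by (simp add: inv_space_def)
  then show "A 3 = A (- 1)" by (simp add: lin t)
  have "tau (A 0) (A 0 + A 2) = A 0 + A 2" using F by (simp add: inv_space_def)
  then show 2: "A (- 2) = A 2" by (simp add: lin t)
  show 4: "A 4 = A 0" using arg_cong[where f = "tau (A 1)", OF 2] by (simp add: t)
  show "A (- 4) = A 0" using arg_cong[where f = "tau (A 0)", OF 4] by (simp add: t)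
  show "A 6 = A 2" using arg_cong[where f = "tau (A 2)", OF 2] by (simp add: t)
qed

text \<open>
  The axes \<open>A 0\<close> and \<open>A 2\<close> are exchanged by the involution of \<open>A 1\<close> and form a sequence of
  period 2, whose values of \<open>sg\<close> at distance 2 are multiples of the axes themselves. For it
  the relation \<open>two_squares\<close> is a multiple of \<open>A 0 - A 2\<close>, which leaves only two values
  for the projection of \<open>A 2\<close> on \<open>A 0\<close>.
\<close>

lemma four_axes_half:
  assumes A: "dihedral A" and E: "A 1 + A (- 1) \<in> inv_space A" and F: "A 0 + A 2 \<in> inv_space A"
    and A0: "A 0 \<notin> inv_space A"
  shows "ee (lam1 A 0) (lam1 A 1) (lam2 A 0) = 2 * cc" "lam2 A 0 = 0 \<or> lam2 A 0 = \<alpha> / 2"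
proof -
  note val = four_axes_values[OF A E F]
  obtain f where f: "kills A f" "f (A 0) \<noteq> 0" using inv_space_iff[OF A] A0 by blast
  note lf = kills_linear[OF f(1)]
  have fE: "f (A 1) + f (A (- 1)) = 0" and fF: "f (A 2) = - f (A 0)"
    using kills_zero[OF f(1) E] kills_zero[OF f(1) F] by (simp_all add: lf eq_neg_iff_add_eq_0 add.commute)
  have "cc * (f (A 2) + f (A (- 2))) + dd (lam1 A 0) (lam1 A 1) * (f (A 1) + f (A (- 1)))
      + ee (lam1 A 0) (lam1 A 1) (lam2 A 0) * f (A 0) = 0"
    using kills_mult(6)[OF A f(1), of 0] by simp
  then have "(ee (lam1 A 0) (lam1 A 1) (lam2 A 0) - 2 * cc) * f (A 0) = 0"
    unfolding fE val fF by (simp add: algebra_simps)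
  then show "ee (lam1 A 0) (lam1 A 1) (lam2 A 0) = 2 * cc" using f(2) by simp
  let ?l = "lam2 A 0"
  \<comment> \<open>the two axes of even index as a dihedral sequence of their own\<close>
  define C where "C n = A (2 * n)" for n
  have C: "dihedral C" using dihedral_affine[OF A, of 0 2] by (simp add: C_def[abs_def])
  have l: "lam1 C 0 = ?l" "lam1 C 1 = ?l" "lam2 C 0 = 1" "lam2 C 1 = 1"
    using lam2_period[OF A, of 0] axis_self(1)[OF dihedral_axis[OF A]]
    by (simp_all add: lam1_def lam2_def C_def val)
  have s: "sg2 C 0 = (1 - 2 * \<beta>) *s A 0" "sg2 C 1 = (1 - 2 * \<beta>) *s A 2"
    unfolding sg2_def C_def sg_def
    by (rule eq_by_functionals, simp add: val axis_idem[OF dihedral_axis[OF A]] linear_form_simps algebra_simps)+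
  have z: "zc C 0 = cc *s (A 0 + A 0) + dd ?l ?l *s (A 2 + A 2) + ee ?l ?l 1 *s A 0"
    "zc C 1 = cc *s (A 2 + A 2) + dd ?l ?l *s (A 0 + A 0) + ee ?l ?l 1 *s A 2"
    using lam1_period[OF C, of 0] by (simp_all add: zc_def l) (simp_all add: C_def val)
  have R: "zc C 0 + (kk - ll) *s (sg2 C 0 - sg2 C 1) = zc C 1"
    using two_squares[OF C, of 0] by (simp add: l)
  \<comment> \<open>the factor by which \<open>A 0 - A 2\<close> is multiplied in R\<close>
  define \<kappa> where "\<kappa> = 2 * cc - 2 * dd ?l ?l + ee ?l ?l 1 + (kk - ll) * (1 - 2 * \<beta>)"
  have "\<kappa> *s (A 0 - A 2) = (zc C 0 + (kk - ll) *s (sg2 C 0 - sg2 C 1)) - zc C 1"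
    unfolding z s \<kappa>_def by (rule eq_by_functionals) (simp add: linear_form_simps algebra_simps)
  then have "\<kappa> *s (A 0 - A 2) = 0" unfolding R by simp
  moreover have "A 0 - A 2 \<noteq> 0"
  proof
    assume "A 0 - A 2 = 0"
    then have "2 * f (A 0) = 0" using fF by simp
    with f(2) show False by simp
  qed
  ultimately have "\<kappa> = 0" by simp
  moreover have "\<kappa> = - (\<alpha> - \<beta>) * (2 * \<alpha> - 1) * (?l * (2 * ?l - \<alpha>))"
    unfolding \<kappa>_def cc_def dd_def ee_def kk_def ll_def by (simp add: field_simps power2_eq_square power3_eq_cube power4_eq_xxxx)
  moreover have "2 * \<alpha> - 1 \<noteq> 0" by (rule sp_nonzero, (rule sp_intros | (simp; fail))+)
  moreover have "\<alpha> - \<beta> \<noteq> 0" by simp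
  ultimately have "?l * (2 * ?l - \<alpha>) = 0" by (simp only: mult_eq_0_iff neg_equal_0_iff_equal simp_thms)
  then show "?l = 0 \<or> ?l = \<alpha> / 2" by (auto simp: field_simps)
qed

text \<open>
  For \<open>lam2 A 0 = 0\<close> the \<open>\<alpha>\<close>-component of \<open>A 2\<close> is invariant and that of \<open>A 1\<close> is, up to
  the factor \<open>\<alpha>\<close>, congruent to \<open>\<beta> - lam1 A 0\<close> times \<open>A 0\<close>. So the \<open>\<alpha>\<close>-component of the
  relation \<open>two_squares\<close> gives an equation in addition to the one from the product with
  \<open>A 0\<close>.
\<close>

lemma four_axes_center:
  assumes A: "dihedral A" and E: "A 1 + A (- 1) \<in> inv_space A" and F: "A 0 + A 2 \<in> inv_space A"
    and A0: "A 0 \<notin> inv_space A"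
    and e: "ee (lam1 A 0) (lam1 A 1) (lam2 A 0) = 2 * cc" "ee (lam1 A 1) (lam1 A 0) (lam2 A 1) = 2 * cc"
  shows "RR (lam1 A 0) (lam1 A 1) (lam2 A 0) = 0"
    "lam2 A 0 = 0 \<Longrightarrow> (\<beta> - lam1 A 0) * PP (lam1 A 0) (lam1 A 1) = 0"
proof -
  define l m l2 where "l = lam1 A 0" and "m = lam1 A 1" and "l2 = lam2 A 0"
  let ?G = "\<alpha> - 2 * \<beta>"
  note val = four_axes_values[OF A E F]
  obtain f where f: "kills A f" "f (A 0) \<noteq> 0" using inv_space_iff[OF A] A0 by blast
  note lf = kills_linear[OF f(1)]
  have fE: "f (A (- 1)) = - f (A 1)" and fF: "f (A 2) = - f (A 0)"
    using kills_zero[OF f(1) E] kills_zero[OF f(1) F] by (simp_all add: lf eq_neg_iff_add_eq_0 add.commute)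
  have lam12: "lam1 A 2 = l" using lam1_period[OF A, of 0] by (simp add: l_def)
  have z0: "zc A 0 = cc *s (A 2 + A 2) + dd l m *s (A 1 + A (- 1)) + (2 * cc) *s A 0"
    using e(1) by (simp add: zc_def val l_def m_def)
  have z1: "zc A 1 = cc *s (A (- 1) + A (- 1)) + dd m l *s (A 2 + A 0) + (2 * cc) *s A 1"
    using e(2) lam12 by (simp add: zc_def val l_def m_def)
  have R: "zc A 0 + (kk - ll) *s (sg2 A 0 - sg2 A 1) + (mm l m - mm m l) *s sg1 A = zc A 1"
    using two_squares[OF A, of 0] by (simp add: l_def m_def)
  have p: "f (A 0 \<odot> A 1) = \<beta> * (f (A 0) + f (A 1))" "f (A 0 \<odot> A (- 1)) = \<beta> * (f (A 0) + f (A (- 1)))"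
    "f (A 0 \<odot> A 2) = \<beta> * (f (A 0) + f (A 2))" "f (A 0 \<odot> A 0) = f (A 0)"
    using kills_mult(4)[OF A f(1), of 0] kills_mult(4)[OF A f(1), of "-1"] kills_mult(5)[OF A f(1), of 0]
    by (simp_all add: axis_idem[OF dihedral_axis[OF A]] mult_commute add.commute)
  have q: "f (A 0 \<odot> sg1 A) = gg l * f (A 0)" "f (A 0 \<odot> sg2 A 0) = (gg l2 - 2 * hh) * f (A 0)"
    "?G * f (A 0 \<odot> sg2 A 1) = (ww l m l2 - 4 * \<beta> * hh) * f (A 0)"
    using kills_mult(1-3)[OF A f(1), of 0]
    by (simp_all add: val fE fF l_def m_def l2_def algebra_simps)
  have 1: "f (A 0 \<odot> zc A 0) + (kk - ll) * (f (A 0 \<odot> sg2 A 0) - f (A 0 \<odot> sg2 A 1)) + (mm l m - mm m l) * f (A 0 \<odot> sg1 A)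
      = f (A 0 \<odot> zc A 1)"
    using arg_cong[where f = "\<lambda>x. f (A 0 \<odot> x)", OF R] by (simp add: bilinear lf)
  have 2: "f (A 0 \<odot> zc A 0) = (2 * cc + 2 * \<beta> * dd l m) * f (A 0)" "f (A 0 \<odot> zc A 1) = (4 * \<beta> * cc + dd m l) * f (A 0)"
    unfolding z0 z1 by (simp_all add: bilinear lf p fE fF algebra_simps)
  have "RR l m l2 * f (A 0) = 0"
    by (rule lincomb2[OF 1[unfolded 2 q(1,2)] q(3), where k = ?G and k' = "kk - ll"]) (simp add: RR_def algebra_simps)
  then show "RR (lam1 A 0) (lam1 A 1) (lam2 A 0) = 0" using f(2) by (simp add: l_def m_def l2_def)
  assume l2: "lam2 A 0 = 0"
  let ?a = "A 0"
  note ax = dihedral_axis[OF A, of 0]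
  let ?v = "pa ?a (A 1)" and ?v2 = "pa ?a (A 2)"
  have neg: "pa ?a (A (- 1)) = ?v"
  proof -
    have "A (- 1) = A 1 - 2 *s pb ?a (A 1)" using dihedral_tau[OF A, of 0 1] tau_eq[OF ax, of "A 1"] by simp
    then show ?thesis using ax by (simp add: axis_linear[OF ax])
  qed
  have pq: "?G *s pa ?a (sg2 A 1) = xx l m *s ?v + (4 * hh) *s ?v2"
  proof -
    have "sg2 A 1 = sg (A 1) (A (- 1))" using sg2_pred[OF A, of 0] by (simp add: sg2_def sg_commute)
    then show ?thesis
      using alpha_part_q[OF A] lam1_back[OF A, of 1] by (simp add: l_def m_def lam1_def)
  qed
  have ps: "pa ?a (sg2 A 0) = (\<alpha> - \<beta>) *s ?v2" "pa ?a (sg1 A) = (\<alpha> - \<beta>) *s ?v"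
    by (simp_all add: sg2_def sg1_def proj_sg[OF ax])
  have pz: "pa ?a (zc A 0) = (2 * cc) *s ?v2 + (2 * dd l m) *s ?v" "pa ?a (zc A 1) = (4 * cc) *s ?v + dd m l *s ?v2"
    unfolding z0 z1 by (rule eq_by_functionals, simp add: axis_linear[OF ax] axis_self[OF ax] neg linear_form_simps algebra_simps)+
  have fv: "\<alpha> * f ?v = (\<beta> - l) * f ?a" "\<alpha> * f ?v2 = 0"
    using arg_cong[where f = f, OF scaled_alpha_part[OF ax, of "A 1"]] arg_cong[where f = f, OF scaled_alpha_part[OF ax, of "A 2"]]
      kills_zero[OF f(1) inv_sg1[OF A]] kills_zero[OF f(1) inv_sg2[OF A, of 0]] l2
    by (simp_all add: lf dihedral_tau[OF A] val fE fF sg1_def sg2_def lam1_def lam2_def l_def)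
  have fv2: "f ?v2 = 0" using fv(2) by simp
  have 3: "f (pa ?a (zc A 0)) + (kk - ll) * (f (pa ?a (sg2 A 0)) - f (pa ?a (sg2 A 1))) + (mm l m - mm m l) * f (pa ?a (sg1 A))
      = f (pa ?a (zc A 1))"
    using arg_cong[where f = "\<lambda>x. f (pa ?a x)", OF R] by (simp add: axis_linear[OF ax] lf)
  have 4: "?G * f (pa ?a (sg2 A 1)) = xx l m * f ?v + 4 * hh * f ?v2"
    using arg_cong[where f = f, OF pq] by (simp add: lf)
  have "PP l m * f ?v = 0"
    by (rule lincomb3[OF 3[unfolded pz ps lf] 4 fv2, where k = "- ?G" and k' = "- (kk - ll)"
          and k'' = "?G * (2 * cc - dd m l) + (kk - ll) * (?G * (\<alpha> - \<beta>) - 4 * hh)"])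
      (simp add: PP_def algebra_simps)
  then have "PP l m * (\<alpha> * f ?v) = 0" by simp
  then have "PP l m * ((\<beta> - l) * f ?a) = 0" unfolding fv .
  then show "(\<beta> - lam1 A 0) * PP (lam1 A 0) (lam1 A 1) = 0" using f(2) by (auto simp: l_def m_def)
qed

text \<open>
  The two halves \<open>A 0, A 2\<close> and \<open>A 1, A (-1)\<close> play the same role, so all conditions hold
  together with their mirror images. The two possible values at distance 2 from
  \<open>four_axes_half\<close> are equal for both halves or different; each case overdetermines the
  projections at distance 1.
\<close>

lemma no_four_axes:
  assumes A: "dihedral A" and E: "A 1 + A (- 1) \<in> inv_space A" and F: "A 0 + A 2 \<in> inv_space A"
    and A0: "A 0 \<notin> inv_space A" and A1: "A 1 \<notin> inv_space A"
  shows False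
proof -
  let ?B = "\<lambda>n. A (1 - n)"
  have B: "dihedral ?B" by (rule dihedral_flip[OF A])
  have Bl: "lam1 ?B 0 = lam1 A 1" "lam1 ?B 1 = lam1 A 0" "lam2 ?B 0 = lam2 A 1" "lam2 ?B 1 = lam2 A 0"
    by (simp_all add: lam_flip[OF A])
  have BE: "?B 1 + ?B (- 1) \<in> inv_space ?B" "?B 0 + ?B 2 \<in> inv_space ?B" "?B 0 \<notin> inv_space ?B"
    using E F A1 unfolding inv_space_flip by simp_all
  note a = four_axes_half[OF A E F A0] and b = four_axes_half[OF B BE, unfolded Bl]
  note c = four_axes_center[OF A E F A0 a(1) b(1)]
  have d: "RR (lam1 A 1) (lam1 A 0) (lam2 A 1) = 0"
    "lam2 A 1 = 0 \<Longrightarrow> (\<beta> - lam1 A 1) * PP (lam1 A 1) (lam1 A 0) = 0"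
    using four_axes_center[OF B BE, unfolded Bl, OF b(1) a(1)] .
  show False
  proof (cases "lam2 A 0 = lam2 A 1")
    case True
    then show False
      using four_axes_scalars_equal[of "lam1 A 0" "lam1 A 1" "lam2 A 0"] a b c(1) d(1) by simp
  next
    case False
    then consider "lam2 A 0 = 0" "lam2 A 1 = \<alpha> / 2" | "lam2 A 1 = 0" "lam2 A 0 = \<alpha> / 2"
      using a(2) b(2) by metis
    then show False
      by cases (use four_axes_scalars_mixed a(1) b(1) c d in metis)+
  qed
qed

section \<open>Sequences with three axes\<close>

text \<open>
  The lemma of Seress: multiplication by a vector of the 0-eigenspace preserves the 0-, \<open>\<alpha>\<close>-
  and \<open>\<beta>\<close>-eigenspaces and annihilates the axis, so it commutes with the axis.
\<close>

lemma seress: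
  assumes a: "primitive_axis a" and x: "x \<odot> a = 0"
  shows "a \<odot> (x \<odot> y) = x \<odot> (a \<odot> y)"
proof -
  note e = axis_eigen[OF a, of y]
  have xa: "a \<odot> x = 0" using x by (simp add: mult_commute)
  have z: "a \<odot> (x \<odot> pz a y) = 0" "a \<odot> (x \<odot> pa a y) = \<alpha> *s (x \<odot> pa a y)" "a \<odot> (x \<odot> pb a y) = \<beta> *s (x \<odot> pb a y)"
    using fusion_zero_zero[OF a x e(1)] fusion_zero_alpha[OF a x e(2)] fusion_zero_beta[OF a x e(3)]
    by (simp_all add: mult_commute)
  have "x \<odot> y = x \<odot> (lam a y *s a + pz a y + pa a y + pb a y)" using axis_decomp[OF a, of y] by simp
  then have "x \<odot> y = x \<odot> pz a y + x \<odot> pa a y + x \<odot> pb a y" by (simp add: bilinear x)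
  then have "a \<odot> (x \<odot> y) = \<alpha> *s (x \<odot> pa a y) + \<beta> *s (x \<odot> pb a y)" by (simp add: bilinear z)
  moreover have "x \<odot> (a \<odot> y) = \<alpha> *s (x \<odot> pa a y) + \<beta> *s (x \<odot> pb a y)"
    by (simp add: axis_mult[OF a, of y] bilinear x)
  ultimately show ?thesis by simp
qed

text \<open>
  Here \<open>\<alpha> w - r\<close> lies in the 0-eigenspace of \<open>a\<close>, so it may be moved past \<open>a\<close> in the
  product with \<open>b\<close>. One side is a multiple of \<open>r\<close>, the other one contains the product of \<open>r\<close>
  with \<open>sg a b\<close>.
\<close>

lemma common_eigenvector_step:
  assumes a: "primitive_axis a" and r: "a \<odot> w = r" "a \<odot> r = \<alpha> *s r"
    and r': "b \<odot> w = r'" "b \<odot> r' = \<alpha> *s r'" and sum: "r + r' = \<eta> *s w" and s: "sg a b \<odot> w = \<gamma> *s w"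
  shows "sg a b \<odot> r = (\<alpha> * \<gamma>) *s w + (\<beta> * (2 * \<alpha> - \<eta>)) *s r' - ((2 * \<alpha> - \<eta>) * (\<eta> - \<alpha>)) *s r"
proof -
  let ?x = "\<alpha> *s w - r"
  have ax: "a \<odot> ?x = 0" by (simp add: bilinear r)
  then have xa: "?x \<odot> a = 0" by (simp add: mult_commute)
  have e: "r = \<eta> *s w - r'" "r' = \<eta> *s w - r" using sum by (simp_all add: algebra_simps)
  have br: "b \<odot> r = (\<eta> - \<alpha>) *s r'"
    by (subst e(1)) (simp add: bilinear r' scale_left_diff_distrib)
  have ar': "a \<odot> r' = (\<eta> - \<alpha>) *s r"
    by (subst e(2)) (simp add: bilinear r scale_left_diff_distrib)
  have xb: "?x \<odot> b = (2 * \<alpha> - \<eta>) *s r'"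
  proof -
    have "?x \<odot> b = \<alpha> *s r' - (\<eta> - \<alpha>) *s r'" by (simp add: bilinear mult_commute[of w b] mult_commute[of r b] r' br)
    also have "\<dots> = (2 * \<alpha> - \<eta>) *s r'" by (rule eq_by_functionals) (simp add: linear_form_simps algebra_simps)
    finally show ?thesis .
  qed
  have 1: "((2 * \<alpha> - \<eta>) * (\<eta> - \<alpha>)) *s r = ?x \<odot> (a \<odot> b)"
  proof -
    have "a \<odot> (?x \<odot> b) = ((2 * \<alpha> - \<eta>) * (\<eta> - \<alpha>)) *s r" unfolding xb by (simp add: bilinear ar')
    then show ?thesis using seress[OF a xa, of b] by metis
  qed
  have 2: "?x \<odot> (a \<odot> b) = (\<alpha> * \<gamma>) *s w - sg a b \<odot> r + \<beta> *s ((2 * \<alpha> - \<eta>) *s r')"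
  proof -
    have "?x \<odot> (a \<odot> b) = ?x \<odot> sg a b + \<beta> *s (?x \<odot> a + ?x \<odot> b)"
      by (simp only: mult_sg[of a b] mult_add_right mult_scale_right)
    also have "?x \<odot> sg a b = (\<alpha> * \<gamma>) *s w - sg a b \<odot> r"
      by (simp add: bilinear mult_commute[of w "sg a b"] mult_commute[of r "sg a b"] s)
    finally show ?thesis unfolding xa xb by simp
  qed
  show ?thesis
    using 1 unfolding 2 by (simp add: algebra_simps)
qed

text \<open>
  Adding the formula of \<open>common_eigenvector_step\<close> to its mirror image and comparing with the
  product of \<open>sg a b\<close> and \<open>r + r' = \<eta> w\<close> yields a scalar equation for \<open>w\<close>.
\<close>

lemma common_eigenvector_zero:
  assumes a: "primitive_axis a" and b: "primitive_axis b" and r: "a \<odot> w = r" "a \<odot> r = \<alpha> *s r"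
    and r': "b \<odot> w = r'" "b \<odot> r' = \<alpha> *s r'" and sum: "r + r' = \<eta> *s w" and s: "sg a b \<odot> w = \<gamma> *s w"
    and ne: "\<eta> - 2 * \<alpha> \<noteq> 0" "\<gamma> + (\<alpha> + \<beta> - \<eta>) * \<eta> \<noteq> 0"
  shows "w = 0"
proof -
  have sum': "r' + r = \<eta> *s w" using sum by (simp add: add.commute)
  have s': "sg b a \<odot> w = \<gamma> *s w" using s by (simp add: sg_commute)
  note 1 = common_eigenvector_step[OF a r r' sum s]
  note 2 = common_eigenvector_step[OF b r' r sum' s', unfolded sg_commute[of b a]]
  have 3: "sg a b \<odot> r + sg a b \<odot> r' = (\<eta> * \<gamma>) *s w"
    using arg_cong[where f = "\<lambda>x. sg a b \<odot> x", OF sum] by (simp add: bilinear s)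
  have "((\<eta> - 2 * \<alpha>) * (\<gamma> + (\<alpha> + \<beta> - \<eta>) * \<eta>)) *s w = 0"
  proof (rule eq_by_functionals)
    fix f :: "'w \<Rightarrow> 'f" assume f: "linear_form f"
    have 4: "f r + f r' = \<eta> * f w" using arg_cong[where f = f, OF sum] f by (simp add: linear_form_simps)
    have 5: "f (sg a b \<odot> r) + f (sg a b \<odot> r') = \<eta> * \<gamma> * f w"
      using arg_cong[where f = f, OF 3] f by (simp add: linear_form_simps)
    have "f (((\<eta> - 2 * \<alpha>) * (\<gamma> + (\<alpha> + \<beta> - \<eta>) * \<eta>)) *s w) = 0"
      by (rule lincomb2[OF 5[unfolded 1 2] 4, where k = "-1" and k' = "(\<beta> - (\<eta> - \<alpha>)) * (2 * \<alpha> - \<eta>)"])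
        (simp add: linear_form_simps[OF f] algebra_simps)
    then show "f (((\<eta> - 2 * \<alpha>) * (\<gamma> + (\<alpha> + \<beta> - \<eta>) * \<eta>)) *s w) = f 0" using f by (simp add: linear_form_simps)
  qed
  then show ?thesis using ne by simp
qed

text \<open>
  By \<open>i3\<close>, \<open>(l - \<beta> / 2) * Q\<close> is a multiple of \<open>l2 - l\<close> for a certain linear function
  \<open>Q\<close> of \<open>l\<close>. If \<open>l2 - l\<close> were not zero, then \<open>i1\<close> and \<open>i2\<close> could be divided by it and would
  together amount to an equation between \<open>\<alpha>\<close> and \<open>\<beta>\<close> alone. So \<open>l2 = l\<close>, and \<open>l\<close> is
  \<open>\<beta> / 2\<close> or the root of \<open>Q\<close>.
\<close>

lemma three_axes_scalars:
  assumes i1: "(kk - ll) * (((\<alpha> - 2 * \<beta>) * (\<alpha> - \<beta>) - 4 * hh) * (\<beta> / 2 - l2) - xx l l * (\<beta> / 2 - l))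
      = (\<alpha> - 2 * \<beta>) * (dd l l - 3 * cc) * (l - l2)"
    and i2: "(kk - ll) * (ls l2 - lq l l l2) = (dd l l - 3 * cc) * (l2 - l)"
    and i3: "ee l l l2 = cc + dd l l"
  shows "l2 = l" "sp l 1 \<or> sp l (19/10)"
proof -
  let ?G = "\<alpha> - 2 * \<beta>"
  define Q where "Q = ?G * (\<alpha> - \<beta>) - 4 * hh - xx l l"
  \<comment> \<open>ee at l2 = l factors after subtraction of the right-hand side of i3\<close>
  have K1: "ee l l l - cc - dd l l = - (\<alpha> - \<beta>) / 2 * ((l - \<beta> / 2) * Q)"
    unfolding Q_def cc_def dd_def ee_def xx_def gg_def ls_def hh_def
    by (simp add: field_simps power2_eq_square power3_eq_cube power4_eq_xxxx)
  have K2: "lq l l l = ls l"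
    unfolding lq_def ls_def gg_def hh_def by (simp add: field_simps power2_eq_square)
  have e: "ee l l l2 = ee l l l + \<alpha> * \<beta> * (\<alpha> - \<beta>) / 2 * (l2 - l)" by (simp add: ee_def field_simps)
  have "(\<alpha> - \<beta>) * (\<alpha> * \<beta> * (l2 - l) - (l - \<beta> / 2) * Q) = 0"
  proof -
    have "ee l l l2 - cc - dd l l = - (\<alpha> - \<beta>) / 2 * ((l - \<beta> / 2) * Q) + \<alpha> * \<beta> * (\<alpha> - \<beta>) / 2 * (l2 - l)"
      unfolding e K1[symmetric] by simp
    then have "- (\<alpha> - \<beta>) / 2 * ((l - \<beta> / 2) * Q) + \<alpha> * \<beta> * (\<alpha> - \<beta>) / 2 * (l2 - l) = 0" using i3 by simp
    then show ?thesis by (rule lincomb1[where k = 2]) (simp add: field_simps)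
  qed
  then have Q: "(l - \<beta> / 2) * Q = \<alpha> * \<beta> * (l2 - l)" by simp
  have lql: "lq l l l2 = ls l + \<beta> * (l2 - l)"
    using linear_in_second(2)[of l l l2] linear_in_second(2)[of l l l] K2 by (simp add: algebra_simps)
  show 1: "l2 = l"
  proof (rule ccontr)
    assume "l2 \<noteq> l"
    then have ne: "l2 - l \<noteq> 0" by simp
    have "(l2 - l) * ((kk - ll) * (1 - 2 * \<beta>) - (dd l l - 3 * cc)) = 0"
      by (rule lincomb1[OF i2, where k = 1]) (simp add: lql ls_def algebra_simps)
    then have d: "(kk - ll) * (1 - 2 * \<beta>) = dd l l - 3 * cc" using ne by simp
    have "(l2 - l) * ((kk - ll) * (- \<alpha> * \<beta> - (?G * (\<alpha> - \<beta>) - 4 * hh)) + ?G * (dd l l - 3 * cc)) = 0"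
      by (rule lincomb2[OF i1 Q, where k = 1 and k' = "kk - ll"]) (simp add: Q_def algebra_simps)
    then have "(kk - ll) * (- \<alpha> * \<beta> - (?G * (\<alpha> - \<beta>) - 4 * hh)) + ?G * (dd l l - 3 * cc) = 0"
      using ne unfolding mult_eq_0_iff by blast
    then have "(kk - ll) * (- \<alpha> * \<beta> - (?G * (\<alpha> - \<beta>) - 4 * hh) + ?G * (1 - 2 * \<beta>)) = 0"
      by (rule lincomb2[OF _ d, where k = 1 and k' = ?G]) (simp add: algebra_simps)
    moreover have "- \<alpha> * \<beta> - (?G * (\<alpha> - \<beta>) - 4 * hh) + ?G * (1 - 2 * \<beta>) \<noteq> 0"
      unfolding hh_def by (rule sp_nonzero, (rule sp_intros | (simp; fail))+)
    ultimately show False using nonzero_scalars(4) by simp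
  qed
  have "l - \<beta> / 2 = 0 \<or> Q = 0" using Q 1 by simp
  then show "sp l 1 \<or> sp l (19/10)"
  proof
    assume "l - \<beta> / 2 = 0"
    then have l: "l = \<beta> / 2" by simp
    have "sp (\<beta> / 2) 1" by (rule sp_eq, (rule sp_intros | (simp; fail))+)
    then show ?thesis unfolding l by blast
  next
    assume "Q = 0"
    have "(4 * (2 * \<alpha> - 1)) * l + (?G * (\<alpha> - \<beta>) - 4 * hh - xx 0 0) = Q"
      unfolding Q_def xx_def gg_def ls_def by (simp add: algebra_simps)
    then have "(4 * (2 * \<alpha> - 1)) * l + (?G * (\<alpha> - \<beta>) - 4 * hh - xx 0 0) = 0" using \<open>Q = 0\<close> by simp
    then have "sp l (19/10)"
      by (rule sp_solve') (unfold scalar_defs, (rule sp_intros | (simp; fail))+)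
    then show ?thesis ..
  qed
qed

text \<open>
  Let \<open>w = A 2 - A (-1)\<close>, the difference of the two given invariants. By invariance it
  also equals \<open>A (-2) - A 1\<close> and \<open>A 0 - A 3\<close>. The product with \<open>sg1 A\<close> shows that the
  sequence is symmetric; the recurrence and the relation \<open>two_squares\<close> then become equations
  for the projections, solved in \<open>three_axes_scalars\<close>. They give that \<open>w\<close> has no component
  along \<open>A 0\<close> and \<open>A 1\<close>, so the products of \<open>w\<close> with these two axes are \<open>\<alpha>\<close>-eigenvectors of
  them. By \<open>two_squares\<close> the sum of both products is a multiple of \<open>w\<close>, and
  \<open>common_eigenvector_zero\<close> applies.
\<close>

lemma three_axes:
  assumes A: "dihedral A" and Y0: "A (- 1) + A 0 + A 1 \<in> inv_space A" and Y1: "A 0 + A 1 + A 2 \<in> inv_space A"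
    and A0: "A 0 \<notin> inv_space A" and A1: "A 1 \<notin> inv_space A"
  shows "A (- 1) = A 2"
proof -
  define w where "w = A 2 - A (- 1)"
  define l m l2 m2 where "l = lam1 A 0" and "m = lam1 A 1" and "l2 = lam2 A 0" and "m2 = lam2 A 1"
  let ?G = "\<alpha> - 2 * \<beta>"
  note ax = dihedral_axis[OF A]
  note t = dihedral_tau[OF A] and tlin = tau_linear[OF ax]
  have "w = (A 0 + A 1 + A 2) - (A (- 1) + A 0 + A 1)" by (simp add: w_def)
  then have wZ: "w \<in> inv_space A" using subspace_diff[OF subspace_inv[OF A] Y1 Y0] by simp
  have w0: "A (- 2) - A 1 = w"
    using wZ unfolding inv_space_def by (auto simp: w_def tlin t dest!: spec[of _ 0])
  have w1: "A 0 - A 3 = w"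
    using wZ unfolding inv_space_def by (auto simp: w_def tlin t dest!: spec[of _ 1])
  have a3: "A 3 = A 0 - w" and am2: "A (- 2) = A 1 + w" and a2: "A 2 = A (- 1) + w"
    by (simp add: w1[symmetric], simp add: w0[symmetric], simp add: w_def)
  have l12: "lam1 A (- 1) = m" "lam1 A 2 = l" "lam2 A 2 = l2" "lam2 A (-1) = m2"
    using lam1_period[OF A, of "-1"] lam1_period[OF A, of 0] lam2_period[OF A, of 0] lam2_period[OF A, of "-1"]
    by (simp_all add: l_def m_def l2_def m2_def)
  have s2: "A 2 \<odot> sg1 A = (\<alpha> - \<beta>) *s sg1 A + gg l *s A 2 + hh *s (A 3 + A 1)"
    and sm1: "A (- 1) \<odot> sg1 A = (\<alpha> - \<beta>) *s sg1 A + gg m *s A (- 1) + hh *s (A 0 + A (- 2))"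
    using mult_sg_center(1)[OF A, of 2] mult_sg_center(1)[OF A, of "-1"] by (simp_all add: l12)
  have sw: "sg1 A \<odot> w = (gg l - 2 * hh) *s w + (gg l - gg m) *s A (- 1)"
  proof -
    have "sg1 A \<odot> w = A 2 \<odot> sg1 A - A (- 1) \<odot> sg1 A" by (simp add: w_def bilinear mult_commute)
    also have "\<dots> = (gg l - 2 * hh) *s w + (gg l - gg m) *s A (- 1)"
      unfolding s2 sm1 unfolding a3 am2 a2 by (rule eq_by_functionals) (simp add: linear_form_simps algebra_simps)
    finally show ?thesis .
  qed
  have Am1: "A (- 1) \<notin> inv_space A"
  proof
    assume *: "A (- 1) \<in> inv_space A"
    then have "tau (A 0) (A (- 1)) = A (- 1)" by (simp add: inv_space_def)
    then show False using * A1 by (simp add: t)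
  qed
  have gl: "gg l - gg m = 0"
  proof -
    obtain f where f: "kills A f" "f (A (- 1)) \<noteq> 0" using inv_space_iff[OF A] Am1 by blast
    have "f (sg1 A \<odot> w) = 0" by (rule kills_inv_mult[OF A f(1) inv_sg1[OF A] wZ])
    then have "(gg l - gg m) * f (A (- 1)) = 0"
      unfolding sw using kills_zero[OF f(1) wZ] by (simp add: kills_linear[OF f(1)])
    with f(2) show ?thesis by simp
  qed
  have "(1 - \<alpha>) * (l - m) = 0" using gl by (simp add: gg_def algebra_simps)
  then have lm: "m = l" by simp
  have sw': "sg1 A \<odot> w = (gg l - 2 * hh) *s w" using sw gl by simp
  obtain f where f: "kills A f" "f (A 0) \<noteq> 0" using inv_space_iff[OF A] A0 by blast
  note lf = kills_linear[OF f(1)]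
  have fw: "f w = 0" by (rule kills_zero[OF f(1) wZ])
  have fm1: "f (A (- 1)) = - f (A 0) - f (A 1)"
    using kills_zero[OF f(1) Y0] by (simp add: lf eq_diff_eq eq_neg_iff_add_eq_0 algebra_simps)
  have e: "ee l l l2 = cc + dd l l"
  proof -
    have "cc * (f (A 2) + f (A (- 2))) + dd l l * (f (A 1) + f (A (- 1))) + ee l l l2 * f (A 0) = 0"
      using kills_mult(6)[OF A f(1), of 0] lm by (simp add: l_def m_def l2_def)
    then have "(ee l l l2 - (cc + dd l l)) * f (A 0) = 0"
      unfolding a2 am2 by (simp add: lf fw fm1 algebra_simps)
    with f(2) show ?thesis by simp
  qed
  have e': "ee l l m2 = cc + dd l l"
  proof -
    obtain g where g: "kills A g" "g (A 1) \<noteq> 0" using inv_space_iff[OF A] A1 by blast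
    note lg = kills_linear[OF g(1)]
    have gw: "g w = 0" by (rule kills_zero[OF g(1) wZ])
    have gm1: "g (A (- 1)) = - g (A 0) - g (A 1)"
      using kills_zero[OF g(1) Y0] by (simp add: lg eq_diff_eq eq_neg_iff_add_eq_0 algebra_simps)
    have "cc * (g (A 3) + g (A (- 1))) + dd l l * (g (A 2) + g (A 0)) + ee l l m2 * g (A 1) = 0"
      using kills_mult(6)[OF A g(1), of 1] lm l12 by (simp add: l_def m_def m2_def)
    then have "(ee l l m2 - (cc + dd l l)) * g (A 1) = 0"
      unfolding a3 a2 by (simp add: lg gw gm1 algebra_simps)
    with g(2) show ?thesis by simp
  qed
  have lm2: "m2 = l2"
  proof -
    have "\<alpha> * \<beta> * (\<alpha> - \<beta>) / 2 * (l2 - m2) = 0"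
      by (rule lincomb2[OF e e', where k = 1 and k' = "-1"]) (simp add: ee_def field_simps)
    then show ?thesis by simp
  qed
  have R: "(kk - ll) *s (sg2 A 0 - sg2 A 1) = (dd l l - 3 * cc) *s w"
  proof -
    have z0: "zc A 0 = cc *s (A 2 + A (- 2)) + dd l l *s (A 1 + A (- 1)) + (cc + dd l l) *s A 0"
      using e lm by (simp add: zc_def l_def m_def l2_def)
    have z1: "zc A 1 = cc *s (A 3 + A (- 1)) + dd l l *s (A 2 + A 0) + (cc + dd l l) *s A 1"
      using e' lm l12 by (simp add: zc_def l_def m_def m2_def)
    have "zc A 0 + (kk - ll) *s (sg2 A 0 - sg2 A 1) = zc A 1"
      using two_squares[OF A, of 0] lm by (simp add: l_def m_def)
    then have "(kk - ll) *s (sg2 A 0 - sg2 A 1) = zc A 1 - zc A 0" by (simp add: algebra_simps)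
    also have "\<dots> = (dd l l - 3 * cc) *s w"
      unfolding z0 z1 a3 am2 a2 by (rule eq_by_functionals) (simp add: linear_form_simps algebra_simps)
    finally show ?thesis .
  qed
  let ?a = "A 0"
  let ?v = "pa ?a (A 1)" and ?v2 = "pa ?a (A 2)"
  note lin = axis_linear[OF ax[of 0]] axis_self[OF ax[of 0]]
  have neg: "pa ?a (A (- 1)) = ?v" "lam ?a (A (- 1)) = l"
  proof -
    have "A (- 1) = A 1 - 2 *s pb ?a (A 1)" using t[of 0 1] tau_eq[OF ax[of 0], of "A 1"] by simp
    then show "pa ?a (A (- 1)) = ?v" "lam ?a (A (- 1)) = l" using ax[of 0] by (simp_all add: lin l_def lam1_def)
  qed
  have q: "sg2 A 1 = sg (A 1) (A (- 1))" using sg2_pred[OF A, of 0] by (simp add: sg2_def sg_commute)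
  have l': "lam (A 0) (A 1) = l" "lam (A 1) (A 0) = l" "lam (A 0) (A 2) = l2"
    using lam1_back[OF A, of 1] lm by (simp_all add: l_def m_def l2_def lam1_def lam2_def)
  have pq: "?G *s pa ?a (sg2 A 1) = xx l l *s ?v + (4 * hh) *s ?v2"
    using alpha_part_q[OF A] by (simp add: q l')
  have lamq: "lam ?a (sg2 A 1) = lq l l l2" using lam_q[OF A] by (simp add: q l')
  have pp: "pa ?a (sg2 A 0) = (\<alpha> - \<beta>) *s ?v2" "lam ?a (sg2 A 0) = ls l2"
    by (simp_all add: sg2_def proj_sg[OF ax[of 0]] l')
  have pw: "pa ?a w = ?v2 - ?v" "lam ?a w = l2 - l" by (simp_all add: w_def lin neg l')
  have i2: "(kk - ll) * (ls l2 - lq l l l2) = (dd l l - 3 * cc) * (l2 - l)"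
    using arg_cong[where f = "lam ?a", OF R] by (simp add: lin pp lamq pw)
  have i1: "(kk - ll) * ((?G * (\<alpha> - \<beta>) - 4 * hh) * (\<beta> / 2 - l2) - xx l l * (\<beta> / 2 - l))
      = ?G * (dd l l - 3 * cc) * (l - l2)"
  proof -
    have fv: "\<alpha> * f ?v = (\<beta> / 2 - l) * f ?a" "\<alpha> * f ?v2 = (\<beta> / 2 - l2) * f ?a"
    proof -
      have "\<alpha> * f ?v = (\<beta> - l) * f ?a + \<beta> / 2 * (f (A 1) + f (A (- 1)))"
        using arg_cong[where f = f, OF scaled_alpha_part[OF ax[of 0], of "A 1"]] kills_zero[OF f(1) inv_sg1[OF A]]
        by (simp add: lf t sg1_def l')
      then show "\<alpha> * f ?v = (\<beta> / 2 - l) * f ?a" unfolding fm1 by (simp add: field_simps)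
      have "\<alpha> * f ?v2 = (\<beta> - l2) * f ?a + \<beta> / 2 * (f (A 2) + f (A (- 2)))"
        using arg_cong[where f = f, OF scaled_alpha_part[OF ax[of 0], of "A 2"]] kills_zero[OF f(1) inv_sg2[OF A, of 0]]
        by (simp add: lf t sg2_def l')
      then show "\<alpha> * f ?v2 = (\<beta> / 2 - l2) * f ?a" unfolding a2 am2 lf fw fm1 by (simp add: field_simps)
    qed
    have 1: "(kk - ll) * ((\<alpha> - \<beta>) * f ?v2 - f (pa ?a (sg2 A 1))) = (dd l l - 3 * cc) * (f ?v2 - f ?v)"
      using arg_cong[where f = "\<lambda>x. f (pa ?a x)", OF R] by (simp add: lin pp pw lf)
    have 2: "?G * f (pa ?a (sg2 A 1)) = xx l l * f ?v + 4 * hh * f ?v2"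
      using arg_cong[where f = f, OF pq] by (simp add: lf)
    have "(kk - ll) * ((?G * (\<alpha> - \<beta>) - 4 * hh) * f ?v2 - xx l l * f ?v) = ?G * (dd l l - 3 * cc) * (f ?v2 - f ?v)"
      by (rule lincomb2[OF 1 2, where k = ?G and k' = "kk - ll"]) (simp add: algebra_simps)
    then have "(kk - ll) * ((?G * (\<alpha> - \<beta>) - 4 * hh) * (\<alpha> * f ?v2) - xx l l * (\<alpha> * f ?v))
      = ?G * (dd l l - 3 * cc) * (\<alpha> * f ?v2 - \<alpha> * f ?v)"
      by (rule lincomb1[where k = \<alpha>]) (simp add: algebra_simps)
    then have "((kk - ll) * ((?G * (\<alpha> - \<beta>) - 4 * hh) * (\<beta> / 2 - l2) - xx l l * (\<beta> / 2 - l))) * f ?a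
      = (?G * (dd l l - 3 * cc) * (l - l2)) * f ?a"
      unfolding fv by (rule lincomb1[where k = 1]) (simp add: algebra_simps)
    with f(2) show ?thesis by simp
  qed
  note sc = three_axes_scalars[OF i1 i2 e]
  \<comment> \<open>By R the products of w with A 0 and A 1 add up to \<open>\<eta> w\<close>.\<close>
  define \<eta> where "\<eta> = (dd l l - 3 * cc) / (kk - ll) + 2 * \<beta>"
  define r r' where "r = A 0 \<odot> w" and "r' = A 1 \<odot> w"
  have rr: "r = sg2 A 0 - sg1 A + \<beta> *s w" "r' = sg1 A - sg2 A 1 + \<beta> *s w"
  proof -
    have p: "A 0 \<odot> A 2 = sg2 A 0 + \<beta> *s (A 0 + A 2)" "A 0 \<odot> A (- 1) = sg1 A + \<beta> *s (A 0 + A (- 1))"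
      "A 1 \<odot> A 2 = sg1 A + \<beta> *s (A 1 + A 2)" "A 1 \<odot> A (- 1) = sg2 A 1 + \<beta> *s (A 1 + A (- 1))"
      using sg1_shift[OF A, of 1] sg1_shift[OF A, of "-1"] sg_commute[of "A 0" "A (- 1)"]
      by (simp_all add: mult_sg[of "A _"] sg2_def[of A 0] q)
    show "r = sg2 A 0 - sg1 A + \<beta> *s w" "r' = sg1 A - sg2 A 1 + \<beta> *s w"
      unfolding r_def r'_def w_def mult_diff_right p
      by (rule eq_by_functionals, simp add: linear_form_simps algebra_simps)+
  qed
  have sum: "r + r' = \<eta> *s w"
  proof -
    have e: "(kk - ll) * \<eta> = (dd l l - 3 * cc) + (kk - ll) * (2 * \<beta>)"
      unfolding \<eta>_def distrib_left using nonzero_scalars(4) by simp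
    have "(kk - ll) *s (r + r') = (kk - ll) *s (sg2 A 0 - sg2 A 1) + ((kk - ll) * (2 * \<beta>)) *s w"
      unfolding rr by (rule eq_by_functionals) (simp add: linear_form_simps algebra_simps)
    also have "\<dots> = ((kk - ll) * \<eta>) *s w"
      unfolding e R by (rule scale_left_distrib[symmetric])
    finally have "(kk - ll) *s (r + r') = (kk - ll) *s (\<eta> *s w)" by simp
    then show ?thesis using nonzero_scalars(4) by (metis scale_left_imp_eq)
  qed
  have wb: "pb (A i) w = 0" for i
    using wZ tau_fixed_iff[OF ax[of i], of w] by (simp add: inv_space_def)
  have "lam (A 1) w = m2 - m"
  proof -
    have "lam (A 1) (A 2) = m" "lam (A 1) (A (- 1)) = m2"
      using lam2_back[OF A, of 1] by (simp_all add: m_def m2_def lam1_def)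
    then show ?thesis using lm lm2 sc(1) by (simp add: w_def axis_linear[OF ax[of 1]])
  qed
  then have lw: "lam (A 1) w = 0" "lam (A 0) w = 0" using pw lm lm2 sc(1) by simp_all
  have eig: "A i \<odot> (A i \<odot> w) = \<alpha> *s (A i \<odot> w)" if "lam (A i) w = 0" for i
  proof -
    have *: "A i \<odot> w = \<alpha> *s pa (A i) w" using axis_mult[OF ax[of i], of w] that wb by simp
    have "A i \<odot> pa (A i) w = \<alpha> *s pa (A i) w" using axis_eigen(2)[OF ax[of i], of w] by (simp add: mult_commute)
    then show ?thesis unfolding * by (simp add: bilinear)
  qed
  have \<eta>: "\<eta> - 2 * \<alpha> \<noteq> 0" "gg l - 2 * hh + (\<alpha> + \<beta> - \<eta>) * \<eta> \<noteq> 0"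
  proof -
    from sc(2) have "(\<eta> - 2 * \<alpha> \<noteq> 0) \<and> (gg l - 2 * hh + (\<alpha> + \<beta> - \<eta>) * \<eta> \<noteq> 0)"
    proof
      assume l: "sp l 1"
      have h: "sp \<eta> (7/2)" unfolding \<eta>_def
        by (rule sp_eq) (unfold scalar_defs, (rule sp_intros l | (simp; fail))+)
      have "\<eta> - 2 * \<alpha> \<noteq> 0" by (rule sp_nonzero, (rule sp_intros h | (simp; fail))+)
      moreover have "gg l - 2 * hh + (\<alpha> + \<beta> - \<eta>) * \<eta> \<noteq> 0"
        by (rule sp_nonzero, unfold gg_def hh_def, (rule sp_intros h l | (simp; fail))+)
      ultimately show ?thesis ..
    next
      assume l: "sp l (19/10)"
      have h: "sp \<eta> (-29/20)" unfolding \<eta>_def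
        by (rule sp_eq) (unfold scalar_defs, (rule sp_intros l | (simp; fail))+)
      have "\<eta> - 2 * \<alpha> \<noteq> 0" by (rule sp_nonzero, (rule sp_intros h | (simp; fail))+)
      moreover have "gg l - 2 * hh + (\<alpha> + \<beta> - \<eta>) * \<eta> \<noteq> 0"
        by (rule sp_nonzero, unfold gg_def hh_def, (rule sp_intros h l | (simp; fail))+)
      ultimately show ?thesis ..
    qed
    then show "\<eta> - 2 * \<alpha> \<noteq> 0" "gg l - 2 * hh + (\<alpha> + \<beta> - \<eta>) * \<eta> \<noteq> 0" by simp_all
  qed
  have "w = 0"
    by (rule common_eigenvector_zero[OF ax ax r_def[symmetric] _ r'_def[symmetric] _ sum sw'[unfolded sg1_def] \<eta>])
      (simp_all add: r_def r'_def eig lw)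
  then show ?thesis by (simp add: w_def)
qed

section \<open>Two axes\<close>

text \<open>
  The product of the invariants \<open>sg1 A\<close> and \<open>A 0 + A 1 + A 2\<close> is invariant. By
  \<open>axis_mult_sg\<close> it is a non-zero multiple of \<open>A 1\<close> modulo the invariants.
\<close>

lemma mixed_ratios:
  assumes A: "dihedral A" and sym: "lam1 A 0 = lam1 A 1"
    and E: "A 1 + A (- 1) \<in> inv_space A" and Y: "A 0 + A 1 + A 2 \<in> inv_space A"
  shows "A 1 \<in> inv_space A"
  unfolding inv_space_iff[OF A]
proof (intro allI impI)
  fix f assume f: "kills A f"
  note lf = kills_linear[OF f]
  have "tau (A 1) (A 1 + A (- 1)) = A 1 + A (- 1)" using E by (simp add: inv_space_def)
  then have 3: "A 3 = A (- 1)" by (simp add: tau_linear[OF dihedral_axis[OF A]] dihedral_tau[OF A])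
  have l2: "lam1 A 2 = lam1 A 1" using lam1_period[OF A, of 0] sym by simp
  have E': "f (A 1) + f (A (- 1)) = 0" and Y': "f (A 0) + f (A 1) + f (A 2) = 0"
    using kills_zero[OF f E] kills_zero[OF f Y] by (simp_all add: lf)
  have "0 = f (sg1 A \<odot> (A 0 + A 1 + A 2))" using kills_inv_mult[OF A f inv_sg1[OF A] Y] by simp
  also have "\<dots> = f (A 0 \<odot> sg1 A) + f (A 1 \<odot> sg1 A) + f (A 2 \<odot> sg1 A)"
    by (simp add: bilinear lf mult_commute)
  also have "\<dots> = gg (lam1 A 1) * (f (A 0) + f (A 1) + f (A 2)) + hh * (2 * (f (A 1) + f (A (- 1))) + (f (A 0) + f (A 1) + f (A 2)) - f (A 1))"
    using kills_mult(1)[OF A f, of 0] kills_mult(1)[OF A f, of 1] kills_mult(1)[OF A f, of 2]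
    by (simp add: sym l2 3 algebra_simps)
  also have "\<dots> = - hh * f (A 1)" unfolding E' Y' by simp
  finally show "f (A 1) = 0" using nonzero_scalars(2) by simp
qed

text \<open>
  The four combinations of the ratios 0 and -1 at \<open>A 0\<close> and at \<open>A 1\<close>.
\<close>

lemma symmetric_pair:
  assumes A: "dihedral A" and sym: "lam1 A 0 = lam1 A 1" "lam2 A 0 = lam2 A 1"
  shows "A 0 \<in> inv_space A \<or> A 1 \<in> inv_space A \<or> A (- 1) = A 2"
proof (rule ccontr)
  assume "\<not> ?thesis"
  then have A0: "A 0 \<notin> inv_space A" and A1: "A 1 \<notin> inv_space A" and ne: "A (- 1) \<noteq> A 2" by auto
  let ?B = "\<lambda>n. A (1 - n)"
  have B: "dihedral ?B" by (rule dihedral_flip[OF A])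
  have Bl: "lam1 ?B 0 = lam1 A 1" "lam1 ?B 1 = lam1 A 0" "lam2 ?B 0 = lam2 A 1" "lam2 ?B 1 = lam2 A 0"
    by (simp_all add: lam_flip[OF A])
  obtain N where N: "A 1 + A (- 1) - N *s A 0 \<in> inv_space A"
    using symmetric_ratio[OF A sym(1) refl sym(2) refl A0] by blast
  obtain N' where N': "A 0 + A 2 - N' *s A 1 \<in> inv_space A"
    using symmetric_ratio[OF B, of "lam1 A 0" "lam2 A 0"] sym A1 unfolding Bl inv_space_flip by auto
  have "N = 0 \<or> N = -1" using ratio_zero_or_minus_one[OF A, of 0 N] N A0 by simp
  moreover have "N' = 0 \<or> N' = -1"
    using ratio_zero_or_minus_one[OF A, of 1 N'] N' A1 by (simp add: add.commute)
  ultimately consider (00) "N = 0" "N' = 0" | (01) "N = 0" "N' = -1" | (10) "N = -1" "N' = 0" | (11) "N = -1" "N' = -1"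
    by blast
  then show False
  proof cases
    case 00
    then show False using no_four_axes[OF A _ _ A0 A1] N N' by simp
  next
    case 01
    then show False using mixed_ratios[OF A sym(1)] N N' A1 by (simp add: algebra_simps)
  next
    case 10
    then show False using mixed_ratios[OF B] sym N N' A0 unfolding Bl inv_space_flip by (simp add: algebra_simps)
  next
    case 11
    then show False using three_axes[OF A _ _ A0 A1] N N' ne by (simp add: algebra_simps)
  qed
qed

text \<open>
  Every second axis: this sequence has the symmetry required by \<open>symmetric_pair\<close>, because its
  terms are the images of a single one under the translations in the dihedral group.
\<close>

lemma alternate_axes:
  assumes A: "dihedral A"
  shows "A 0 + A 2 \<in> inv_space A \<or> A (- 2) + A 0 + A 2 \<in> inv_space A"
proof -
  define C where "C n = A (2 * n)" for n
  have C: "dihedral C" using dihedral_affine[OF A, of 0 2] by (simp add: C_def[abs_def])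
  have l: "lam1 C 0 = lam1 C 1" "lam2 C 0 = lam2 C 1"
    using dihedral_lam_shift[OF A, of 0 1 2] dihedral_lam_shift[OF A, of 0 1 4]
    by (simp_all add: lam1_def lam2_def C_def)
  note t = dihedral_tau[OF A] and tlin = tau_linear[OF dihedral_axis[OF A]]
  have four: ?thesis if "A (- 2) = A 2"
  proof -
    have "A 4 = A 0" using arg_cong[where f = "tau (A 1)", OF that] by (simp add: t)
    have "A 0 + A 2 \<in> inv_space A"
      by (rule inv_spaceI[OF A]) (simp_all add: tlin t that add.commute)
    then show ?thesis ..
  qed
  from symmetric_pair[OF C l] show ?thesis
  proof (elim disjE)
    assume "C 0 \<in> inv_space C"
    then have "tau (C 1) (C 0) = C 0" by (simp add: inv_space_def)
    then have "A 4 = A 0" by (simp add: C_def t)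
    from arg_cong[where f = "tau (A 1)", OF this] show ?thesis by (intro four) (simp add: t)
  next
    assume "C 1 \<in> inv_space C"
    then have "tau (C 0) (C 1) = C 1" by (simp add: inv_space_def)
    then show ?thesis by (intro four) (simp add: C_def t)
  next
    assume "C (- 1) = C 2"
    then have *: "A 4 = A (- 2)" by (simp add: C_def)
    have "A (- 2) + A 0 + A 2 \<in> inv_space A"
      by (rule inv_spaceI[OF A]) (simp_all add: tlin t * algebra_simps)
    then show ?thesis ..
  qed
qed

text \<open>
  As in \<open>mixed_ratios\<close>, with the invariants \<open>sg1 A\<close> and \<open>A 0 + A 2\<close>.
\<close>

lemma four_and_six:
  assumes A: "dihedral A" and F: "A 0 + A 2 \<in> inv_space A" and Y: "A 3 + A 1 + A (- 1) \<in> inv_space A"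
  shows "A 1 \<in> inv_space A"
  unfolding inv_space_iff[OF A]
proof (intro allI impI)
  fix f assume f: "kills A f"
  note lf = kills_linear[OF f]
  have l2: "lam1 A 2 = lam1 A 0" using lam1_period[OF A, of 0] by simp
  have F': "f (A 0) + f (A 2) = 0" and Y': "f (A 3) + f (A 1) + f (A (- 1)) = 0"
    using kills_zero[OF f F] kills_zero[OF f Y] by (simp_all add: lf)
  have "0 = f (sg1 A \<odot> (A 0 + A 2))" using kills_inv_mult[OF A f inv_sg1[OF A] F] by simp
  also have "\<dots> = f (A 0 \<odot> sg1 A) + f (A 2 \<odot> sg1 A)" by (simp add: bilinear lf mult_commute)
  also have "\<dots> = gg (lam1 A 0) * (f (A 0) + f (A 2)) + hh * (f (A 3) + f (A 1) + f (A (- 1)) + f (A 1))"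
    using kills_mult(1)[OF A f, of 0] kills_mult(1)[OF A f, of 2] by (simp add: l2 algebra_simps)
  also have "\<dots> = hh * f (A 1)" unfolding F' Y' by simp
  finally show "f (A 1) = 0" using nonzero_scalars(2) by simp
qed

text \<open>
  With the given invariants the recurrence at \<open>A 0\<close> reduces to a relation between
  \<open>A 1 + A (-1)\<close> and \<open>A 0\<close>. If it were not trivial, it would give a ratio, hence 0 or -1;
  the former makes \<open>A 3\<close> and so \<open>A 1\<close> invariant, the latter leads to the situation of
  \<open>three_axes\<close>.
\<close>

lemma six_and_six:
  assumes A: "dihedral A" and E: "A (- 2) + A 0 + A 2 \<in> inv_space A" and Y: "A 3 + A 1 + A (- 1) \<in> inv_space A"
    and A0: "A 0 \<notin> inv_space A" and A1: "A 1 \<notin> inv_space A" and ne: "A (- 1) \<noteq> A 2"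
  shows "dd (lam1 A 0) (lam1 A 1) = 0" "ee (lam1 A 0) (lam1 A 1) (lam2 A 0) = cc"
proof -
  note Z = subspace_inv[OF A]
  note t = dihedral_tau[OF A] and tlin = tau_linear[OF dihedral_axis[OF A]]
  let ?d = "dd (lam1 A 0) (lam1 A 1)" and ?e = "ee (lam1 A 0) (lam1 A 1) (lam2 A 0)"
  have eq: "?d * (f (A 1) + f (A (- 1))) + (?e - cc) * f (A 0) = 0" if f: "kills A f" for f
  proof -
    have r: "cc * (f (A 2) + f (A (- 2))) + ?d * (f (A 1) + f (A (- 1))) + ?e * f (A 0) = 0"
      using kills_mult(6)[OF A f, of 0] by simp
    have E': "f (A (- 2)) + f (A 0) + f (A 2) = 0" using kills_zero[OF f E] by (simp add: kills_linear[OF f])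
    show ?thesis by (rule lincomb2[OF r E', where k = 1 and k' = "- cc"]) (simp add: algebra_simps)
  qed
  have "\<not> (A 1 + A (- 1) - N *s A 0 \<in> inv_space A)" for N
  proof
    assume N: "A 1 + A (- 1) - N *s A 0 \<in> inv_space A"
    then have "N = 0 \<or> N = -1" using ratio_zero_or_minus_one[OF A, of 0 N] A0 by simp
    then show False
    proof
      assume "N = 0"
      then have "A 1 + A (- 1) \<in> inv_space A" using N by simp
      from subspace_diff[OF Z Y this] have 3: "A 3 \<in> inv_space A" by (simp add: algebra_simps)
      then have "tau (A 2) (A 3) = A 3" by (simp add: inv_space_def)
      then show False using 3 A1 by (simp add: t)
    next
      assume "N = -1"
      then have Y0: "A (- 1) + A 0 + A 1 \<in> inv_space A" using N by (simp add: algebra_simps)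
      then have "tau (A 1) (A (- 1) + A 0 + A 1) = A (- 1) + A 0 + A 1" by (simp add: inv_space_def)
      then have Y1: "A 3 + A 2 + A 1 = A (- 1) + A 0 + A 1" by (simp add: tlin t)
      have "A 0 + A 1 + A 2 = (A (- 1) + A 0 + A 1) + ((A 3 + A 2 + A 1) - (A 3 + A 1 + A (- 1)))"
        by simp
      also have "\<dots> \<in> inv_space A" unfolding Y1
        by (intro subspace_add[OF Z] subspace_diff[OF Z] Y0 Y)
      finally have "A 0 + A 1 + A 2 \<in> inv_space A" .
      from three_axes[OF A Y0 this A0 A1] ne show False by simp
    qed
  qed
  then show "?d = 0" "?e = cc" using ratio_or_zero[OF A A0 eq] by auto
qed

text \<open>
  The alternatives of \<open>alternate_axes\<close> for the even and for the odd indices are combined. In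
  the last case \<open>six_and_six\<close> and its mirror image give linear equations for the projections
  that imply their symmetry, and \<open>symmetric_pair\<close> applies.
\<close>

theorem two_axes:
  assumes A: "dihedral A"
  shows "A 0 \<in> inv_space A \<or> A 1 \<in> inv_space A \<or> A (- 1) = A 2"
proof (rule ccontr)
  assume "\<not> ?thesis"
  then have A0: "A 0 \<notin> inv_space A" and A1: "A 1 \<notin> inv_space A" and ne: "A (- 1) \<noteq> A 2" by auto
  let ?B = "\<lambda>n. A (1 - n)"
  have B: "dihedral ?B" by (rule dihedral_flip[OF A])
  have Bl: "lam1 ?B 0 = lam1 A 1" "lam1 ?B 1 = lam1 A 0" "lam2 ?B 0 = lam2 A 1"
    by (simp_all add: lam_flip[OF A])
  have even: "A 0 + A 2 \<in> inv_space A \<or> A (- 2) + A 0 + A 2 \<in> inv_space A" by (rule alternate_axes[OF A])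
  have odd: "A 1 + A (- 1) \<in> inv_space A \<or> A 3 + A 1 + A (- 1) \<in> inv_space A"
    using alternate_axes[OF B] unfolding inv_space_flip by simp
  from even show False
  proof
    assume F: "A 0 + A 2 \<in> inv_space A"
    from odd show False
    proof
      assume "A 1 + A (- 1) \<in> inv_space A"
      from no_four_axes[OF A this F A0 A1] show False .
    next
      assume "A 3 + A 1 + A (- 1) \<in> inv_space A"
      from four_and_six[OF A F this] A1 show False by simp
    qed
  next
    assume E: "A (- 2) + A 0 + A 2 \<in> inv_space A"
    from odd show False
    proof
      assume "A 1 + A (- 1) \<in> inv_space A"
      then show False using four_and_six[OF B] E A0 unfolding inv_space_flip by simp
    next
      assume Y: "A 3 + A 1 + A (- 1) \<in> inv_space A"
      note a = six_and_six[OF A E Y A0 A1 ne]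
      have b: "dd (lam1 A 1) (lam1 A 0) = 0" "ee (lam1 A 1) (lam1 A 0) (lam2 A 1) = cc"
        using six_and_six[OF B] E Y A0 A1 ne unfolding inv_space_flip Bl by (simp_all add: algebra_simps)
      have "dd (lam1 A 0) (lam1 A 1) - dd (lam1 A 1) (lam1 A 0)
        = (\<alpha> * \<beta> * (\<alpha> - \<beta>) + (\<alpha> - \<beta>) * (\<alpha> - 1) * (\<alpha> - 4 * \<beta>) / 2) * (lam1 A 0 - lam1 A 1)"
        by (simp add: dd_def field_simps)
      moreover have "\<alpha> * \<beta> * (\<alpha> - \<beta>) + (\<alpha> - \<beta>) * (\<alpha> - 1) * (\<alpha> - 4 * \<beta>) / 2 \<noteq> 0"
        by (rule sp_nonzero, (rule sp_intros | (simp; fail))+)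
      ultimately have l: "lam1 A 0 = lam1 A 1" using a(1) b(1) by simp
      have "\<alpha> * \<beta> * (\<alpha> - \<beta>) / 2 * (lam2 A 0 - lam2 A 1) = 0"
        by (rule lincomb2[OF a(2) b(2), where k = 1 and k' = "-1"]) (simp add: l ee_def field_simps)
      then have "lam2 A 0 = lam2 A 1" by simp
      from symmetric_pair[OF A l this] A0 A1 ne show False by simp
    qed
  qed
qed

end

section \<open>The Miyamoto group\<close>

text \<open>
  The orders 2 and 3 of the product correspond to the commutation and to the braid relation; a
  product equal to the identity is included.
\<close>

lemma (in group) involutions_order_at_most_3:
  assumes s: "s \<in> carrier G" "s \<otimes> s = \<one>" and t: "t \<in> carrier G" "t \<otimes> t = \<one>"
    and rel: "s \<otimes> t = t \<otimes> s \<or> s \<otimes> t \<otimes> s = t \<otimes> s \<otimes> t"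
  shows "order_at_most G 3 (s \<otimes> t)"
proof -
  have st: "s \<otimes> t \<in> carrier G" using s t by simp
  have pow2: "(s \<otimes> t) [^] (2::nat) = s \<otimes> t \<otimes> (s \<otimes> t)"
    and pow3: "(s \<otimes> t) [^] (3::nat) = (s \<otimes> t \<otimes> s) \<otimes> (t \<otimes> s \<otimes> t)"
    using s t by (simp_all add: numeral_2_eq_2 numeral_3_eq_3 m_assoc)
  have one: "x \<otimes> x = \<one>" if "x = y \<otimes> z" "x = z \<otimes> y" "y \<in> carrier G" "z \<in> carrier G" "y \<otimes> y = \<one>" "z \<otimes> z = \<one>" for x y z
  proof -
    have "x \<otimes> x = (y \<otimes> z) \<otimes> (z \<otimes> y)" using that(1,2) by metis
    also have "\<dots> = y \<otimes> (z \<otimes> z) \<otimes> y" using that(3,4) by (simp add: m_assoc)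
    finally show ?thesis using that by simp
  qed
  have "\<exists>n::nat. 0 < n \<and> n \<le> 3 \<and> (s \<otimes> t) [^] n = \<one>"
    using rel
  proof
    assume "s \<otimes> t = t \<otimes> s"
    then have "(s \<otimes> t) [^] (2::nat) = \<one>" unfolding pow2 using one[of "s \<otimes> t" s t] s t by simp
    then show ?thesis by (intro exI[of _ "2::nat"]) simp
  next
    assume r: "s \<otimes> t \<otimes> s = t \<otimes> s \<otimes> t"
    have "(s \<otimes> t \<otimes> s) \<otimes> (s \<otimes> t \<otimes> s) = s \<otimes> t \<otimes> (s \<otimes> s) \<otimes> t \<otimes> s" using s(1) t(1) by (simp add: m_assoc)
    also have "\<dots> = s \<otimes> (t \<otimes> t) \<otimes> s" using s t by (simp add: m_assoc)
    finally have "(s \<otimes> t) [^] (3::nat) = \<one>" unfolding pow3 r[symmetric] using s t by simp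
    then show ?thesis by (intro exI[of _ "3::nat"]) simp
  qed
  then obtain n :: nat where n: "0 < n" "n \<le> 3" "ord (s \<otimes> t) dvd n" using pow_eq_id[OF st] by auto
  then show ?thesis
    unfolding order_at_most_def using dvd_imp_le[OF n(3,1)] dvd_pos_nat[OF n(1,3)] by simp
qed

context generic_monster_algebra
begin

text \<open>
  By \<open>tau_conj\<close>, an axis \<open>y\<close> that is fixed by the involution of \<open>x\<close> has an involution that
  commutes with it, and the braid relation expresses that \<open>\<tau>\<^sub>a b\<close> and \<open>\<tau>\<^sub>b a\<close> have the same
  involution.
\<close>

lemma tau_commute_or_braid:
  assumes a: "primitive_axis a" and b: "primitive_axis b"
  shows "tau a \<circ> tau b = tau b \<circ> tau a \<or> tau a \<circ> tau b \<circ> tau a = tau b \<circ> tau a \<circ> tau b"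
proof -
  obtain A where A: "dihedral A" "A 0 = a" "A 1 = b" using dihedral_exists[OF a b] by blast
  have t: "tau a b = A (- 1)" "tau b a = A 2"
    using dihedral_tau[OF A(1), of 0 1] dihedral_tau[OF A(1), of 1 0] A by simp_all
  have comm: "tau x \<circ> tau y = tau y \<circ> tau x" if x: "primitive_axis x" and y: "primitive_axis y" and xy: "tau x y = y" for x y
  proof
    fix v
    show "(tau x \<circ> tau y) v = (tau y \<circ> tau x) v"
      using tau_conj[OF x y, of "tau x v"] by (simp add: tau_tau[OF x] xy)
  qed
  from two_axes[OF A(1)] show ?thesis
  proof (elim disjE)
    assume "A 0 \<in> inv_space A"
    then have "tau (A 1) (A 0) = A 0" unfolding inv_space_def by blast
    then have "tau b \<circ> tau a = tau a \<circ> tau b" using comm[OF b a] A by simp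
    then show ?thesis by simp
  next
    assume "A 1 \<in> inv_space A"
    then have "tau (A 0) (A 1) = A 1" unfolding inv_space_def by blast
    then show ?thesis using comm[OF a b] A by simp
  next
    assume "A (- 1) = A 2"
    then have "tau a b = tau b a" by (simp add: t)
    then have "tau a \<circ> tau b \<circ> tau a = tau b \<circ> tau a \<circ> tau b"
      by (intro ext) (metis comp_apply tau_conj[OF a b] tau_conj[OF b a])
    then show ?thesis ..
  qed
qed

abbreviation "M \<equiv> miyamoto_group"
abbreviation "B \<equiv> BijGroup (UNIV :: 'w set)"

text \<open>
  On the whole type every function is extensional, so the group operation is plain
  composition.
\<close>

lemma bij_group_ops:
  "f \<in> carrier B \<longleftrightarrow> bij f" "\<one>\<^bsub>B\<^esub> = id" "bij f \<Longrightarrow> bij g \<Longrightarrow> f \<otimes>\<^bsub>B\<^esub> g = f \<circ> g"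
  by (auto simp: BijGroup_def Bij_def compose_def fun_eq_iff)

lemma tau_in_bij_group: "primitive_axis a \<Longrightarrow> tau a \<in> carrier B"
  by (simp add: bij_group_ops(1) automorphism_bij automorphism_tau)

lemma miyamoto_subgroup: "subgroup (carrier M) B"
  unfolding miyamoto_group_def
  using group.generate_is_subgroup[OF group_BijGroup, of "tau ` {a. primitive_axis a}" UNIV] tau_in_bij_group by auto

lemma group_miyamoto: "group M"
  using subgroup.subgroup_is_group[OF miyamoto_subgroup group_BijGroup] by (simp add: miyamoto_group_def)

lemma miyamoto_ops: "\<one>\<^bsub>M\<^esub> = id" "f \<in> carrier M \<Longrightarrow> g \<in> carrier M \<Longrightarrow> f \<otimes>\<^bsub>M\<^esub> g = f \<circ> g"
  using bij_group_ops subgroup.mem_carrier[OF miyamoto_subgroup] by (auto simp: miyamoto_group_def)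

lemma tau_in_miyamoto: "primitive_axis a \<Longrightarrow> tau a \<in> carrier M"
  by (auto simp: miyamoto_group_def intro: generate.incl)

lemma tau_square: "primitive_axis a \<Longrightarrow> tau a \<otimes>\<^bsub>M\<^esub> tau a = \<one>\<^bsub>M\<^esub>"
  by (auto simp: miyamoto_ops tau_in_miyamoto tau_tau)

lemma miyamoto_automorphism:
  assumes "g \<in> carrier M"
  shows "automorphism g"
proof -
  interpret B: group B by (rule group_BijGroup)
  have "g \<in> generate B (tau ` {a. primitive_axis a})" using assms by (simp add: miyamoto_group_def)
  then show ?thesis
  proof induction
    case one
    show ?case unfolding bij_group_ops(2) by (rule automorphism_id)
  next
    case (incl h)
    then show ?case using automorphism_tau by blast
  next
    case (inv h)
    then obtain a where a: "primitive_axis a" "h = tau a" by blast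
    have "bij (tau a)" by (rule automorphism_bij[OF automorphism_tau[OF a(1)]])
    then have "inv\<^bsub>B\<^esub> h = h"
      using tau_in_bij_group[OF a(1)] by (intro B.inv_equality) (auto simp: a bij_group_ops tau_tau)
    then show ?case using a automorphism_tau by simp
  next
    case (eng h h')
    then show ?case
      unfolding bij_group_ops(3)[OF automorphism_bij[OF eng(3)] automorphism_bij[OF eng(4)]] by (intro automorphism_comp)
  qed
qed

lemma tau_product_order:
  assumes a: "primitive_axis a" and b: "primitive_axis b"
  shows "order_at_most M 3 (tau a \<otimes>\<^bsub>M\<^esub> tau b)"
proof -
  interpret M: group M by (rule group_miyamoto)
  note in_M = tau_in_miyamoto[OF a] tau_in_miyamoto[OF b]
  have "tau a \<circ> tau b \<in> carrier M" "tau b \<circ> tau a \<in> carrier M"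
    using M.m_closed[OF in_M] M.m_closed[OF in_M(2,1)] by (simp_all add: miyamoto_ops in_M)
  then have "tau a \<otimes>\<^bsub>M\<^esub> tau b = tau b \<otimes>\<^bsub>M\<^esub> tau a
      \<or> tau a \<otimes>\<^bsub>M\<^esub> tau b \<otimes>\<^bsub>M\<^esub> tau a = tau b \<otimes>\<^bsub>M\<^esub> tau a \<otimes>\<^bsub>M\<^esub> tau b"
    using tau_commute_or_braid[OF a b] by (simp add: miyamoto_ops in_M)
  then show ?thesis
    by (rule M.involutions_order_at_most_3[OF in_M(1) tau_square[OF a] in_M(2) tau_square[OF b]])
qed

lemma miyamoto_conj:
  assumes g: "g \<in> carrier M" and a: "primitive_axis a"
  shows "g \<otimes>\<^bsub>M\<^esub> tau a \<otimes>\<^bsub>M\<^esub> inv\<^bsub>M\<^esub> g = tau (g a)"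
proof -
  interpret M: group M by (rule group_miyamoto)
  note aut = miyamoto_automorphism[OF g]
  note in_M = g tau_in_miyamoto[OF a] tau_in_miyamoto[OF axis_image[OF aut a]]
  have "g \<otimes>\<^bsub>M\<^esub> tau a = tau (g a) \<otimes>\<^bsub>M\<^esub> g"
    by (simp add: miyamoto_ops in_M fun_eq_iff tau_image[OF aut a])
  then show ?thesis using in_M by (simp add: M.m_assoc)
qed

text \<open>
  An axis without \<open>\<beta>\<close>-eigenvectors has a trivial involution, which must be left out of the
  class of transpositions; it does not contribute to the generated group.
\<close>

theorem three_transposition_miyamoto: "three_transposition_group M"
proof -
  interpret M: group M by (rule group_miyamoto)
  define D where "D = {tau a | a. primitive_axis a \<and> tau a \<noteq> \<one>\<^bsub>M\<^esub>}"
  have D: "D \<subseteq> carrier M" unfolding D_def using tau_in_miyamoto by auto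
  have gen: "generate M D = carrier M"
  proof
    show "generate M D \<subseteq> carrier M" by (rule M.generate_incl[OF D])
    have tau_gen: "tau a \<in> generate M D" if "primitive_axis a" for a
      using that generate.one[of M D] generate.incl[of "tau a" D M] by (cases "tau a = \<one>\<^bsub>M\<^esub>") (auto simp: D_def)
    have eq: "generate M D = generate B D"
      using group.generate_consistent[OF group_BijGroup D miyamoto_subgroup] by (simp add: miyamoto_group_def)
    have "subgroup (generate M D) B"
      unfolding eq using D subgroup.subset[OF miyamoto_subgroup]
      by (intro group.generate_is_subgroup[OF group_BijGroup]) blast
    from group.generate_subgroup_incl[OF group_BijGroup _ this, of "tau ` {a. primitive_axis a}"]
    show "carrier M \<subseteq> generate M D" using tau_gen by (auto simp: miyamoto_group_def)
  qed
  have conj: "g \<otimes>\<^bsub>M\<^esub> d \<otimes>\<^bsub>M\<^esub> inv\<^bsub>M\<^esub> g \<in> D" if g: "g \<in> carrier M" and d: "d \<in> D" for g d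
  proof -
    from d obtain a where a: "d = tau a" "primitive_axis a" "tau a \<noteq> \<one>\<^bsub>M\<^esub>" unfolding D_def by blast
    have ga: "primitive_axis (g a)" by (rule axis_image[OF miyamoto_automorphism[OF g] a(2)])
    have "tau (g a) \<noteq> \<one>\<^bsub>M\<^esub>"
    proof
      assume "tau (g a) = \<one>\<^bsub>M\<^esub>"
      then have "g \<otimes>\<^bsub>M\<^esub> tau a = g"
        using miyamoto_conj[OF g a(2)] g tau_in_miyamoto[OF a(2)] by (metis M.inv_solve_right M.l_one M.m_closed M.one_closed)
      then show False using a(3) g tau_in_miyamoto[OF a(2)] by simp
    qed
    then show ?thesis unfolding a(1) miyamoto_conj[OF g a(2)] D_def using ga by blast
  qed
  have ord2: "M.ord d = 2" if d: "d \<in> D" for d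
  proof -
    from d obtain a where a: "d = tau a" "primitive_axis a" "tau a \<noteq> \<one>\<^bsub>M\<^esub>" unfolding D_def by blast
    have "d [^]\<^bsub>M\<^esub> (2::nat) = \<one>\<^bsub>M\<^esub>"
      using tau_square[OF a(2)] tau_in_miyamoto[OF a(2)] by (simp add: a(1) numeral_2_eq_2)
    then have "M.ord d dvd 2" using M.pow_eq_id D d by blast
    moreover have "M.ord d \<noteq> 1" using M.ord_eq_1 D d a by blast
    ultimately show ?thesis by (metis prime_nat_iff two_is_prime_nat)
  qed
  have "order_at_most M 3 (c \<otimes>\<^bsub>M\<^esub> d)" if "c \<in> D" "d \<in> D" for c d
    using that tau_product_order unfolding D_def by blast
  then show ?thesis
    unfolding three_transposition_group_def
    by (intro conjI group_miyamoto exI[of _ D] ballI D gen conj ord2)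
qed

end

theorem corollary1p4:
  fixes scale :: "ratfun2 \<Rightarrow> 'w::ab_group_add \<Rightarrow> 'w"
    and mult :: "'w \<Rightarrow> 'w \<Rightarrow> 'w"
  assumes "fg_primitive_axial_algebra scale mult indet_alpha indet_beta"
  defines "M \<equiv> monster_algebra.miyamoto_group scale mult indet_alpha indet_beta"
    and "\<tau> \<equiv> monster_algebra.miyamoto_involution scale mult indet_alpha indet_beta"
    and "axis \<equiv> monster_algebra.primitive_axis scale mult indet_alpha indet_beta"
  shows "three_transposition_group M \<and>
    (\<forall>a b. axis a \<longrightarrow> axis b \<longrightarrow> order_at_most M 3 (\<tau> a \<otimes>\<^bsub>M\<^esub> \<tau> b))"
proof -
  interpret fg_primitive_axial_algebra scale mult indet_alpha indet_beta by (rule assms(1))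
  interpret generic_monster_algebra scale mult indet_alpha indet_beta
    by unfold_locales (rule specializes_ratfun2)
  show ?thesis
    unfolding M_def \<tau>_def axis_def using three_transposition_miyamoto tau_product_order by blast
qed

end
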